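(* Let $h>0$ and let $\gamma_1:[t_1,+\infty)\to E^N$ and $\gamma_2:[t_2,+\infty)\to E^N$ be two hyperbolic geodesic rays of energy $h$. The following are equivalent: (1) the Euclidean distance $\|\gamma_1(t)-\gamma_2(t)\|$ is bounded (for $t\ge\max(t_1,t_2)$); (2) the Jacobi-Maupertuis distance $\phi_h(\gamma_1(t),\gamma_2(t))$ is bounded (for $t\ge\max(t_1,t_2)$); (3) $\gamma_1$ and $\gamma_2$ have the same limit shape; (4) the corresponding Busemann functions $b_{\gamma_1}$ and $b_{\gamma_2}$ differ by a constant.
   Context: Setting: $E$ is a Euclidean space of finite dimension $d\ge 2$, $N\ge 2$, and $m_1,\dots,m_N>0$ are masses. For $x=(r_1,\dots,r_N)\in E^N$, $U(x)=\sum_{i<j}m_im_j\|r_i-r_j\|_E^{-1}$ (with value $+\infty$ at collisions), and $\Omega=\{x\in E^N: r_i\ne r_j\ \forall i\neq j\}$. $E^N$ carries the mass inner product $\langle (r_i),(s_i)\rangle=\sum_i m_i\langle r_i,s_i\rangle_E$, with norm $\|\cdot\|$; gradients are taken with respect to it. A motion is a solution $x:I\to\Omega$ of $\ddot x=\nabla U(x)$; its energy $\frac12\|\dot x\|^2-U(x)$ is constant. A hyperbolic motion is a motion defined on an interval unbounded to the right with $x(t)=ta+o(t)$ as $t\to+\infty$ for some $a\in\Omega$; $a$ is called its limit shape (its energy is then $\frac12\|a\|^2$). For $h\ge 0$ and an absolutely continuous curve $\gamma:[s_0,s_1]\to E^N$, $\mathcal A_{L+h}(\gamma)=\int_{s_0}^{s_1}\big(\frac12\|\dot\gamma\|^2+U(\gamma)+h\big)dt\in[0,+\infty]$,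 and the Jacobi-Maupertuis distance $\phi_h(x,y)$ is the infimum of $\mathcal A_{L+h}(\gamma)$ over all absolutely continuous curves from $x$ to $y$ defined on compact intervals of arbitrary positive length. It is a distance on $E^N$. A hyperbolic geodesic ray (of energy $h>0$) is an absolutely continuous curve $\gamma:[t_0,+\infty)\to E^N$ such that $\gamma|_{(t_0,+\infty)}$ is a hyperbolic motion of energy $h$ and $\mathcal A_{L+h}(\gamma|_{[t_0,t]})=\phi_h(\gamma(t_0),\gamma(t))$ for all $t>t_0$. Its Busemann function is $b_\gamma(x)=\lim_{t\to+\infty}\big[\phi_h(x,\gamma(t))-\phi_h(\gamma(t),\gamma(t_0))\big]$, $x\in E^N$ (the limit exists). *)

theory Defs
  imports "HOL-Analysis.Analysis" "HOL-Library.Landau_Symbols"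
begin

text \<open>
  The Euclidean space \<open>E\<close> is a type \<open>'a::euclidean_space\<close>, and \<open>E\<^sup>N\<close> is
  \<open>'a ^ 'n\<close>, that is, \<open>('a, 'n) vec\<close>, with \<open>N = CARD('n)\<close>; the linear order on the index type
  is only used to sum over pairs \<open>i < j\<close>.
  The library's inner product and norm on \<open>'a ^ 'n\<close> are not weighted by the masses, hence
  \<open>mass_inner\<close> and \<open>mass_norm\<close>. For positive masses the two norms are equivalent, so that limits,
  derivatives of curves and absolute continuity can be expressed with the library's one.
\<close>

definition mass_inner :: "('n::finite \<Rightarrow> real) \<Rightarrow> ('a::euclidean_space, 'n) vec \<Rightarrow> ('a, 'n) vec \<Rightarrow> real" where
  "mass_inner m x y = (\<Sum>i\<in>UNIV. m i * (x $ i \<bullet> y $ i))"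

definition mass_norm :: "('n::finite \<Rightarrow> real) \<Rightarrow> ('a::euclidean_space, 'n) vec \<Rightarrow> real" where
  "mass_norm m x = sqrt (mass_inner m x x)"

definition has_mass_gradient ::
    "('n::finite \<Rightarrow> real) \<Rightarrow> (('a::euclidean_space, 'n) vec \<Rightarrow> real) \<Rightarrow> ('a, 'n) vec \<Rightarrow> ('a, 'n) vec \<Rightarrow> bool" where
  "has_mass_gradient m f x g \<longleftrightarrow> (f has_derivative mass_inner m g) (at x)"

definition Omega :: "('a::euclidean_space, 'n::finite) vec set" where
  "Omega = {x. \<forall>i j. i \<noteq> j \<longrightarrow> x $ i \<noteq> x $ j}"

text \<open>Division by zero in \<^typ>\<open>ennreal\<close> yields \<open>\<infinity>\<close> for a nonzero numerator, which gives the value of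
  the potential at collisions (see \<open>potential_eq_top_iff\<close>).\<close>

definition potential ::
    "('n::{finite,linorder} \<Rightarrow> real) \<Rightarrow> ('a::euclidean_space, 'n) vec \<Rightarrow> ennreal" where
  "potential m x =
     (\<Sum>(i, j)\<in>{(i, j). i < j}. ennreal (m i * m j) / ennreal (norm (x $ i - x $ j)))"

lemma potential_eq_top_iff:
  fixes m :: "'n::{finite,linorder} \<Rightarrow> real" and x :: "('a::euclidean_space, 'n) vec"
  assumes "\<And>i. m i > 0"
  shows "potential m x = \<infinity> \<longleftrightarrow> x \<notin> Omega"
proof -
  have "potential m x = \<infinity> \<longleftrightarrow> (\<exists>i j. i < j \<and> x $ i = x $ j)"
    using assms by (auto simp: potential_def ennreal_divide_eq_top_iff ennreal_eq_0_iff not_le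
        infinity_ennreal_def)
  also have "\<dots> \<longleftrightarrow> x \<notin> Omega"
    unfolding Omega_def mem_Collect_eq by (metis linorder_neqE less_irrefl)
  finally show ?thesis .
qed

lemma enn2real_potential:
  fixes m :: "'n::{finite,linorder} \<Rightarrow> real" and x :: "('a::euclidean_space, 'n) vec"
  assumes "\<And>i. m i > 0" "x \<in> Omega"
  shows "enn2real (potential m x) = (\<Sum>(i, j)\<in>{(i, j). i < j}. m i * m j / norm (x $ i - x $ j))"
proof -
  have "potential m x = (\<Sum>p\<in>{(i, j). i < j}.
      ennreal (m (fst p) * m (snd p) / norm (x $ fst p - x $ snd p)))"
    unfolding potential_def using assms
    by (intro sum.cong) (auto simp: Omega_def divide_ennreal less_imp_le)
  also have "\<dots> = ennreal (\<Sum>p\<in>{(i, j). i < j}.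
      m (fst p) * m (snd p) / norm (x $ fst p - x $ snd p))"
    using assms by (intro sum_ennreal) (simp add: less_imp_le)
  finally show ?thesis
    using assms by (simp add: sum_nonneg less_imp_le case_prod_unfold)
qed

text \<open>By \<open>enn2real_potential\<close>, on \<^const>\<open>Omega\<close> (an open set) \<open>enn2real \<circ> potential m\<close> is the usual
  real-valued potential. At a boundary point of \<open>I\<close> that belongs to \<open>I\<close> the derivatives are one-sided.\<close>

definition motion ::
    "('n::{finite,linorder} \<Rightarrow> real) \<Rightarrow> real set \<Rightarrow> (real \<Rightarrow> ('a::euclidean_space, 'n) vec) \<Rightarrow> bool" where
  "motion m I x \<longleftrightarrow>
     is_interval I \<and> interior I \<noteq> {} \<and> x ` I \<subseteq> Omega \<and>
     (\<exists>v a. \<forall>t\<in>I.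
        (x has_vector_derivative v t) (at t within I) \<and>
        (v has_vector_derivative a t) (at t within I) \<and>
        has_mass_gradient m (\<lambda>y. enn2real (potential m y)) (x t) (a t))"

definition has_energy ::
    "('n::{finite,linorder} \<Rightarrow> real) \<Rightarrow> real set \<Rightarrow> (real \<Rightarrow> ('a::euclidean_space, 'n) vec) \<Rightarrow> real \<Rightarrow> bool"
  where
  "has_energy m I x h \<longleftrightarrow>
     (\<forall>t\<in>I. 1 / 2 * (mass_norm m (vector_derivative x (at t within I)))\<^sup>2
              - enn2real (potential m (x t)) = h)"

definition has_limit_shape ::
    "('n::finite \<Rightarrow> real) \<Rightarrow> (real \<Rightarrow> ('a::euclidean_space, 'n) vec) \<Rightarrow> ('a, 'n) vec \<Rightarrow> bool" where
  "has_limit_shape m x a \<longleftrightarrow>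
     a \<in> Omega \<and> (\<lambda>t. mass_norm m (x t - t *\<^sub>R a)) \<in> o[at_top](\<lambda>t. t)"

definition hyperbolic_motion ::
    "('n::{finite,linorder} \<Rightarrow> real) \<Rightarrow> real set \<Rightarrow> (real \<Rightarrow> ('a::euclidean_space, 'n) vec) \<Rightarrow> bool" where
  "hyperbolic_motion m I x \<longleftrightarrow>
     motion m I x \<and> \<not> bdd_above I \<and> (\<exists>a. has_limit_shape m x a)"

text \<open>The usual \<open>\<epsilon>\<close>-\<open>\<delta>\<close> definition; \<open>D\<close> is a finite family of nonoverlapping compact intervals
  \<open>[a, b]\<close>, each represented by the pair \<open>(a, b)\<close>.\<close>

definition abs_continuous_on :: "real set \<Rightarrow> (real \<Rightarrow> 'b::real_normed_vector) \<Rightarrow> bool" where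
  "abs_continuous_on S f \<longleftrightarrow>
     (\<forall>\<epsilon>>0. \<exists>\<delta>>0. \<forall>D.
        finite D \<and> (\<forall>(a, b)\<in>D. a \<le> b \<and> {a..b} \<subseteq> S) \<and>
        pairwise (\<lambda>(a, b) (c, d). {a<..<b} \<inter> {c<..<d} = {}) D \<and>
        (\<Sum>(a, b)\<in>D. b - a) < \<delta>
        \<longrightarrow> (\<Sum>(a, b)\<in>D. norm (f b - f a)) < \<epsilon>)"

text \<open>Only used for \<open>h \<ge> 0\<close> (\<^const>\<open>ennreal\<close> truncates negative reals) and for absolutely continuous
  curves, which are differentiable almost everywhere.\<close>

definition action ::
    "('n::{finite,linorder} \<Rightarrow> real) \<Rightarrow> real \<Rightarrow> real \<Rightarrow> real \<Rightarrow> (real \<Rightarrow> ('a::euclidean_space, 'n) vec) \<Rightarrow> ennreal"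
  where
  "action m h s0 s1 \<gamma> =
     (\<integral>\<^sup>+ t\<in>{s0..s1}.
        (ennreal (1 / 2 * (mass_norm m (vector_derivative \<gamma> (at t within {s0..s1})))\<^sup>2)
         + potential m (\<gamma> t) + ennreal h) \<partial>lborel)"

definition jm_dist ::
    "('n::{finite,linorder} \<Rightarrow> real) \<Rightarrow> real \<Rightarrow> ('a::euclidean_space, 'n) vec \<Rightarrow> ('a, 'n) vec \<Rightarrow> ennreal" where
  "jm_dist m h x y =
     Inf {action m h s0 s1 \<gamma> | s0 s1 \<gamma>.
            s0 < s1 \<and> abs_continuous_on {s0..s1} \<gamma> \<and> \<gamma> s0 = x \<and> \<gamma> s1 = y}"

definition hyperbolic_geodesic_ray ::
    "('n::{finite,linorder} \<Rightarrow> real) \<Rightarrow> real \<Rightarrow> real \<Rightarrow> (real \<Rightarrow> ('a::euclidean_space, 'n) vec) \<Rightarrow> bool" where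
  "hyperbolic_geodesic_ray m h t0 \<gamma> \<longleftrightarrow>
     (\<forall>t>t0. abs_continuous_on {t0..t} \<gamma>) \<and>
     hyperbolic_motion m {t0<..} \<gamma> \<and> has_energy m {t0<..} \<gamma> h \<and>
     (\<forall>t>t0. action m h t0 t \<gamma> = jm_dist m h (\<gamma> t0) (\<gamma> t))"

definition busemann ::
    "('n::{finite,linorder} \<Rightarrow> real) \<Rightarrow> real \<Rightarrow> real \<Rightarrow> (real \<Rightarrow> ('a::euclidean_space, 'n) vec)
       \<Rightarrow> ('a, 'n) vec \<Rightarrow> real" where
  "busemann m h t0 \<gamma> x =
     Lim at_top (\<lambda>t. enn2real (jm_dist m h x (\<gamma> t)) - enn2real (jm_dist m h (\<gamma> t) (\<gamma> t0)))"

end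

theory Submission
  imports Defs "HOL-Real_Asymp.Real_Asymp"
begin

text \<open>
  Let \<open>k = sqrt (2 * h)\<close> and let \<open>d\<close> be the Jacobi-Maupertuis distance. Always \<open>d x y \<ge> k * norm (x - y)\<close> in
  the mass norm, and limit shapes of rays of energy \<open>h\<close> have norm \<open>k\<close>. Around the half-line of a limit shape \<open>a\<close>
  the potential is of order \<open>1 / t\<close> at distance of order \<open>t\<close>, so the action of segments shows that \<open>d\<close> exceeds
  the lower bound there by \<open>O(norm (x - y) / t)\<close> only.

  If two rays have the same limit shape, the forces along them are \<open>O(t\<^sup>-\<^sup>2)\<close> and differ by
  \<open>O(t\<^sup>-\<^sup>5\<^sup>/\<^sup>2)\<close>; two integrations give a bounded difference of the positions, hence bounded distances.
  A nearly minimizing curve from any \<open>x\<close> to \<open>\<gamma>2 t\<close> arrives in the direction of \<open>a\<close>, so that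
  \<open>d x (\<gamma>1 t) - d x (\<gamma>2 t) - a \<bullet> (\<gamma>1 t - \<gamma>2 t)\<close> tends to \<open>0\<close> for every \<open>x\<close>; thus the Busemann functions differ
  by a constant.

  Conversely, let the limit shapes \<open>a1\<close> and \<open>a\<close> of the two rays be different. Along \<open>\<gamma>1\<close> the Busemann function
  of \<open>\<gamma>1\<close> is at most \<open>- k\<^sup>2 * s + o(s)\<close>. That of \<open>\<gamma>2\<close> at \<open>\<gamma>1 s\<close> is at least \<open>- (k\<^sup>2 - g / 2) * s\<close> with
  \<open>g = k\<^sup>2 - a \<bullet> a1 > 0\<close>: a nearly minimizing curve from \<open>\<gamma>1 s\<close> to \<open>\<gamma>2 T\<close> passes through the cone around
  the half-line of \<open>a\<close> at a distance comparable to \<open>s\<close>, uniformly in \<open>T\<close>.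
\<close>

subsection \<open>Absolutely continuous curves\<close>

text \<open>No minimizing curve is ever shown to exist: \<open>jm_dist\<close> is an infimum over
  all absolutely continuous curves, and an almost minimizing one serves only through the points
  where it crosses a level of a continuous function. Bounding the action of an arbitrary competitor
  from below requires differentiability almost everywhere and the fundamental theorem of calculus
  for absolutely continuous curves, which explains the long real-analytic beginning. The exponents
  come from the error terms. Excesses over the straight cost that are linear in the scale
  \<open>s\<close> of the starting point or logarithmic are all weakened to
  \<open>sqrt (s * \<xi>)\<close> for a target at scale \<open>\<xi>\<close>. In Euclidean geometry
  such an excess permits a relative sideways deviation of order \<open>s / \<xi>\<close> to the
  power 1/4 only, which is still summable over \<open>\<xi>\<close>, \<open>\<xi> / 2\<close>,
  \<open>\<xi> / 4\<close>, ... and small in total if the descent stops at a large fixed multiple of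
  \<open>s\<close>. At that scale the logarithmic excess is bounded, hence negligible against the
  linear gap \<open>g * s\<close>.\<close>

lemma abs_continuous_on_family:
  assumes "abs_continuous_on S f" "\<epsilon> > 0"
  shows "\<exists>\<delta>>0. \<forall>(I::'i set) u v. finite I \<and> (\<forall>i\<in>I. u i \<le> v i \<and> {u i..v i} \<subseteq> S) \<and>
      (\<forall>i\<in>I. \<forall>j\<in>I. i \<noteq> j \<longrightarrow> {u i<..<v i} \<inter> {u j<..<v j} = {}) \<and> (\<Sum>i\<in>I. v i - u i) < \<delta> \<longrightarrow>
      (\<Sum>i\<in>I. norm (f (v i) - f (u i))) < \<epsilon>"
proof -
  obtain \<delta> where \<delta>: "\<delta> > 0" and D: "\<And>D. finite D \<Longrightarrow> (\<forall>(a, b)\<in>D. a \<le> b \<and> {a..b} \<subseteq> S) \<Longrightarrow>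
        pairwise (\<lambda>(a, b) (c, d). {a<..<b} \<inter> {c<..<d} = {}) D \<Longrightarrow>
        (\<Sum>(a, b)\<in>D. b - a) < \<delta> \<Longrightarrow> (\<Sum>(a, b)\<in>D. norm (f b - f a)) < \<epsilon>"
    using assms unfolding abs_continuous_on_def by meson
  show ?thesis
  proof (intro exI[of _ \<delta>] conjI allI impI \<delta>)
    fix I :: "'i set" and u v
    assume *: "finite I \<and> (\<forall>i\<in>I. u i \<le> v i \<and> {u i..v i} \<subseteq> S) \<and>
      (\<forall>i\<in>I. \<forall>j\<in>I. i \<noteq> j \<longrightarrow> {u i<..<v i} \<inter> {u j<..<v j} = {}) \<and> (\<Sum>i\<in>I. v i - u i) < \<delta>"
    \<comment> \<open>Two indices can share a pair only if its interval is degenerate, as the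
      interiors are disjoint. Degenerate members contribute 0 to both sums and are dropped; then the
      passage to a set of pairs is injective.\<close>
    define J where "J = {i\<in>I. u i < v i}"
    define g where "g i = (u i, v i)" for i
    have inj: "inj_on g J"
    proof (rule inj_onI, rule ccontr)
      fix i j assume ij: "i \<in> J" "j \<in> J" "g i = g j" "i \<noteq> j"
      then have "{u i<..<v i} \<inter> {u j<..<v j} = {}"
        using * unfolding J_def by blast
      with ij show False by (auto simp: J_def g_def)
    qed
    have s: "sum F I = sum F J" if "\<And>i. i \<in> I \<Longrightarrow> u i = v i \<Longrightarrow> F i = 0" for F :: "'i \<Rightarrow> real"
      using * that by (intro sum.mono_neutral_right) (force simp: J_def)+
    have "(\<Sum>(a, b)\<in>g ` J. norm (f b - f a)) < \<epsilon>"
    proof (rule D)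
      show "finite (g ` J)" using * by (simp add: J_def)
      show "\<forall>(a, b)\<in>g ` J. a \<le> b \<and> {a..b} \<subseteq> S" using * by (auto simp: J_def g_def)
      show "pairwise (\<lambda>(a, b) (c, d). {a<..<b} \<inter> {c<..<d} = {}) (g ` J)"
        using * unfolding pairwise_def J_def g_def by auto
      have "(\<Sum>(a, b)\<in>g ` J. b - a) = (\<Sum>i\<in>J. v i - u i)"
        by (subst sum.reindex[OF inj]) (simp add: g_def)
      then show "(\<Sum>(a, b)\<in>g ` J. b - a) < \<delta>" using * s[of "\<lambda>i. v i - u i"] by simp
    qed
    also have "(\<Sum>(a, b)\<in>g ` J. norm (f b - f a)) = (\<Sum>i\<in>J. norm (f (v i) - f (u i)))"
      by (subst sum.reindex[OF inj]) (simp add: g_def)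
    also have "\<dots> = (\<Sum>i\<in>I. norm (f (v i) - f (u i)))"
      using s[of "\<lambda>i. norm (f (v i) - f (u i))"] by simp
    finally show "(\<Sum>i\<in>I. norm (f (v i) - f (u i))) < \<epsilon>" .
  qed
qed

lemma abs_continuous_onE:
  assumes "abs_continuous_on S f" "\<epsilon> > 0"
  obtains \<delta> where "\<delta> > 0" "\<And>(I::'i set) u v. finite I \<Longrightarrow> (\<forall>i\<in>I. u i \<le> v i \<and> {u i..v i} \<subseteq> S) \<Longrightarrow>
      (\<forall>i\<in>I. \<forall>j\<in>I. i \<noteq> j \<longrightarrow> {u i<..<v i} \<inter> {u j<..<v j} = {}) \<Longrightarrow> (\<Sum>i\<in>I. v i - u i) < \<delta> \<Longrightarrow>
      (\<Sum>i\<in>I. norm (f (v i) - f (u i))) < \<epsilon>"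
proof -
  from abs_continuous_on_family[OF assms, where 'i='i]
  obtain \<delta> where \<delta>: "\<delta> > 0" and *: "\<forall>(I::'i set) u v. finite I \<and> (\<forall>i\<in>I. u i \<le> v i \<and> {u i..v i} \<subseteq> S) \<and>
      (\<forall>i\<in>I. \<forall>j\<in>I. i \<noteq> j \<longrightarrow> {u i<..<v i} \<inter> {u j<..<v j} = {}) \<and> (\<Sum>i\<in>I. v i - u i) < \<delta> \<longrightarrow>
      (\<Sum>i\<in>I. norm (f (v i) - f (u i))) < \<epsilon>"
    by (elim exE conjE) (rule that)
  show thesis
    by (rule that[OF \<delta>]) (rule *[rule_format], intro conjI)
qed

lemma abs_continuous_onI:
  assumes "\<And>\<epsilon>. \<epsilon> > 0 \<Longrightarrow> \<exists>\<delta>>0. \<forall>D. finite D \<longrightarrow> (\<forall>p\<in>D. fst p \<le> snd p \<and> {fst p..snd p} \<subseteq> S) \<longrightarrow>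
      (\<forall>p\<in>D. \<forall>q\<in>D. p \<noteq> q \<longrightarrow> {fst p<..<snd p} \<inter> {fst q<..<snd q} = {}) \<longrightarrow>
      (\<Sum>p\<in>D. snd p - fst p) < \<delta> \<longrightarrow> (\<Sum>p\<in>D. norm (f (snd p) - f (fst p))) < \<epsilon>"
  shows "abs_continuous_on S f"
  unfolding abs_continuous_on_def
proof (intro allI impI)
  fix \<epsilon> :: real assume "\<epsilon> > 0"
  from assms[OF this] obtain \<delta> where d: "\<delta> > 0" "\<forall>D. finite D \<longrightarrow> (\<forall>p\<in>D. fst p \<le> snd p \<and> {fst p..snd p} \<subseteq> S) \<longrightarrow>
      (\<forall>p\<in>D. \<forall>q\<in>D. p \<noteq> q \<longrightarrow> {fst p<..<snd p} \<inter> {fst q<..<snd q} = {}) \<longrightarrow>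
      (\<Sum>p\<in>D. snd p - fst p) < \<delta> \<longrightarrow> (\<Sum>p\<in>D. norm (f (snd p) - f (fst p))) < \<epsilon>"
    by (elim exE conjE) (rule that)
  show "\<exists>\<delta>>0. \<forall>D. finite D \<and> (\<forall>(a, b)\<in>D. a \<le> b \<and> {a..b} \<subseteq> S) \<and>
        pairwise (\<lambda>(a, b) (c, d). {a<..<b} \<inter> {c<..<d} = {}) D \<and>
        (\<Sum>(a, b)\<in>D. b - a) < \<delta> \<longrightarrow> (\<Sum>(a, b)\<in>D. norm (f b - f a)) < \<epsilon>"
    using d unfolding pairwise_def by (intro exI[of _ \<delta>]) (auto simp: case_prod_beta)
qed

lemma abs_continuous_on_cong_subset:
  assumes "abs_continuous_on T f" "S \<subseteq> T" "\<And>t. t \<in> S \<Longrightarrow> f t = g t"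
  shows "abs_continuous_on S g"
proof (rule abs_continuous_onI)
  fix \<epsilon> :: real assume "\<epsilon> > 0"
  obtain \<delta> where d: "\<delta> > 0" "\<And>(I::(real \<times> real) set) u v. finite I \<Longrightarrow> (\<forall>i\<in>I. u i \<le> v i \<and> {u i..v i} \<subseteq> T) \<Longrightarrow>
      (\<forall>i\<in>I. \<forall>j\<in>I. i \<noteq> j \<longrightarrow> {u i<..<v i} \<inter> {u j<..<v j} = {}) \<Longrightarrow> (\<Sum>i\<in>I. v i - u i) < \<delta> \<Longrightarrow>
      (\<Sum>i\<in>I. norm (f (v i) - f (u i))) < \<epsilon>"
    by (rule abs_continuous_onE[OF assms(1) \<open>\<epsilon> > 0\<close>, where 'i="real \<times> real"]) (rule that)
  show "\<exists>\<delta>>0. \<forall>D. finite D \<longrightarrow> (\<forall>p\<in>D. fst p \<le> snd p \<and> {fst p..snd p} \<subseteq> S) \<longrightarrow>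
      (\<forall>p\<in>D. \<forall>q\<in>D. p \<noteq> q \<longrightarrow> {fst p<..<snd p} \<inter> {fst q<..<snd q} = {}) \<longrightarrow>
      (\<Sum>p\<in>D. snd p - fst p) < \<delta> \<longrightarrow> (\<Sum>p\<in>D. norm (g (snd p) - g (fst p))) < \<epsilon>"
  proof (intro exI[of _ \<delta>] conjI allI impI)
    fix D :: "(real \<times> real) set"
    assume *: "finite D" "\<forall>p\<in>D. fst p \<le> snd p \<and> {fst p..snd p} \<subseteq> S"
      "\<forall>p\<in>D. \<forall>q\<in>D. p \<noteq> q \<longrightarrow> {fst p<..<snd p} \<inter> {fst q<..<snd q} = {}" "(\<Sum>p\<in>D. snd p - fst p) < \<delta>"
    have "(\<Sum>p\<in>D. norm (g (snd p) - g (fst p))) = (\<Sum>p\<in>D. norm (f (snd p) - f (fst p)))"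
      using *(2) assms(3) by (intro sum.cong refl) (force simp: subset_eq)
    moreover have "\<forall>p\<in>D. fst p \<le> snd p \<and> {fst p..snd p} \<subseteq> T" using *(2) assms(2) by blast
    ultimately show "(\<Sum>p\<in>D. norm (g (snd p) - g (fst p))) < \<epsilon>" using d(2)[OF *(1) _ *(3,4)] by simp
  qed (fact d)
qed

lemma abs_continuous_on_subset: "abs_continuous_on T f \<Longrightarrow> S \<subseteq> T \<Longrightarrow> abs_continuous_on S f"
  by (rule abs_continuous_on_cong_subset) auto

text \<open>A monotone change of parameter keeps intervals nonoverlapping, and the Lipschitz
  constant controls their total length. The decreasing case is for reversing curves, the increasing
  one for translating and clamping them.\<close>

lemma abs_continuous_on_compose:
  assumes f: "abs_continuous_on {c..d} f" and L: "L > 0"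
    and g: "(\<forall>u v. a \<le> u \<and> u \<le> v \<and> v \<le> b \<longrightarrow> c \<le> g u \<and> g u \<le> g v \<and> g v \<le> d \<and> g v - g u \<le> L * (v - u)) \<or>
            (\<forall>u v. a \<le> u \<and> u \<le> v \<and> v \<le> b \<longrightarrow> c \<le> g v \<and> g v \<le> g u \<and> g u \<le> d \<and> g u - g v \<le> L * (v - u))"
  shows "abs_continuous_on {a..b} (\<lambda>t. f (g t))"
proof (rule abs_continuous_onI)
  fix \<epsilon> :: real assume "\<epsilon> > 0"
  obtain \<delta> where d: "\<delta> > 0" "\<And>(I::(real \<times> real) set) u v. finite I \<Longrightarrow> (\<forall>i\<in>I. u i \<le> v i \<and> {u i..v i} \<subseteq> {c..d}) \<Longrightarrow>
      (\<forall>i\<in>I. \<forall>j\<in>I. i \<noteq> j \<longrightarrow> {u i<..<v i} \<inter> {u j<..<v j} = {}) \<Longrightarrow> (\<Sum>i\<in>I. v i - u i) < \<delta> \<Longrightarrow>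
      (\<Sum>i\<in>I. norm (f (v i) - f (u i))) < \<epsilon>"
    by (rule abs_continuous_onE[OF f \<open>\<epsilon> > 0\<close>, where 'i="real \<times> real"]) (rule that)
  show "\<exists>\<delta>>0. \<forall>D. finite D \<longrightarrow> (\<forall>p\<in>D. fst p \<le> snd p \<and> {fst p..snd p} \<subseteq> {a..b}) \<longrightarrow>
      (\<forall>p\<in>D. \<forall>q\<in>D. p \<noteq> q \<longrightarrow> {fst p<..<snd p} \<inter> {fst q<..<snd q} = {}) \<longrightarrow>
      (\<Sum>p\<in>D. snd p - fst p) < \<delta> \<longrightarrow> (\<Sum>p\<in>D. norm (f (g (snd p)) - f (g (fst p)))) < \<epsilon>"
  proof (intro exI[of _ "\<delta> / L"] conjI allI impI)
    show "0 < \<delta> / L" using d L by simp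
    fix D :: "(real \<times> real) set"
    assume *: "finite D" "\<forall>p\<in>D. fst p \<le> snd p \<and> {fst p..snd p} \<subseteq> {a..b}"
      "\<forall>p\<in>D. \<forall>q\<in>D. p \<noteq> q \<longrightarrow> {fst p<..<snd p} \<inter> {fst q<..<snd q} = {}" "(\<Sum>p\<in>D. snd p - fst p) < \<delta> / L"
    have ab: "a \<le> fst p" "fst p \<le> snd p" "snd p \<le> b" if "p \<in> D" for p using that *(2) by force+
    have ord: "snd p \<le> fst q \<or> snd q \<le> fst p \<or> fst p = snd p \<or> fst q = snd q"
      if "p \<in> D" "q \<in> D" "p \<noteq> q" for p q
    proof (rule ccontr)
      assume n: "\<not> ?thesis"
      then have "max (fst p) (fst q) < min (snd p) (snd q)" using ab(2)[OF that(1)] ab(2)[OF that(2)] by auto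
      then obtain r where "max (fst p) (fst q) < r" "r < min (snd p) (snd q)" using dense by blast
      then have "r \<in> {fst p<..<snd p} \<inter> {fst q<..<snd q}" by auto
      then show False using *(3) that by blast
    qed
    have S: "L * (\<Sum>p\<in>D. snd p - fst p) < \<delta>" using *(4) L by (simp add: field_simps)
    from g show "(\<Sum>p\<in>D. norm (f (g (snd p)) - f (g (fst p)))) < \<epsilon>"
    proof
      assume g: "\<forall>u v. a \<le> u \<and> u \<le> v \<and> v \<le> b \<longrightarrow> c \<le> g u \<and> g u \<le> g v \<and> g v \<le> d \<and> g v - g u \<le> L * (v - u)"
      show ?thesis
      proof (rule d(2)[OF *(1), of "\<lambda>p. g (fst p)" "\<lambda>p. g (snd p)"])
        show "\<forall>i\<in>D. g (fst i) \<le> g (snd i) \<and> {g (fst i)..g (snd i)} \<subseteq> {c..d}"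
          using g ab by (metis atLeastatMost_subset_iff)
        have "(\<Sum>p\<in>D. g (snd p) - g (fst p)) \<le> (\<Sum>p\<in>D. L * (snd p - fst p))"
          using g ab by (intro sum_mono) blast
        with S show "(\<Sum>p\<in>D. g (snd p) - g (fst p)) < \<delta>" by (simp add: sum_distrib_left)
        show "\<forall>i\<in>D. \<forall>j\<in>D. i \<noteq> j \<longrightarrow> {g (fst i)<..<g (snd i)} \<inter> {g (fst j)<..<g (snd j)} = {}"
        proof (intro ballI impI)
          fix p q assume pq: "p \<in> D" "q \<in> D" "p \<noteq> q"
          have m: "g u \<le> g v" if "a \<le> u" "u \<le> v" "v \<le> b" for u v using g that by blast
          have "g (snd p) \<le> g (fst q) \<or> g (snd q) \<le> g (fst p) \<or> fst p = snd p \<or> fst q = snd q"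
            using ord[OF pq] m ab[OF pq(1)] ab[OF pq(2)] by (meson order_trans)
          then show "{g (fst p)<..<g (snd p)} \<inter> {g (fst q)<..<g (snd q)} = {}" by auto
        qed
      qed
    next
      assume g: "\<forall>u v. a \<le> u \<and> u \<le> v \<and> v \<le> b \<longrightarrow> c \<le> g v \<and> g v \<le> g u \<and> g u \<le> d \<and> g u - g v \<le> L * (v - u)"
      have "(\<Sum>p\<in>D. norm (f (g (fst p)) - f (g (snd p)))) < \<epsilon>"
      proof (rule d(2)[OF *(1), of "\<lambda>p. g (snd p)" "\<lambda>p. g (fst p)"])
        show "\<forall>i\<in>D. g (snd i) \<le> g (fst i) \<and> {g (snd i)..g (fst i)} \<subseteq> {c..d}"
          using g ab by (metis atLeastatMost_subset_iff)
        have "(\<Sum>p\<in>D. g (fst p) - g (snd p)) \<le> (\<Sum>p\<in>D. L * (snd p - fst p))"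
          using g ab by (intro sum_mono) blast
        with S show "(\<Sum>p\<in>D. g (fst p) - g (snd p)) < \<delta>" by (simp add: sum_distrib_left)
        show "\<forall>i\<in>D. \<forall>j\<in>D. i \<noteq> j \<longrightarrow> {g (snd i)<..<g (fst i)} \<inter> {g (snd j)<..<g (fst j)} = {}"
        proof (intro ballI impI)
          fix p q assume pq: "p \<in> D" "q \<in> D" "p \<noteq> q"
          have m: "g v \<le> g u" if "a \<le> u" "u \<le> v" "v \<le> b" for u v using g that by blast
          have "g (fst q) \<le> g (snd p) \<or> g (fst p) \<le> g (snd q) \<or> fst p = snd p \<or> fst q = snd q"
            using ord[OF pq] m ab[OF pq(1)] ab[OF pq(2)] by (meson order_trans)
          then show "{g (snd p)<..<g (fst p)} \<inter> {g (snd q)<..<g (fst q)} = {}" by auto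
        qed
      qed
      then show ?thesis by (simp add: norm_minus_commute)
    qed
  qed
qed

lemma abs_continuous_on_add:
  assumes "abs_continuous_on S f" "abs_continuous_on S g"
  shows "abs_continuous_on S (\<lambda>t. f t + g t)"
proof (rule abs_continuous_onI)
  fix \<epsilon> :: real assume "\<epsilon> > 0"
  then have e: "\<epsilon> / 2 > 0" by simp
  obtain \<delta>1 where d1: "\<delta>1 > 0" "\<And>(I::(real \<times> real) set) u v. finite I \<Longrightarrow> (\<forall>i\<in>I. u i \<le> v i \<and> {u i..v i} \<subseteq> S) \<Longrightarrow>
      (\<forall>i\<in>I. \<forall>j\<in>I. i \<noteq> j \<longrightarrow> {u i<..<v i} \<inter> {u j<..<v j} = {}) \<Longrightarrow> (\<Sum>i\<in>I. v i - u i) < \<delta>1 \<Longrightarrow>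
      (\<Sum>i\<in>I. norm (f (v i) - f (u i))) < \<epsilon> / 2"
    by (rule abs_continuous_onE[OF assms(1) e, where 'i="real \<times> real"]) (rule that)
  obtain \<delta>2 where d2: "\<delta>2 > 0" "\<And>(I::(real \<times> real) set) u v. finite I \<Longrightarrow> (\<forall>i\<in>I. u i \<le> v i \<and> {u i..v i} \<subseteq> S) \<Longrightarrow>
      (\<forall>i\<in>I. \<forall>j\<in>I. i \<noteq> j \<longrightarrow> {u i<..<v i} \<inter> {u j<..<v j} = {}) \<Longrightarrow> (\<Sum>i\<in>I. v i - u i) < \<delta>2 \<Longrightarrow>
      (\<Sum>i\<in>I. norm (g (v i) - g (u i))) < \<epsilon> / 2"
    by (rule abs_continuous_onE[OF assms(2) e, where 'i="real \<times> real"]) (rule that)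
  show "\<exists>\<delta>>0. \<forall>D. finite D \<longrightarrow> (\<forall>p\<in>D. fst p \<le> snd p \<and> {fst p..snd p} \<subseteq> S) \<longrightarrow>
      (\<forall>p\<in>D. \<forall>q\<in>D. p \<noteq> q \<longrightarrow> {fst p<..<snd p} \<inter> {fst q<..<snd q} = {}) \<longrightarrow>
      (\<Sum>p\<in>D. snd p - fst p) < \<delta> \<longrightarrow> (\<Sum>p\<in>D. norm (f (snd p) + g (snd p) - (f (fst p) + g (fst p)))) < \<epsilon>"
  proof (intro exI[of _ "min \<delta>1 \<delta>2"] conjI allI impI)
    fix D :: "(real \<times> real) set"
    assume *: "finite D" "\<forall>p\<in>D. fst p \<le> snd p \<and> {fst p..snd p} \<subseteq> S"
      "\<forall>p\<in>D. \<forall>q\<in>D. p \<noteq> q \<longrightarrow> {fst p<..<snd p} \<inter> {fst q<..<snd q} = {}" "(\<Sum>p\<in>D. snd p - fst p) < min \<delta>1 \<delta>2"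
    have "(\<Sum>p\<in>D. norm (f (snd p) + g (snd p) - (f (fst p) + g (fst p)))) \<le>
       (\<Sum>p\<in>D. norm (f (snd p) - f (fst p)) + norm (g (snd p) - g (fst p)))"
      by (intro sum_mono) norm
    also have "\<dots> < \<epsilon> / 2 + \<epsilon> / 2" unfolding sum.distrib
      using * by (intro add_strict_mono d1 d2) auto
    finally show "(\<Sum>p\<in>D. norm (f (snd p) + g (snd p) - (f (fst p) + g (fst p)))) < \<epsilon>" by simp
  qed (use d1 d2 in auto)
qed

lemma abs_continuous_on_lipschitz:
  assumes "\<And>u v. u \<in> S \<Longrightarrow> v \<in> S \<Longrightarrow> u \<le> v \<Longrightarrow> norm (f v - f u) \<le> L * (v - u)"
  shows "abs_continuous_on S f"
proof (rule abs_continuous_onI)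
  fix \<epsilon> :: real assume e: "\<epsilon> > 0"
  have p: "0 < \<bar>L\<bar> + 1" by simp
  show "\<exists>\<delta>>0. \<forall>D. finite D \<longrightarrow> (\<forall>p\<in>D. fst p \<le> snd p \<and> {fst p..snd p} \<subseteq> S) \<longrightarrow>
      (\<forall>p\<in>D. \<forall>q\<in>D. p \<noteq> q \<longrightarrow> {fst p<..<snd p} \<inter> {fst q<..<snd q} = {}) \<longrightarrow>
      (\<Sum>p\<in>D. snd p - fst p) < \<delta> \<longrightarrow> (\<Sum>p\<in>D. norm (f (snd p) - f (fst p))) < \<epsilon>"
  proof (intro exI[of _ "\<epsilon> / (\<bar>L\<bar> + 1)"] conjI allI impI)
    fix D :: "(real \<times> real) set"
    assume *: "finite D" "\<forall>p\<in>D. fst p \<le> snd p \<and> {fst p..snd p} \<subseteq> S" "(\<Sum>p\<in>D. snd p - fst p) < \<epsilon> / (\<bar>L\<bar> + 1)"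
    have "(\<Sum>p\<in>D. norm (f (snd p) - f (fst p))) \<le> (\<Sum>p\<in>D. (\<bar>L\<bar> + 1) * (snd p - fst p))"
    proof (intro sum_mono)
      fix p assume "p \<in> D"
      then have "fst p \<le> snd p" "fst p \<in> S" "snd p \<in> S" using * by force+
      then have "norm (f (snd p) - f (fst p)) \<le> L * (snd p - fst p)" using assms by blast
      also have "\<dots> \<le> (\<bar>L\<bar> + 1) * (snd p - fst p)" using \<open>fst p \<le> snd p\<close> by (intro mult_right_mono) auto
      finally show "norm (f (snd p) - f (fst p)) \<le> (\<bar>L\<bar> + 1) * (snd p - fst p)" .
    qed
    also have "\<dots> = (\<bar>L\<bar> + 1) * (\<Sum>p\<in>D. snd p - fst p)" by (rule sum_distrib_left[symmetric])
    also have "\<dots> < \<epsilon>" using *(3) p by (simp add: pos_less_divide_eq mult.commute)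
    finally show "(\<Sum>p\<in>D. norm (f (snd p) - f (fst p))) < \<epsilon>" .
  qed (use e p in auto)
qed

lemma abs_continuous_on_bounded_linear:
  assumes f: "abs_continuous_on S f" and g: "bounded_linear g"
  shows "abs_continuous_on S (\<lambda>t. g (f t))"
proof (rule abs_continuous_onI)
  fix \<epsilon> :: real assume e: "\<epsilon> > 0"
  interpret bounded_linear g by fact
  obtain K where K: "K > 0" "\<And>x. norm (g x) \<le> norm x * K" using pos_bounded by blast
  have e': "\<epsilon> / K > 0" using e K by simp
  obtain \<delta> where d: "\<delta> > 0" "\<And>(I::(real \<times> real) set) u v. finite I \<Longrightarrow> (\<forall>i\<in>I. u i \<le> v i \<and> {u i..v i} \<subseteq> S) \<Longrightarrow>
      (\<forall>i\<in>I. \<forall>j\<in>I. i \<noteq> j \<longrightarrow> {u i<..<v i} \<inter> {u j<..<v j} = {}) \<Longrightarrow> (\<Sum>i\<in>I. v i - u i) < \<delta> \<Longrightarrow>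
      (\<Sum>i\<in>I. norm (f (v i) - f (u i))) < \<epsilon> / K"
    by (rule abs_continuous_onE[OF f e', where 'i="real \<times> real"]) (rule that)
  show "\<exists>\<delta>>0. \<forall>D. finite D \<longrightarrow> (\<forall>p\<in>D. fst p \<le> snd p \<and> {fst p..snd p} \<subseteq> S) \<longrightarrow>
      (\<forall>p\<in>D. \<forall>q\<in>D. p \<noteq> q \<longrightarrow> {fst p<..<snd p} \<inter> {fst q<..<snd q} = {}) \<longrightarrow>
      (\<Sum>p\<in>D. snd p - fst p) < \<delta> \<longrightarrow> (\<Sum>p\<in>D. norm (g (f (snd p)) - g (f (fst p)))) < \<epsilon>"
  proof (intro exI[of _ \<delta>] conjI allI impI)
    fix D :: "(real \<times> real) set"
    assume *: "finite D" "\<forall>p\<in>D. fst p \<le> snd p \<and> {fst p..snd p} \<subseteq> S"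
      "\<forall>p\<in>D. \<forall>q\<in>D. p \<noteq> q \<longrightarrow> {fst p<..<snd p} \<inter> {fst q<..<snd q} = {}" "(\<Sum>p\<in>D. snd p - fst p) < \<delta>"
    have "(\<Sum>p\<in>D. norm (g (f (snd p)) - g (f (fst p)))) \<le> (\<Sum>p\<in>D. norm (f (snd p) - f (fst p)) * K)"
      using K by (intro sum_mono) (metis diff)
    also have "\<dots> = (\<Sum>p\<in>D. norm (f (snd p) - f (fst p))) * K" by (rule sum_distrib_right[symmetric])
    also have "\<dots> < \<epsilon>" using d(2)[OF *] K by (simp add: pos_less_divide_eq)
    finally show "(\<Sum>p\<in>D. norm (g (f (snd p)) - g (f (fst p)))) < \<epsilon>" .
  qed (fact d)
qed

lemma abs_continuous_on_imp_continuous_on: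
  assumes "abs_continuous_on {a..b} f" shows "continuous_on {a..b} f"
  unfolding continuous_on_iff
proof (intro ballI allI impI)
  fix x e :: real assume x: "x \<in> {a..b}" and e: "0 < e"
  obtain \<delta> where d: "\<delta> > 0" "\<And>(I::unit set) u v. finite I \<Longrightarrow> (\<forall>i\<in>I. u i \<le> v i \<and> {u i..v i} \<subseteq> {a..b}) \<Longrightarrow>
      (\<forall>i\<in>I. \<forall>j\<in>I. i \<noteq> j \<longrightarrow> {u i<..<v i} \<inter> {u j<..<v j} = {}) \<Longrightarrow> (\<Sum>i\<in>I. v i - u i) < \<delta> \<Longrightarrow>
      (\<Sum>i\<in>I. norm (f (v i) - f (u i))) < e"
    by (rule abs_continuous_onE[OF assms e, where 'i=unit]) (rule that)
  show "\<exists>d>0. \<forall>x'\<in>{a..b}. dist x' x < d \<longrightarrow> dist (f x') (f x) < e"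
  proof (intro exI[of _ \<delta>] conjI ballI impI d)
    fix y assume y: "y \<in> {a..b}" "dist y x < \<delta>"
    have "norm (f (max x y) - f (min x y)) < e"
      using d(2)[of UNIV "\<lambda>_. min x y" "\<lambda>_. max x y"] x y by (auto simp: dist_real_def)
    then show "dist (f y) (f x) < e"
      by (cases "x \<le> y") (auto simp: dist_norm norm_minus_commute max_def min_def)
  qed
qed

section \<open>Vitali coverings and differentiability almost everywhere\<close>

lemma vitali_finite_intervals:
  fixes E O' :: "real set"
  assumes E: "E \<in> lmeasurable" and EO: "E \<subseteq> O'" "open O'" and \<delta>: "\<delta> > 0"
    and P: "\<And>t d. t \<in> E \<Longrightarrow> d > 0 \<Longrightarrow> \<exists>u v. u < v \<and> P u v \<and> t \<in> {u..v} \<and> v - u < d"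
  obtains D where "finite D" "\<And>u v. (u, v) \<in> D \<Longrightarrow> u < v \<and> P u v \<and> {u..v} \<subseteq> O'"
    "\<And>p q. p \<in> D \<Longrightarrow> q \<in> D \<Longrightarrow> p \<noteq> q \<Longrightarrow> {fst p..snd p} \<inter> {fst q..snd q} = {}"
    "measure lebesgue E - \<delta> < measure lebesgue (E \<inter> (\<Union>p\<in>D. {fst p..snd p}))"
proof -
  define K where "K = {p. fst p < snd p \<and> P (fst p) (snd p) \<and> {fst p..snd p} \<subseteq> O'}"
  define a where "a p = (fst p + snd p) / 2" for p :: "real \<times> real"
  define r where "r p = (snd p - fst p) / 2" for p :: "real \<times> real"
  have cb: "cball (a p) (r p) = {fst p..snd p}" for p
    by (simp add: cball_eq_atLeastAtMost a_def r_def field_simps)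
  obtain C where C: "countable C" "C \<subseteq> K" "pairwise (\<lambda>i j. disjnt (cball (a i) (r i)) (cball (a j) (r j))) C"
    and neg: "negligible (E - (\<Union>i \<in> C. cball (a i) (r i)))"
  proof (rule Vitali_covering_theorem_cballs[of K r E a])
    show "0 < r i" if "i \<in> K" for i using that by (simp add: K_def r_def)
    fix t and d :: real assume t: "t \<in> E" "0 < d"
    then obtain e where e: "e > 0" "cball t e \<subseteq> O'" using EO open_contains_cball by blast
    obtain u v where uv: "u < v" "P u v" "t \<in> {u..v}" "v - u < min d e" using P[OF t(1), of "min d e"] t e by auto
    have "{u..v} \<subseteq> cball t e" using uv by (auto simp: dist_real_def)
    then have "(u, v) \<in> K" using uv e by (auto simp: K_def)
    moreover have "t \<in> cball (a (u, v)) (r (u, v))" unfolding cb using uv by simp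
    moreover have "r (u, v) < d" using uv e by (simp add: r_def)
    ultimately show "\<exists>i. i \<in> K \<and> t \<in> cball (a i) (r i) \<and> r i < d" by blast
  qed
  show thesis
  proof (cases "C = {}")
    case True
    with neg have "measure lebesgue E = 0" by (simp add: negligible_imp_measure0)
    then show ?thesis using \<delta> by (intro that[of "{}"]) auto
  next
    case False
    define c where "c = from_nat_into C"
    have c: "range c = C" "c i \<in> C" for i using range_from_nat_into[OF False C(1)] by (auto simp: c_def)
    \<comment> \<open>The covering theorem gives a countable disjoint family that exhausts
      \<open>E\<close> up to a null set; by continuity of the measure from below, finitely many
      members already capture all but \<open>\<delta>\<close> of it.\<close>
    define A where "A n = E \<inter> (\<Union>i<n. {fst (c i)..snd (c i)})" for n :: nat
    have Am: "A n \<in> lmeasurable" for n unfolding A_def by (intro fmeasurable_Int_fmeasurable E) auto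
    have UA: "(\<Union>n. A n) = E \<inter> (\<Union>i\<in>C. cball (a i) (r i))"
      unfolding A_def cb c(1)[symmetric] by (force intro: exI[of _ "Suc _"])
    have UAm: "(\<Union>n. A n) \<in> lmeasurable"
      unfolding UA by (intro fmeasurable_Int_fmeasurable E sets.countable_UN'' C(1)) (simp add: cb)
    have "(\<lambda>n. measure lebesgue (A n)) \<longlonglongrightarrow> measure lebesgue (\<Union>n. A n)"
    proof (rule Lim_measure_incseq)
      show "range A \<subseteq> sets lebesgue" using Am by auto
      show "incseq A" unfolding A_def incseq_def by (intro allI impI Int_mono UN_mono) auto
      show "emeasure lebesgue (\<Union>n. A n) \<noteq> \<infinity>" by (metis UAm fmeasurableD2 infinity_ennreal_def)
    qed
    moreover have "measure lebesgue (\<Union>n. A n) = measure lebesgue E"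
    proof -
      have "E - (\<Union>n. A n) \<union> ((\<Union>n. A n) - E) = E - (\<Union>i \<in> C. cball (a i) (r i))" unfolding UA by auto
      with neg show ?thesis by (metis E measure_negligible_symdiff)
    qed
    ultimately have "\<forall>\<^sub>F n in sequentially. measure lebesgue E - \<delta> < measure lebesgue (A n)"
      using \<delta> by (intro order_tendstoD(1)) auto
    then obtain n where n: "measure lebesgue E - \<delta> < measure lebesgue (A n)"
      using eventually_happens' sequentially_bot by blast
    show ?thesis
    proof (rule that[of "c ` {..<n}"])
      show "finite (c ` {..<n})" by simp
      show "\<And>u v. (u, v) \<in> c ` {..<n} \<Longrightarrow> u < v \<and> P u v \<and> {u..v} \<subseteq> O'"
      proof -
        fix u v assume "(u, v) \<in> c ` {..<n}"
        then have "(u, v) \<in> C" by (metis c(2) imageE)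
        then have "(u, v) \<in> K" using C(2) by blast
        then show "u < v \<and> P u v \<and> {u..v} \<subseteq> O'" by (simp add: K_def)
      qed
      show "{fst p..snd p} \<inter> {fst q..snd q} = {}" if "p \<in> c ` {..<n}" "q \<in> c ` {..<n}" "p \<noteq> q" for p q
      proof -
        have "p \<in> C" "q \<in> C" using that c by auto
        then show ?thesis using C(3) that(3) unfolding pairwise_def disjnt_def cb by blast
      qed
      show "measure lebesgue E - \<delta> < measure lebesgue (E \<inter> (\<Union>p\<in>c ` {..<n}. {fst p..snd p}))"
        using n unfolding A_def by simp
    qed
  qed
qed

lemma measure_disjoint_intervals:
  fixes D :: "(real \<times> real) set"
  assumes "finite D" "\<And>p. p \<in> D \<Longrightarrow> fst p \<le> snd p"
    "\<And>p q. p \<in> D \<Longrightarrow> q \<in> D \<Longrightarrow> p \<noteq> q \<Longrightarrow> {fst p..snd p} \<inter> {fst q..snd q} = {}"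
  shows "measure lebesgue (\<Union>p\<in>D. {fst p..snd p}) = (\<Sum>p\<in>D. snd p - fst p)"
proof -
  have "measure lebesgue (\<Union>p\<in>D. {fst p..snd p}) = (\<Sum>p\<in>D. measure lebesgue {fst p..snd p})"
  proof (intro measure_finite_Union assms(1))
    show "disjoint_family_on (\<lambda>p. {fst p..snd p}) D" using assms(3) by (auto simp: disjoint_family_on_def)
    show "emeasure lebesgue {fst p..snd p} \<noteq> \<infinity>" if "p \<in> D" for p
      by (metis fmeasurableD2 lmeasurable_cbox box_real(2) infinity_ennreal_def)
  qed auto
  also have "\<dots> = (\<Sum>p\<in>D. snd p - fst p)"
    using assms(2) by (intro sum.cong) auto
  finally show ?thesis .
qed

text \<open>Disjoint intervals extend to a division of \<open>{a..b}\<close>, and increments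
  telescope over a division. The identity is stated for every \<open>f\<close> at once because it is
  used for the function under study and for the identity function, whose increments are
  lengths.\<close>

lemma complementary_intervals:
  fixes D :: "(real \<times> real) set"
  assumes ab: "a \<le> b" and D: "finite D" "\<And>p. p \<in> D \<Longrightarrow> a \<le> fst p \<and> fst p \<le> snd p \<and> snd p \<le> b"
    "\<And>p q. p \<in> D \<Longrightarrow> q \<in> D \<Longrightarrow> p \<noteq> q \<Longrightarrow> {fst p..snd p} \<inter> {fst q..snd q} = {}"
  obtains R where "finite R" "\<And>J. J \<in> R \<Longrightarrow> \<exists>c d. J = {c..d} \<and> a \<le> c \<and> c \<le> d \<and> d \<le> b"
    "\<And>J J'. J \<in> R \<Longrightarrow> J' \<in> R \<Longrightarrow> J \<noteq> J' \<Longrightarrow> interior J \<inter> interior J' = {}"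
    "\<And>f::real \<Rightarrow> real. (\<Sum>p\<in>D. f (snd p) - f (fst p)) + (\<Sum>J\<in>R. f (Sup J) - f (Inf J)) = f b - f a"
proof -
  define B where "B p = {fst p..snd p}" for p :: "real \<times> real"
  have ne: "B p \<noteq> {}" "B p \<subseteq> {a..b}" if "p \<in> D" for p using D(2)[OF that] by (auto simp: B_def)
  have inj: "inj_on B D" using D(3) ne(1) by (auto simp: inj_on_def B_def)
  have "B ` D division_of \<Union>(B ` D)"
  proof (rule division_ofI)
    show "\<And>K1 K2. K1 \<in> B ` D \<Longrightarrow> K2 \<in> B ` D \<Longrightarrow> K1 \<noteq> K2 \<Longrightarrow> interior K1 \<inter> interior K2 = {}"
    proof -
      fix K1 K2 assume *: "K1 \<in> B ` D" "K2 \<in> B ` D" "K1 \<noteq> K2"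
      then have "K1 \<inter> K2 = {}" using D(3) unfolding B_def by fastforce
      then show "interior K1 \<inter> interior K2 = {}" using interior_subset by blast
    qed
    show "\<And>K. K \<in> B ` D \<Longrightarrow> \<exists>a b. K = cbox a b" by (auto simp: B_def simp flip: box_real)
  qed (use D ne in auto)
  moreover have "\<Union>(B ` D) \<subseteq> cbox a b" using ne(2) unfolding box_real by (intro UN_least)
  ultimately obtain q where q: "B ` D \<subseteq> q" "q division_of cbox a b" by (rule partial_division_extend_interval)
  \<comment> \<open>Tags at the left endpoints, only to reach the telescoping rule for tagged
    divisions.\<close>
  define p where "p = (\<lambda>K::real set. (Inf K, K)) ` q"
  have qK: "\<exists>c d. K = {c..d} \<and> a \<le> c \<and> c \<le> d \<and> d \<le> b" if K: "K \<in> q" for K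
  proof -
    obtain c d where "K = {c..d}" using division_ofD(4)[OF q(2) K] by (auto simp: box_real)
    then show ?thesis using division_ofD(2,3)[OF q(2) K] by (auto simp: box_real)
  qed
  have "p tagged_division_of cbox a b"
  proof (rule tagged_division_ofI)
    show "finite p" using q by (auto simp: p_def)
    fix x K assume xK: "(x, K) \<in> p"
    then have K: "K \<in> q" "x = Inf K" by (auto simp: p_def)
    then obtain c d where cd: "K = {c..d}" "a \<le> c" "c \<le> d" "d \<le> b" using qK by blast
    show "x \<in> K" using K cd by auto
    show "K \<subseteq> cbox a b" using cd by (auto simp: box_real)
    show "\<exists>a b. K = cbox a b" using cd by (auto simp: box_real)
    fix x' K' assume "(x', K') \<in> p" "(x, K) \<noteq> (x', K')"
    then have "K' \<in> q" "K \<noteq> K'" using K by (auto simp: p_def)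
    then show "interior K \<inter> interior K' = {}" using division_ofD(5)[OF q(2) K(1)] by blast
  next
    have "{K. \<exists>x. (x, K) \<in> p} = q" by (auto simp: p_def)
    then show "\<Union> {K. \<exists>x. (x, K) \<in> p} = cbox a b" using division_ofD(6)[OF q(2)] by simp
  qed
  then have pt: "p tagged_division_of {a..b}" by (simp add: box_real)
  have fq: "(\<Sum>J\<in>q. f (Sup J) - f (Inf J)) = f b - f a" for f :: "real \<Rightarrow> real"
  proof -
    have "(\<Sum>(x,K)\<in>p. f (Sup K) - f (Inf K)) = (\<Sum>J\<in>q. f (Sup J) - f (Inf J))"
      unfolding p_def by (subst sum.reindex) (auto simp: inj_on_def)
    then show ?thesis using additive_tagged_division_1[OF ab pt, of f] by simp
  qed
  show thesis
  proof (rule that[of "q - B ` D"])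
    show "finite (q - B ` D)" using q by auto
    show "\<And>J. J \<in> q - B ` D \<Longrightarrow> \<exists>c d. J = {c..d} \<and> a \<le> c \<and> c \<le> d \<and> d \<le> b" using qK by blast
    show "\<And>J J'. J \<in> q - B ` D \<Longrightarrow> J' \<in> q - B ` D \<Longrightarrow> J \<noteq> J' \<Longrightarrow> interior J \<inter> interior J' = {}"
      using division_ofD(5)[OF q(2)] by blast
    fix f :: "real \<Rightarrow> real"
    have "(\<Sum>J\<in>B ` D. f (Sup J) - f (Inf J)) = (\<Sum>p\<in>D. f (snd p) - f (fst p))"
      unfolding sum.reindex[OF inj] by (intro sum.cong) (use D(2) in \<open>auto simp: B_def\<close>)
    then show "(\<Sum>p\<in>D. f (snd p) - f (fst p)) + (\<Sum>J\<in>q - B ` D. f (Sup J) - f (Inf J)) = f b - f a"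
      using fq[of f] sum.subset_diff[OF q(1), of "\<lambda>J. f (Sup J) - f (Inf J)"] division_of_finite[OF q(2)] by simp
  qed
qed

text \<open>For a fixed step \<open>k\<close> the set \<open>V k\<close> is open, since
  \<open>f\<close> is continuous and \<open>G\<close> is open. Arbitrary unions over small steps
  remain open, so the set is a countable intersection of open sets.\<close>

lemma frequently_slope_borel:
  fixes f :: "real \<Rightarrow> real"
  assumes f: "continuous_on UNIV f" and G: "open G"
  shows "{t. \<exists>\<^sub>F y in at t. (f y - f t) / (y - t) \<in> G} \<in> sets borel"
proof -
  define V where "V k = {t. (f (t + k) - f t) / k \<in> G}" for k
  have "open (V k)" for k
  proof -
    have "continuous_on UNIV (\<lambda>t. (f (t + k) - f t) / k)"
      unfolding divide_inverse by (intro continuous_intros continuous_on_compose2[OF f]) auto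
    from open_vimage[OF G this] show ?thesis by (simp add: V_def vimage_def)
  qed
  then have "open (\<Union>k\<in>{k. k \<noteq> 0 \<and> \<bar>k\<bar> < d}. V k)" for d :: real by blast
  then have "(\<Inter>n. \<Union>k\<in>{k. k \<noteq> 0 \<and> \<bar>k\<bar> < 1 / real (Suc n)}. V k) \<in> sets borel" by auto
  also have "(\<Inter>n. \<Union>k\<in>{k. k \<noteq> 0 \<and> \<bar>k\<bar> < 1 / real (Suc n)}. V k) = {t. \<exists>\<^sub>F y in at t. (f y - f t) / (y - t) \<in> G}"
  proof (intro set_eqI iffI)
    fix t assume t: "t \<in> {t. \<exists>\<^sub>F y in at t. (f y - f t) / (y - t) \<in> G}"
    show "t \<in> (\<Inter>n. \<Union>k\<in>{k. k \<noteq> 0 \<and> \<bar>k\<bar> < 1 / real (Suc n)}. V k)"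
    proof
      fix n
      have "0 < 1 / real (Suc n)" by simp
      with t obtain y where "y \<noteq> t" "dist y t < 1 / real (Suc n)" "(f y - f t) / (y - t) \<in> G"
        unfolding mem_Collect_eq frequently_at by blast
      then show "t \<in> (\<Union>k\<in>{k. k \<noteq> 0 \<and> \<bar>k\<bar> < 1 / real (Suc n)}. V k)"
        by (auto simp: V_def dist_real_def intro!: exI[of _ "y - t"])
    qed
  next
    fix t assume t: "t \<in> (\<Inter>n. \<Union>k\<in>{k. k \<noteq> 0 \<and> \<bar>k\<bar> < 1 / real (Suc n)}. V k)"
    show "t \<in> {t. \<exists>\<^sub>F y in at t. (f y - f t) / (y - t) \<in> G}"
      unfolding mem_Collect_eq frequently_at
    proof (intro allI impI)
      fix d :: real assume "d > 0"
      then obtain n where n: "1 / real (Suc n) < d" using nat_approx_posE by blast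
      from t obtain k where "k \<noteq> 0" "\<bar>k\<bar> < 1 / real (Suc n)" "t \<in> V k" by auto
      then show "\<exists>y\<in>UNIV. y \<noteq> t \<and> dist y t < d \<and> (f y - f t) / (y - t) \<in> G"
        using n by (intro bexI[of _ "t + k"]) (auto simp: V_def dist_real_def)
    qed
  qed
  finally show ?thesis .
qed

text \<open>The second point may lie on either side of \<open>t\<close>; exchanging the endpoints
  leaves the quotient unchanged, which yields an interval around \<open>t\<close> as the covering
  argument wants it.\<close>

lemma frequently_slope_interval:
  fixes f :: "real \<Rightarrow> real"
  assumes "\<exists>\<^sub>F y in at t. (f y - f t) / (y - t) \<in> G" "d > 0"
  shows "\<exists>u v. u < v \<and> (f v - f u) / (v - u) \<in> G \<and> t \<in> {u..v} \<and> v - u < d"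
proof -
  obtain y where y: "y \<noteq> t" "dist y t < d" "(f y - f t) / (y - t) \<in> G"
    using assms unfolding frequently_at by blast
  show ?thesis
  proof (cases "y < t")
    case True
    have "(f t - f y) / (t - y) = (f y - f t) / (y - t)" by (metis minus_diff_eq minus_divide_divide)
    with True y show ?thesis by (intro exI[of _ y] exI[of _ t]) (auto simp: dist_real_def)
  qed (use y in \<open>intro exI[of _ t] exI[of _ y], auto simp: dist_real_def\<close>)
qed

lemma continuous_on_UNIV_if_abs_continuous:
  fixes f :: "real \<Rightarrow> 'b::real_normed_vector"
  assumes "\<And>a b. abs_continuous_on {a..b} f" shows "continuous_on UNIV f"
proof -
  have c: "continuous_on {x<..<y} f" for x y
    using abs_continuous_on_imp_continuous_on[OF assms[of x y]] by (rule continuous_on_subset) auto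
  have "isCont f x" for x
    by (rule continuous_on_interior[OF c[of "x - 1" "x + 1"]]) simp
  then show ?thesis by (simp add: continuous_on_eq_continuous_at)
qed

text \<open>If both slopes occurred at a set of positive measure, cover it by intervals of one kind and the
  set inside these by intervals of the other kind: the increments of the two coverings differ by
  much, while the difference of their unions has small measure.\<close>

lemma opposite_slopes_negligible:
  fixes f :: "real \<Rightarrow> real"
  assumes ac: "\<And>a b. abs_continuous_on {a..b} f" and k: "k > 0"
  shows "negligible {t. (\<exists>\<^sub>F y in at t. (f y - f t) / (y - t) \<in> {..<-k}) \<and>
      (\<exists>\<^sub>F y in at t. (f y - f t) / (y - t) \<in> {k<..})}" (is "negligible ?E")
proof -
  have cont: "continuous_on UNIV f" by (rule continuous_on_UNIV_if_abs_continuous[OF ac])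
  have Eb: "?E \<in> sets borel"
  proof -
    have "?E = {t. \<exists>\<^sub>F y in at t. (f y - f t) / (y - t) \<in> {..<-k}} \<inter>
       {t. \<exists>\<^sub>F y in at t. (f y - f t) / (y - t) \<in> {k<..}}" by blast
    also have "\<dots> \<in> sets borel" by (intro sets.Int frequently_slope_borel cont) auto
    finally show ?thesis .
  qed
  have "negligible (?E \<inter> {a<..<b})" for a b
  proof (rule ccontr)
    assume nn: "\<not> negligible (?E \<inter> {a<..<b})"
    define E where "E = ?E \<inter> {a<..<b}"
    have El: "E \<in> lmeasurable"
      unfolding E_def by (subst Int_commute, intro fmeasurable_Int_fmeasurable sets_completionI_sets)
        (use Eb in \<open>simp_all add: lmeasurable_box flip: box_real\<close>)
    define m where "m = measure lebesgue E"
    have m: "m > 0" using nn El unfolding m_def E_def[symmetric]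
      by (metis measure_nonneg negligible_iff_measure order_less_le)
    have s1: "\<exists>u v. u < v \<and> (f v - f u) / (v - u) < -k \<and> t \<in> {u..v} \<and> v - u < d"
      and s2: "\<exists>u v. u < v \<and> (f v - f u) / (v - u) > k \<and> t \<in> {u..v} \<and> v - u < d" if "t \<in> E" "d > 0" for t d
      using that frequently_slope_interval[of f t "{..<-k}" d] frequently_slope_interval[of f t "{k<..}" d]
      unfolding E_def Int_iff mem_Collect_eq lessThan_iff greaterThan_iff by blast+
    obtain \<delta>0 where \<delta>0: "\<delta>0 > 0" "\<And>(I::((real \<times> real) \<times> real set) set) u v. finite I \<Longrightarrow> (\<forall>i\<in>I. u i \<le> v i \<and> {u i..v i} \<subseteq> {a..b}) \<Longrightarrow>
      (\<forall>i\<in>I. \<forall>j\<in>I. i \<noteq> j \<longrightarrow> {u i<..<v i} \<inter> {u j<..<v j} = {}) \<Longrightarrow> (\<Sum>i\<in>I. v i - u i) < \<delta>0 \<Longrightarrow>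
      (\<Sum>i\<in>I. norm (f (v i) - f (u i))) < k * m / 2"
      using k m by (rule_tac abs_continuous_onE[OF ac, of "k * m / 2" a b, where 'i="(real \<times> real) \<times> real set"]) auto
    \<comment> \<open>With \<open>\<delta> \<le> \<delta>0 / 8\<close> the gaps between the two
      coverings, of total length below \<open>3 * \<delta>\<close>, fall under absolute continuity;
      with \<open>\<delta> \<le> m / 8\<close> each covering keeps a length above
      \<open>3 * m / 4\<close>, far more than the gaps could compensate.\<close>
    define \<delta> where "\<delta> = min (m / 8) (\<delta>0 / 8)"
    have \<delta>: "\<delta> > 0" "\<delta> \<le> m / 8" "\<delta> \<le> \<delta>0 / 8" using m \<delta>0 by (auto simp: \<delta>_def)
    obtain T where T: "open T" "E \<subseteq> T" "T - E \<in> lmeasurable" "emeasure lebesgue (T - E) < ennreal \<delta>"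
      using sets_lebesgue_outer_open[of E \<delta>] El \<delta> by blast
    have TE: "measure lebesgue (T - E) < \<delta>"
      using T(3,4) by (simp add: emeasure_eq_measure2 ennreal_less_iff)
    define O' where "O' = T \<inter> {a<..<b}"
    have O': "open O'" "E \<subseteq> O'" "O' \<subseteq> {a<..<b}" "O' - E \<subseteq> T - E" using T by (auto simp: O'_def E_def)
    have Ol: "O' \<in> lmeasurable"
      unfolding O'_def by (subst Int_commute, intro fmeasurable_Int_fmeasurable sets_completionI_sets)
        (use T in \<open>simp_all add: lmeasurable_box flip: box_real\<close>)
    have OE: "measure lebesgue (O' - E) < \<delta>"
      using measure_mono_fmeasurable[OF O'(4) _ T(3)] TE Ol El by auto
    obtain D where D: "finite D" "\<And>u v. (u, v) \<in> D \<Longrightarrow> u < v \<and> (f v - f u) / (v - u) < -k \<and> {u..v} \<subseteq> O'"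
      "\<And>p q. p \<in> D \<Longrightarrow> q \<in> D \<Longrightarrow> p \<noteq> q \<Longrightarrow> {fst p..snd p} \<inter> {fst q..snd q} = {}"
      "m - \<delta> < measure lebesgue (E \<inter> (\<Union>p\<in>D. {fst p..snd p}))"
      by (rule vitali_finite_intervals[OF El O'(2,1) \<delta>(1) s1, folded m_def], assumption+, rule that)
    have D': "fst p < snd p" "{fst p..snd p} \<subseteq> O'" "f (snd p) - f (fst p) < -k * (snd p - fst p)" if "p \<in> D" for p
      using D(2)[of "fst p" "snd p"] that by (auto simp: pos_divide_less_eq)
    define UD where "UD = (\<Union>p\<in>D. {fst p..snd p})"
    have UD: "UD \<in> lmeasurable" unfolding UD_def using D(1) by (auto simp flip: box_real)
    have mUD: "measure lebesgue UD = (\<Sum>p\<in>D. snd p - fst p)"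
      unfolding UD_def using D(1,3) D'(1) by (intro measure_disjoint_intervals) (auto intro: less_imp_le)
    have mUD_ub: "measure lebesgue UD < m + \<delta>"
    proof -
      have "measure lebesgue UD \<le> measure lebesgue O'" using UD Ol D'(2)
        by (intro measure_mono_fmeasurable) (auto simp: UD_def)
      also have "measure lebesgue O' = measure lebesgue E + measure lebesgue (O' - E)"
        using measurable_measure_Diff[OF Ol, of E] O'(2) El by auto
      finally show ?thesis using OE by (simp add: m_def)
    qed
    have mUD_lb: "m - \<delta> < measure lebesgue UD"
    proof -
      have "measure lebesgue (E \<inter> UD) \<le> measure lebesgue UD" using UD El by (intro measure_mono_fmeasurable) auto
      with D(4) show ?thesis unfolding UD_def by linarith
    qed
    \<comment> \<open>The endpoints form a finite set and can be removed from \<open>E\<close>. The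
      second covering then lives in the open set \<open>O1\<close>, which forces each of its
      intervals into a single interval of the first (\<open>Cex\<close>).\<close>
    define N where "N = fst ` D \<union> snd ` D"
    define E1 where "E1 = E \<inter> UD - N"
    define O1 where "O1 = (\<Union>p\<in>D. {fst p<..<snd p})"
    have Nneg: "negligible N" unfolding N_def using D(1) by (intro negligible_finite) auto
    have E1l: "E1 \<in> lmeasurable" unfolding E1_def
      by (intro fmeasurable_Diff fmeasurable_Int_fmeasurable El fmeasurableD[OF UD] negligible_imp_sets[OF Nneg])
    have "measure lebesgue E1 = measure lebesgue (E \<inter> UD)"
    proof (rule measure_negligible_symdiff)
      show "E \<inter> UD \<in> lmeasurable" using El UD by auto
      show "negligible (E \<inter> UD - E1 \<union> (E1 - E \<inter> UD))"
        by (rule negligible_subset[OF Nneg]) (auto simp: E1_def)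
    qed
    then have mE1: "m - \<delta> < measure lebesgue E1" using D(4) by (simp add: UD_def)
    have E1O1: "E1 \<subseteq> O1" unfolding E1_def O1_def UD_def N_def by force
    have O1: "open O1" unfolding O1_def by auto
    have s2': "\<exists>u v. u < v \<and> (f v - f u) / (v - u) > k \<and> t \<in> {u..v} \<and> v - u < d" if "t \<in> E1" "d > 0" for t d
      using s2 that unfolding E1_def by auto
    obtain C where C: "finite C" "\<And>u v. (u, v) \<in> C \<Longrightarrow> u < v \<and> (f v - f u) / (v - u) > k \<and> {u..v} \<subseteq> O1"
      "\<And>p q. p \<in> C \<Longrightarrow> q \<in> C \<Longrightarrow> p \<noteq> q \<Longrightarrow> {fst p..snd p} \<inter> {fst q..snd q} = {}"
      "measure lebesgue E1 - \<delta> < measure lebesgue (E1 \<inter> (\<Union>p\<in>C. {fst p..snd p}))"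
      by (rule vitali_finite_intervals[OF E1l E1O1 O1 \<delta>(1) s2'], assumption+, rule that)
    have C': "fst p < snd p" "{fst p..snd p} \<subseteq> O1" "f (snd p) - f (fst p) > k * (snd p - fst p)" if "p \<in> C" for p
      using C(2)[of "fst p" "snd p"] that by (auto simp: pos_less_divide_eq)
    have UC: "(\<Union>p\<in>C. {fst p..snd p}) \<in> lmeasurable" using C(1) by (auto simp flip: box_real)
    have mUC: "m - 2 * \<delta> < (\<Sum>p\<in>C. snd p - fst p)"
    proof -
      have "m - 2 * \<delta> < measure lebesgue (E1 \<inter> (\<Union>p\<in>C. {fst p..snd p}))" using C(4) mE1 by simp
      also have "\<dots> \<le> measure lebesgue (\<Union>p\<in>C. {fst p..snd p})" using UC E1l by (intro measure_mono_fmeasurable) auto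
      also have "\<dots> = (\<Sum>p\<in>C. snd p - fst p)"
        using C(1,3) C'(1) by (intro measure_disjoint_intervals) (auto intro: less_imp_le)
      finally show ?thesis .
    qed
    define Cp where "Cp p = {q\<in>C. fst p < fst q \<and> snd q < snd p}" for p :: "real \<times> real"
    have Cex: "\<exists>p\<in>D. q \<in> Cp p" if q: "q \<in> C" for q
    proof -
      have "fst q \<in> O1" using C'[OF q] by auto
      then obtain p where p: "p \<in> D" "fst p < fst q" "fst q < snd p" by (auto simp: O1_def)
      have "snd q < snd p"
      proof (rule ccontr)
        assume "\<not> snd q < snd p"
        then have "snd p \<in> O1" using C'[OF q] p by auto
        then obtain p' where p': "p' \<in> D" "fst p' < snd p" "snd p < snd p'" by (auto simp: O1_def)
        then have "snd p \<in> {fst p..snd p} \<inter> {fst p'..snd p'}" using p by auto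
        then show False using D(3)[OF p(1) p'(1)] p' by auto
      qed
      with p q show ?thesis by (auto simp: Cp_def)
    qed
    have CU: "C = (\<Union>p\<in>D. Cp p)" using Cex by (auto simp: Cp_def)
    have Cdisj: "Cp p \<inter> Cp p' = {}" if "p \<in> D" "p' \<in> D" "p \<noteq> p'" for p p'
    proof -
      have "False" if q: "q \<in> Cp p" "q \<in> Cp p'" for q
      proof -
        have "fst q < snd q" using C'(1) q by (auto simp: Cp_def)
        then have "fst q \<in> {fst p..snd p} \<inter> {fst p'..snd p'}" using q by (auto simp: Cp_def)
        then show False using D(3)[OF \<open>p \<in> D\<close> \<open>p' \<in> D\<close> \<open>p \<noteq> p'\<close>] by auto
      qed
      then show ?thesis by blast
    qed
    have Csum: "(\<Sum>q\<in>C. F q) = (\<Sum>p\<in>D. \<Sum>q\<in>Cp p. F q)" for F :: "real \<times> real \<Rightarrow> real"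
      by (subst CU, rule sum.UNION_disjoint) (use D(1) C(1) Cdisj in \<open>auto simp: Cp_def\<close>)
    have "\<forall>p\<in>D. \<exists>R. finite R \<and> (\<forall>J\<in>R. \<exists>c d. J = {c..d} \<and> fst p \<le> c \<and> c \<le> d \<and> d \<le> snd p) \<and>
      (\<forall>J\<in>R. \<forall>J'\<in>R. J \<noteq> J' \<longrightarrow> interior J \<inter> interior J' = {}) \<and>
      (\<forall>f::real \<Rightarrow> real. (\<Sum>q\<in>Cp p. f (snd q) - f (fst q)) + (\<Sum>J\<in>R. f (Sup J) - f (Inf J)) = f (snd p) - f (fst p))"
    proof
      fix p assume p: "p \<in> D"
      have *: "fst p \<le> snd p" "finite (Cp p)" using C(1) D'(1)[OF p] by (auto simp: Cp_def)
      have **: "fst p \<le> fst q \<and> fst q \<le> snd q \<and> snd q \<le> snd p" if "q \<in> Cp p" for q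
        using that C'(1)[of q] by (auto simp: Cp_def)
      have ***: "{fst q..snd q} \<inter> {fst q'..snd q'} = {}" if "q \<in> Cp p" "q' \<in> Cp p" "q \<noteq> q'" for q q'
        using C(3)[of q q'] that unfolding Cp_def by blast
      show "\<exists>R. finite R \<and> (\<forall>J\<in>R. \<exists>c d. J = {c..d} \<and> fst p \<le> c \<and> c \<le> d \<and> d \<le> snd p) \<and>
      (\<forall>J\<in>R. \<forall>J'\<in>R. J \<noteq> J' \<longrightarrow> interior J \<inter> interior J' = {}) \<and>
      (\<forall>f::real \<Rightarrow> real. (\<Sum>q\<in>Cp p. f (snd q) - f (fst q)) + (\<Sum>J\<in>R. f (Sup J) - f (Inf J)) = f (snd p) - f (fst p))"
      proof (rule complementary_intervals[OF * ** ***])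
        fix R :: "real set set"
        assume R: "finite R" "\<And>J. J \<in> R \<Longrightarrow> \<exists>c d. J = {c..d} \<and> fst p \<le> c \<and> c \<le> d \<and> d \<le> snd p"
          "\<And>J J'. J \<in> R \<Longrightarrow> J' \<in> R \<Longrightarrow> J \<noteq> J' \<Longrightarrow> interior J \<inter> interior J' = {}"
          "\<And>f::real \<Rightarrow> real. (\<Sum>q\<in>Cp p. f (snd q) - f (fst q)) + (\<Sum>J\<in>R. f (Sup J) - f (Inf J)) = f (snd p) - f (fst p)"
        show ?thesis
          by (rule exI[of _ R], intro conjI ballI impI allI) (erule R | rule R | assumption)+
      qed
    qed
    from bchoice[OF this] obtain R where R0: "\<forall>p\<in>D. finite (R p) \<and> (\<forall>J\<in>R p. \<exists>c d. J = {c..d} \<and> fst p \<le> c \<and> c \<le> d \<and> d \<le> snd p) \<and>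
      (\<forall>J\<in>R p. \<forall>J'\<in>R p. J \<noteq> J' \<longrightarrow> interior J \<inter> interior J' = {}) \<and>
      (\<forall>f::real \<Rightarrow> real. (\<Sum>q\<in>Cp p. f (snd q) - f (fst q)) + (\<Sum>J\<in>R p. f (Sup J) - f (Inf J)) = f (snd p) - f (fst p))" ..
    have R: "finite (R p)" "\<And>J. J \<in> R p \<Longrightarrow> \<exists>c d. J = {c..d} \<and> fst p \<le> c \<and> c \<le> d \<and> d \<le> snd p"
        "\<And>J J'. J \<in> R p \<Longrightarrow> J' \<in> R p \<Longrightarrow> J \<noteq> J' \<Longrightarrow> interior J \<inter> interior J' = {}"
        "\<And>f::real \<Rightarrow> real. (\<Sum>q\<in>Cp p. f (snd q) - f (fst q)) + (\<Sum>J\<in>R p. f (Sup J) - f (Inf J)) = f (snd p) - f (fst p)"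
      if "p \<in> D" for p
    proof -
      note r = bspec[OF R0 that]
      show "finite (R p)" using r by (rule conjunct1)
      show "\<exists>c d. J = {c..d} \<and> fst p \<le> c \<and> c \<le> d \<and> d \<le> snd p" if "J \<in> R p" for J
        using conjunct1[OF conjunct2[OF r]] that by (rule bspec)
      show "interior J \<inter> interior J' = {}" if "J \<in> R p" "J' \<in> R p" "J \<noteq> J'" for J J'
        using bspec[OF bspec[OF conjunct1[OF conjunct2[OF conjunct2[OF r]]] that(1)] that(2)] that(3) by (rule mp)
      show "(\<Sum>q\<in>Cp p. f (snd q) - f (fst q)) + (\<Sum>J\<in>R p. f (Sup J) - f (Inf J)) = f (snd p) - f (fst p)"
        for f :: "real \<Rightarrow> real"
        using conjunct2[OF conjunct2[OF conjunct2[OF r]]] by (rule spec)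
    qed
    \<comment> \<open>The gaps: what \<open>C\<close> leaves uncovered inside each interval of
      \<open>D\<close>, labelled by that interval. Their increments sum up to those over
      \<open>D\<close> minus those over \<open>C\<close>.\<close>
    define I where "I = Sigma D R"
    have tot: "(\<Sum>q\<in>C. g (snd q) - g (fst q)) + (\<Sum>i\<in>I. g (Sup (snd i)) - g (Inf (snd i))) = (\<Sum>p\<in>D. g (snd p) - g (fst p))"
      for g :: "real \<Rightarrow> real"
    proof -
      have "(\<Sum>i\<in>I. g (Sup (snd i)) - g (Inf (snd i))) = (\<Sum>p\<in>D. \<Sum>J\<in>R p. g (Sup J) - g (Inf J))"
        unfolding I_def using D(1) R(1) by (subst sum.Sigma) (auto simp: case_prod_beta)
      then show ?thesis unfolding Csum using R(4)[of _ g] by (simp add: sum.distrib[symmetric] cong: sum.cong)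
    qed
    have int: "Inf (snd i) \<le> Sup (snd i) \<and> {Inf (snd i)..Sup (snd i)} = snd i \<and> snd i \<subseteq> {fst (fst i)..snd (fst i)}"
      if "i \<in> I" for i
      using R(2)[of "fst i" "snd i"] that unfolding I_def by auto
    have "(\<Sum>i\<in>I. norm (f (Sup (snd i)) - f (Inf (snd i)))) < k * m / 2"
    proof (rule \<delta>0(2))
      show "finite I" unfolding I_def using D(1) R(1) by auto
      show "\<forall>i\<in>I. Inf (snd i) \<le> Sup (snd i) \<and> {Inf (snd i)..Sup (snd i)} \<subseteq> {a..b}"
      proof
        fix i assume i: "i \<in> I"
        then have "{fst (fst i)..snd (fst i)} \<subseteq> {a..b}" using D'(2)[of "fst i"] O'(3) unfolding I_def by fastforce
        then show "Inf (snd i) \<le> Sup (snd i) \<and> {Inf (snd i)..Sup (snd i)} \<subseteq> {a..b}" using int[OF i] by blast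
      qed
      show "\<forall>i\<in>I. \<forall>j\<in>I. i \<noteq> j \<longrightarrow> {Inf (snd i)<..<Sup (snd i)} \<inter> {Inf (snd j)<..<Sup (snd j)} = {}"
      proof (intro ballI impI)
        fix i j assume i: "i \<in> I" and j: "j \<in> I" and ij: "i \<noteq> j"
        show "{Inf (snd i)<..<Sup (snd i)} \<inter> {Inf (snd j)<..<Sup (snd j)} = {}"
        proof (cases "fst i = fst j")
          case True
          then have "interior (snd i) \<inter> interior (snd j) = {}"
            using R(3)[of "fst i" "snd i" "snd j"] i j ij unfolding I_def by (auto simp: prod_eq_iff)
          moreover have "interior (snd l) = {Inf (snd l)<..<Sup (snd l)}" if "l \<in> I" for l
            using int[OF that] by (metis interior_atLeastAtMost_real)
          ultimately show ?thesis using i j by simp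
        next
          case False
          then have "{fst (fst i)..snd (fst i)} \<inter> {fst (fst j)..snd (fst j)} = {}"
            using D(3) i j unfolding I_def by auto
          then have "snd i \<inter> snd j = {}" using int[OF i] int[OF j] by blast
          moreover have "{Inf (snd l)<..<Sup (snd l)} \<subseteq> snd l" if "l \<in> I" for l
            using int[OF that] greaterThanLessThan_subseteq_atLeastAtMost_iff by (metis order_refl)
          ultimately show ?thesis using i j by blast
        qed
      qed
      show "(\<Sum>i\<in>I. Sup (snd i) - Inf (snd i)) < \<delta>0"
        using tot[of "\<lambda>x. x"] mUD mUD_ub mUC \<delta> by simp
    qed
    then have "\<bar>\<Sum>i\<in>I. f (Sup (snd i)) - f (Inf (snd i))\<bar> < k * m / 2"
      unfolding real_norm_def by (rule order_le_less_trans[OF sum_abs])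
    moreover have "(\<Sum>p\<in>D. f (snd p) - f (fst p)) \<le> (\<Sum>p\<in>D. -k * (snd p - fst p))"
      using D'(3) by (intro sum_mono) (auto intro: less_imp_le)
    moreover have "(\<Sum>p\<in>D. -k * (snd p - fst p)) = -k * measure lebesgue UD"
      unfolding mUD by (rule sum_distrib_left[symmetric])
    moreover have "(\<Sum>p\<in>C. f (snd p) - f (fst p)) \<ge> (\<Sum>p\<in>C. k * (snd p - fst p))"
      using C'(3) by (intro sum_mono) (auto intro: less_imp_le)
    moreover have "(\<Sum>p\<in>C. k * (snd p - fst p)) = k * (\<Sum>p\<in>C. snd p - fst p)"
      by (rule sum_distrib_left[symmetric])
    ultimately have "k * (\<Sum>p\<in>C. snd p - fst p) + k * measure lebesgue UD < k * m / 2"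
      using tot[of f] by simp
    then have "k * ((\<Sum>p\<in>C. snd p - fst p) + measure lebesgue UD) < k * (m / 2)" by (simp add: algebra_simps)
    then have "(\<Sum>p\<in>C. snd p - fst p) + measure lebesgue UD < m / 2" using k by simp
    then show False using mUC mUD_lb \<delta> m by linarith
  qed
  then have "negligible (\<Union>n::nat. ?E \<inter> {- real n<..<real n})" by (intro negligible_countable_Union) auto
  then show ?thesis
  proof (rule negligible_subset)
    show "?E \<subseteq> (\<Union>n::nat. ?E \<inter> {- real n<..<real n})"
    proof
      fix t assume t: "t \<in> ?E"
      obtain n :: nat where "\<bar>t\<bar> < real n" using reals_Archimedean2 by blast
      then have "t \<in> {- real n<..<real n}" by auto
      with t show "t \<in> (\<Union>n::nat. ?E \<inter> {- real n<..<real n})" by blast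
    qed
  qed
qed

text \<open>If the set had measure \<open>m > 0\<close> in a short interval, disjoint intervals of
  steepness above \<open>n > 2 / m\<close> covering half of it would have increments of total size
  above 1, although their total length is below the \<open>\<delta>\<close> that belongs to 1.
  Negligibility is a local property, so short intervals suffice.\<close>

lemma unbounded_slopes_negligible:
  fixes f :: "real \<Rightarrow> real"
  assumes ac: "\<And>a b. abs_continuous_on {a..b} f"
  shows "negligible {t. \<forall>n::nat. \<exists>\<^sub>F y in at t. (f y - f t) / (y - t) \<in> {s. real n < \<bar>s\<bar>}}" (is "negligible ?E")
proof -
  have cont: "continuous_on UNIV f" by (rule continuous_on_UNIV_if_abs_continuous[OF ac])
  have op: "open {s::real. c < \<bar>s\<bar>}" for c by (intro open_Collect_less continuous_intros)
  have Eb: "?E \<in> sets borel"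
  proof -
    have "?E = (\<Inter>n. {t. \<exists>\<^sub>F y in at t. (f y - f t) / (y - t) \<in> {s. real n < \<bar>s\<bar>}})" by blast
    also have "\<dots> \<in> sets borel" by (intro sets.countable_INT image_subsetI frequently_slope_borel cont op) auto
    finally show ?thesis .
  qed
  have "\<exists>d>0. negligible (?E \<inter> {t0 - d<..<t0 + d})" for t0
  proof -
    obtain \<delta> where \<delta>: "\<delta> > 0" "\<And>(I::(real \<times> real) set) u v. finite I \<Longrightarrow> (\<forall>i\<in>I. u i \<le> v i \<and> {u i..v i} \<subseteq> {t0 - 1..t0 + 1}) \<Longrightarrow>
      (\<forall>i\<in>I. \<forall>j\<in>I. i \<noteq> j \<longrightarrow> {u i<..<v i} \<inter> {u j<..<v j} = {}) \<Longrightarrow> (\<Sum>i\<in>I. v i - u i) < \<delta> \<Longrightarrow>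
      (\<Sum>i\<in>I. norm (f (v i) - f (u i))) < 1"
      by (rule abs_continuous_onE[OF ac zero_less_one, of "t0 - 1" "t0 + 1", where 'i="real \<times> real"]) (rule that)
    define d where "d = min 1 (\<delta> / 3)"
    have d: "d > 0" "d \<le> 1" "2 * d < \<delta>" using \<delta> by (auto simp: d_def)
    define O' where "O' = {t0 - d<..<t0 + d}"
    have O'l: "O' \<in> lmeasurable" "open O'" "measure lebesgue O' = 2 * d"
    proof -
      show "O' \<in> lmeasurable" unfolding O'_def by (simp add: lmeasurable_box flip: box_real)
      show "open O'" "measure lebesgue O' = 2 * d" using d by (simp_all add: O'_def)
    qed
    define E where "E = ?E \<inter> O'"
    have El: "E \<in> lmeasurable"
      unfolding E_def by (subst Int_commute, intro fmeasurable_Int_fmeasurable sets_completionI_sets O'l)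
        (use Eb in simp_all)
    have "negligible E"
    proof (rule ccontr)
      assume "\<not> negligible E"
      then have m: "measure lebesgue E > 0"
        using El by (metis measure_nonneg negligible_iff_measure order_less_le)
      define m where "m = measure lebesgue E"
      obtain n :: nat where n: "2 / m < real n" using reals_Archimedean2 by blast
      have s: "\<exists>u v. u < v \<and> real n < \<bar>(f v - f u) / (v - u)\<bar> \<and> t \<in> {u..v} \<and> v - u < e" if "t \<in> E" "e > 0" for t e
        using that frequently_slope_interval[of f t "{s. real n < \<bar>s\<bar>}" e] unfolding E_def by simp
      obtain D where D: "finite D" "\<And>u v. (u, v) \<in> D \<Longrightarrow> u < v \<and> real n < \<bar>(f v - f u) / (v - u)\<bar> \<and> {u..v} \<subseteq> O'"
        "\<And>p q. p \<in> D \<Longrightarrow> q \<in> D \<Longrightarrow> p \<noteq> q \<Longrightarrow> {fst p..snd p} \<inter> {fst q..snd q} = {}"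
        "m - m / 2 < measure lebesgue (E \<inter> (\<Union>p\<in>D. {fst p..snd p}))"
      proof (rule vitali_finite_intervals[OF El _ O'l(2) _ s, of "m / 2", folded m_def])
        show "E \<subseteq> O'" by (simp add: E_def)
        show "0 < m / 2" using m by (simp add: m_def)
      qed (assumption+, rule that)
      have D': "fst p < snd p" "{fst p..snd p} \<subseteq> O'" "\<bar>f (snd p) - f (fst p)\<bar> > real n * (snd p - fst p)" if "p \<in> D"
        for p
        using D(2)[of "fst p" "snd p"] that by (auto simp: pos_less_divide_eq)
      define UD where "UD = (\<Union>p\<in>D. {fst p..snd p})"
      have UD: "UD \<in> lmeasurable" unfolding UD_def using D(1) by (auto simp flip: box_real)
      have mUD: "measure lebesgue UD = (\<Sum>p\<in>D. snd p - fst p)"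
        unfolding UD_def using D(1,3) D'(1) by (intro measure_disjoint_intervals) (auto intro: less_imp_le)
      have "measure lebesgue (E \<inter> UD) \<le> measure lebesgue UD" using UD El by (intro measure_mono_fmeasurable) auto
      then have lb: "m / 2 < (\<Sum>p\<in>D. snd p - fst p)" using D(4) unfolding UD_def[symmetric] mUD by linarith
      have "measure lebesgue UD \<le> measure lebesgue O'" using UD O'l D'(2)
        by (intro measure_mono_fmeasurable) (auto simp: UD_def)
      then have ub: "(\<Sum>p\<in>D. snd p - fst p) < \<delta>" using mUD O'l d by simp
      have "(\<Sum>p\<in>D. norm (f (snd p) - f (fst p))) < 1"
      proof (rule \<delta>(2)[OF D(1) _ _ ub])
        have "O' \<subseteq> {t0 - 1..t0 + 1}" using d by (auto simp: O'_def)
        then show "\<forall>i\<in>D. fst i \<le> snd i \<and> {fst i..snd i} \<subseteq> {t0 - 1..t0 + 1}" using D'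
          by (meson less_imp_le order_trans)
        show "\<forall>i\<in>D. \<forall>j\<in>D. i \<noteq> j \<longrightarrow> {fst i<..<snd i} \<inter> {fst j<..<snd j} = {}"
        proof (intro ballI impI)
          fix i j assume "i \<in> D" "j \<in> D" "i \<noteq> j"
          then have "{fst i..snd i} \<inter> {fst j..snd j} = {}" by (rule D(3))
          moreover have "{fst l<..<snd l} \<subseteq> {fst l..snd l}" for l :: "real \<times> real" by auto
          ultimately show "{fst i<..<snd i} \<inter> {fst j<..<snd j} = {}" by blast
        qed
      qed
      moreover have "real n * (\<Sum>p\<in>D. snd p - fst p) \<le> (\<Sum>p\<in>D. norm (f (snd p) - f (fst p)))"
        unfolding sum_distrib_left using D'(3) by (intro sum_mono) (auto intro: less_imp_le)
      moreover have "1 < real n * (m / 2)" using n m by (simp add: m_def field_simps)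
      moreover have "real n * (m / 2) \<le> real n * (\<Sum>p\<in>D. snd p - fst p)" using lb by (intro mult_left_mono) auto
      ultimately show False by linarith
    qed
    then show ?thesis using d unfolding E_def O'_def by blast
  qed
  note loc = this
  show ?thesis unfolding locally_negligible_alt[of ?E]
  proof
    fix t0 assume t0: "t0 \<in> ?E"
    obtain d where d: "d > 0" "negligible (?E \<inter> {t0 - d<..<t0 + d})" using loc by blast
    show "\<exists>U. openin (top_of_set ?E) U \<and> t0 \<in> U \<and> negligible U"
    proof (intro exI conjI)
      show "openin (top_of_set ?E) (?E \<inter> {t0 - d<..<t0 + d})" by (intro openin_open_Int) auto
      show "t0 \<in> ?E \<inter> {t0 - d<..<t0 + d}" using t0 d(1) by simp
    qed (fact d)
  qed
qed

text \<open>The candidate is the lower limit, the supremum of the eventual lower bounds. The values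
  are frequently below any rational \<open>p\<close> above it, so by \<open>gap\<close> they
  eventually do not exceed any larger rational.\<close>

lemma tendsto_if_no_rational_gap:
  fixes s :: "'a \<Rightarrow> real"
  assumes F: "F \<noteq> bot" and M: "\<forall>\<^sub>F y in F. \<bar>s y\<bar> \<le> M"
    and gap: "\<And>p q. p \<in> \<rat> \<Longrightarrow> q \<in> \<rat> \<Longrightarrow> p < q \<Longrightarrow> \<exists>\<^sub>F y in F. s y < p \<Longrightarrow> \<not> (\<exists>\<^sub>F y in F. q < s y)"
  shows "\<exists>l. (s \<longlongrightarrow> l) F"
proof -
  define A where "A = {c. \<forall>\<^sub>F y in F. c \<le> s y}"
  define l where "l = Sup A"
  have ne: "- M \<in> A" unfolding A_def using M by (auto elim!: eventually_mono)
  have ub: "c \<le> M" if "c \<in> A" for c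
  proof -
    have "\<forall>\<^sub>F y in F. c \<le> s y \<and> \<bar>s y\<bar> \<le> M" using that M unfolding A_def by (simp add: eventually_conj)
    then obtain y where "c \<le> s y \<and> \<bar>s y\<bar> \<le> M" using eventually_happens'[OF F] by blast
    then show ?thesis by linarith
  qed
  have bdd: "bdd_above A" using ub by (rule bdd_aboveI)
  have "(s \<longlongrightarrow> l) F"
  proof (rule order_tendstoI)
    fix a assume "a < l"
    then obtain c where "c \<in> A" "a < c" unfolding l_def using less_cSup_iff[OF _ bdd, of a] ne by blast
    then show "\<forall>\<^sub>F y in F. a < s y" unfolding A_def by (auto elim!: eventually_mono)
  next
    fix a assume a: "l < a"
    obtain p where p: "p \<in> \<rat>" "l < p" "p < a" using Rats_dense_in_real[OF a] by blast
    obtain q where q: "q \<in> \<rat>" "p < q" "q < a" using Rats_dense_in_real[OF p(3)] by blast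
    have "p \<notin> A" using cSup_upper[OF _ bdd, of p] p(2) unfolding l_def by linarith
    then have "\<exists>\<^sub>F y in F. s y < p" unfolding A_def frequently_def by (simp add: not_less)
    from gap[OF p(1) q(1,2) this] have "\<forall>\<^sub>F y in F. s y \<le> q" unfolding frequently_def by (simp add: not_less)
    then show "\<forall>\<^sub>F y in F. s y < a" using q(3) by (auto elim!: eventually_mono)
  qed
  then show ?thesis by blast
qed

text \<open>Where the derivative fails to exist, the slopes are unbounded or pass frequently below
  \<open>p\<close> and frequently above \<open>q\<close> for some rationals \<open>p < q\<close>.
  There are countably many such pairs, and each exceptional set is null.\<close>

lemma abs_continuous_real_differentiable_ae:
  fixes f :: "real \<Rightarrow> real"
  assumes ac: "\<And>a b. abs_continuous_on {a..b} f"
  shows "negligible {t. \<not> f differentiable (at t)}"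
proof -
  define X where "X p q = {t. (\<exists>\<^sub>F y in at t. (f y - f t) / (y - t) < p) \<and> (\<exists>\<^sub>F y in at t. q < (f y - f t) / (y - t))}"
    for p q
  define Z where "Z = {t. \<forall>n::nat. \<exists>\<^sub>F y in at t. (f y - f t) / (y - t) \<in> {s. real n < \<bar>s\<bar>}}"
  have X: "negligible (X p q)" if "p < q" for p q
  proof -
    \<comment> \<open>Subtracting a linear function with the mean slope moves the gap to
      \<open>- (q - p) / 2\<close> and \<open>(q - p) / 2\<close>, the symmetric form treated in
      \<open>opposite_slopes_negligible\<close>.\<close>
    define c where "c = (p + q) / 2"
    define g where "g t = f t + (- c) * t" for t
    have "abs_continuous_on {a..b} g" for a b
    proof -
      have "norm ((- c) * v - (- c) * u) \<le> \<bar>c\<bar> * (v - u)" if "u \<le> v" for u v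
        using that by (simp only: right_diff_distrib[symmetric] norm_mult) simp
      then show ?thesis
        unfolding g_def by (intro abs_continuous_on_add ac abs_continuous_on_lipschitz[where L="\<bar>c\<bar>"]) blast
    qed
    from opposite_slopes_negligible[of g "(q - p) / 2", OF this] that
    have neg: "negligible {t. (\<exists>\<^sub>F y in at t. (g y - g t) / (y - t) \<in> {..<- ((q - p) / 2)}) \<and>
      (\<exists>\<^sub>F y in at t. (g y - g t) / (y - t) \<in> {(q - p) / 2<..})}" by simp
    have sl: "(g y - g t) / (y - t) = (f y - f t) / (y - t) - c" if "y \<noteq> t" for y t
      using that unfolding g_def by (simp add: divide_simps) (simp add: algebra_simps)
    have nt: "\<forall>\<^sub>F y in at t. y \<noteq> t" for t :: real by (simp add: eventually_at_filter)
    show ?thesis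
    proof (rule negligible_subset[OF neg], rule subsetI)
      fix t assume "t \<in> X p q"
      then have *: "\<exists>\<^sub>F y in at t. (f y - f t) / (y - t) < p" "\<exists>\<^sub>F y in at t. q < (f y - f t) / (y - t)"
        unfolding X_def by auto
      have "\<exists>\<^sub>F y in at t. (g y - g t) / (y - t) \<in> {..<- ((q - p) / 2)}"
      proof (rule frequently_elim1[OF frequently_eventually_conj[OF *(1) nt]])
        fix y assume y: "y \<noteq> t \<and> (f y - f t) / (y - t) < p"
        then have "(g y - g t) / (y - t) = (f y - f t) / (y - t) - (p + q) / 2" using sl[of y t] by (simp add: c_def)
        with y show "(g y - g t) / (y - t) \<in> {..<- ((q - p) / 2)}" unfolding lessThan_iff by argo
      qed
      moreover have "\<exists>\<^sub>F y in at t. (g y - g t) / (y - t) \<in> {(q - p) / 2<..}"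
      proof (rule frequently_elim1[OF frequently_eventually_conj[OF *(2) nt]])
        fix y assume y: "y \<noteq> t \<and> q < (f y - f t) / (y - t)"
        then have "(g y - g t) / (y - t) = (f y - f t) / (y - t) - (p + q) / 2" using sl[of y t] by (simp add: c_def)
        with y show "(g y - g t) / (y - t) \<in> {(q - p) / 2<..}" unfolding greaterThan_iff by argo
      qed
      ultimately show "t \<in> {t. (\<exists>\<^sub>F y in at t. (g y - g t) / (y - t) \<in> {..<- ((q - p) / 2)}) \<and>
      (\<exists>\<^sub>F y in at t. (g y - g t) / (y - t) \<in> {(q - p) / 2<..})}" by simp
    qed
  qed
  have Z: "negligible Z" unfolding Z_def by (rule unbounded_slopes_negligible[OF ac])
  define PQ where "PQ = {(p::real, q). p \<in> \<rat> \<and> q \<in> \<rat> \<and> p < q}"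
  have "countable PQ" by (rule countable_subset[of _ "\<rat> \<times> \<rat>"]) (auto simp: PQ_def countable_rat)
  then have "negligible (\<Union>pq\<in>PQ. X (fst pq) (snd pq))"
    using X by (intro negligible_countable_Union countable_image) (auto simp: PQ_def)
  with Z have neg: "negligible (Z \<union> (\<Union>pq\<in>PQ. X (fst pq) (snd pq)))" by (rule negligible_Un)
  show ?thesis
  proof (rule negligible_subset[OF neg], rule subsetI, rule ccontr)
    fix t assume t: "t \<in> {t. \<not> f differentiable at t}" and n: "t \<notin> Z \<union> (\<Union>pq\<in>PQ. X (fst pq) (snd pq))"
    from n obtain k :: nat where "\<not> (\<exists>\<^sub>F y in at t. (f y - f t) / (y - t) \<in> {s. real k < \<bar>s\<bar>})" unfolding Z_def
      by blast
    then have M: "\<forall>\<^sub>F y in at t. \<bar>(f y - f t) / (y - t)\<bar> \<le> real k" unfolding frequently_def by (simp add: not_less)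
    have "\<exists>l. ((\<lambda>y. (f y - f t) / (y - t)) \<longlongrightarrow> l) (at t)"
    proof (rule tendsto_if_no_rational_gap[OF _ M])
      fix p q :: real assume pq: "p \<in> \<rat>" "q \<in> \<rat>" "p < q" "\<exists>\<^sub>F y in at t. (f y - f t) / (y - t) < p"
      then have "(p, q) \<in> PQ" by (simp add: PQ_def)
      with n have "t \<notin> X p q" by force
      with pq(4) show "\<not> (\<exists>\<^sub>F y in at t. q < (f y - f t) / (y - t))" unfolding X_def by blast
    qed simp
    then have "\<exists>l. (f has_field_derivative l) (at t)" by (simp add: has_field_derivative_iff)
    with t show False using real_differentiable_def by blast
  qed
qed

text \<open>Constant extension beyond the endpoints: it makes results about the whole line available
  on an interval and lets curves be glued by addition.\<close>

lemma abs_continuous_on_clamp: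
  assumes "abs_continuous_on {a..b} f" "a \<le> b"
  shows "abs_continuous_on {c..d} (\<lambda>t. f (max a (min b t)))"
  by (rule abs_continuous_on_compose[OF assms(1) zero_less_one]) (use assms(2) in \<open>auto simp: max_def min_def\<close>)

lemma abs_continuous_differentiable_ae:
  fixes f :: "real \<Rightarrow> 'b::euclidean_space"
  assumes ac: "abs_continuous_on {a..b} f"
  shows "\<exists>N. negligible N \<and> (\<forall>t\<in>{a<..<b} - N. f differentiable (at t))"
proof (cases "a \<le> b")
  case True
  define N where "N i = {t. \<not> (\<lambda>t. f (max a (min b t)) \<bullet> i) differentiable (at t)}" for i
  have "negligible (N i)" for i unfolding N_def
    by (intro abs_continuous_real_differentiable_ae abs_continuous_on_bounded_linear[OF _ bounded_linear_inner_left]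
        abs_continuous_on_clamp ac True)
  then have "negligible (\<Union>i\<in>Basis. N i)"
    by (intro negligible_countable_Union countable_image) (auto intro: countable_finite)
  moreover have "f differentiable (at t)" if t: "t \<in> {a<..<b}" "t \<notin> (\<Union>i\<in>Basis. N i)" for t
  proof -
    have "(\<lambda>t. f (max a (min b t))) differentiable (at t)"
      using t(2) unfolding N_def by (subst differentiable_componentwise_within) auto
    then obtain D where "((\<lambda>t. f (max a (min b t))) has_derivative D) (at t)" unfolding differentiable_def by blast
    then have "(f has_derivative D) (at t)"
      by (rule has_derivative_transform_within_open[of _ _ _ _ "{a<..<b}"]) (use t(1) in auto)
    then show ?thesis unfolding differentiable_def by blast
  qed
  ultimately show ?thesis by (intro exI[of _ "\<Union>i\<in>Basis. N i"]) auto
qed (auto intro: exI[of _ "{}"])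

text \<open>The gauge integral asks for no integrability of \<open>f'\<close> in advance. Intervals
  tagged outside \<open>N\<close> are controlled by the derivative; those tagged in \<open>N\<close>
  lie in an open set of measure below \<open>\<delta>\<close>, so that absolute continuity bounds
  their increments, while \<open>f'\<close> contributes nothing there.\<close>

lemma abs_continuous_has_integral:
  fixes f :: "real \<Rightarrow> 'b::euclidean_space"
  assumes ab: "a < b" and ac: "abs_continuous_on {a..b} f" and N: "negligible N"
    and f': "\<And>t. t \<in> {a..b} - N \<Longrightarrow> (f has_vector_derivative f' t) (at t within {a..b})"
    and f'N: "\<And>t. t \<in> N \<Longrightarrow> f' t = 0"
  shows "(f' has_integral (f b - f a)) {a..b}"
  unfolding has_integral_factor_content box_real[symmetric]
proof (intro allI impI)
  fix e :: real assume e: "e > 0"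
  have e2: "e / 2 > 0" using e by simp
  have "\<forall>x. \<exists>d>0. x \<in> {a..b} - N \<longrightarrow>
         (\<forall>y\<in>{a..b}. norm (y-x) < d \<longrightarrow> norm (f y - f x - (y-x) *\<^sub>R f' x) \<le> e / 2 * norm (y-x))"
  proof
    fix x
    show "\<exists>d>0. x \<in> {a..b} - N \<longrightarrow>
         (\<forall>y\<in>{a..b}. norm (y-x) < d \<longrightarrow> norm (f y - f x - (y-x) *\<^sub>R f' x) \<le> e / 2 * norm (y-x))"
    proof (cases "x \<in> {a..b} - N")
      case True
      from f'[OF this, unfolded has_vector_derivative_def has_derivative_within_alt] e2 show ?thesis by blast
    qed (auto intro: exI[of _ 1])
  qed
  then obtain d where d: "\<And>x. 0 < d x"
      "\<And>x y. \<lbrakk>x \<in> {a..b} - N; y \<in> {a..b}; norm (y-x) < d x\<rbrakk> \<Longrightarrow> norm (f y - f x - (y-x) *\<^sub>R f' x) \<le> e / 2 * norm (y-x)"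
    unfolding choice_iff by blast
  have e3: "e * (b - a) / 2 > 0" using e ab by simp
  obtain \<delta> where \<delta>: "\<delta> > 0" "\<And>(I::(real \<times> real set) set) u v. finite I \<Longrightarrow> (\<forall>i\<in>I. u i \<le> v i \<and> {u i..v i} \<subseteq> {a..b}) \<Longrightarrow>
      (\<forall>i\<in>I. \<forall>j\<in>I. i \<noteq> j \<longrightarrow> {u i<..<v i} \<inter> {u j<..<v j} = {}) \<Longrightarrow> (\<Sum>i\<in>I. v i - u i) < \<delta> \<Longrightarrow>
      (\<Sum>i\<in>I. norm (f (v i) - f (u i))) < e * (b - a) / 2"
    by (rule abs_continuous_onE[OF ac e3, where 'i="real \<times> real set"]) (rule that)
  obtain T where T: "open T" "N \<subseteq> T" "T - N \<in> lmeasurable" "emeasure lebesgue (T - N) < ennreal \<delta>"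
    using sets_lebesgue_outer_open[OF negligible_imp_sets[OF N] \<delta>(1)] by blast
  have Tm: "T \<in> lmeasurable" "measure lebesgue T = measure lebesgue (T - N)"
  proof -
    have n: "negligible ((T - N) - T \<union> (T - (T - N)))" by (rule negligible_subset[OF N]) auto
    show "T \<in> lmeasurable" using T(3) n by (rule lmeasurable_negligible_symdiff)
    show "measure lebesgue T = measure lebesgue (T - N)" using T(3) n by (rule measure_negligible_symdiff)
  qed
  have mT: "measure lebesgue T < \<delta>"
    using T(3,4) unfolding Tm(2) by (simp add: emeasure_eq_measure2 ennreal_less_iff)
  have "\<forall>x. \<exists>r>0. x \<in> N \<longrightarrow> ball x r \<subseteq> T"
  proof
    fix x
    show "\<exists>r>0. x \<in> N \<longrightarrow> ball x r \<subseteq> T"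
    proof (cases "x \<in> N")
      case True
      with T(1,2) show ?thesis unfolding open_contains_ball by blast
    qed (auto intro: exI[of _ 1])
  qed
  then obtain r where r: "\<And>x. r x > 0" "\<And>x. x \<in> N \<Longrightarrow> ball x (r x) \<subseteq> T" unfolding choice_iff by blast
  define \<rho> where "\<rho> x = (if x \<in> N then r x else d x)" for x
  show "\<exists>\<gamma>. gauge \<gamma> \<and> (\<forall>p. p tagged_division_of cbox a b \<and> \<gamma> fine p \<longrightarrow>
    norm ((\<Sum>(x, k)\<in>p. measure lborel k *\<^sub>R f' x) - (f b - f a)) \<le> e * measure lborel (cbox a b))"
  proof (intro exI[of _ "\<lambda>x. ball x (\<rho> x)"] conjI allI impI)
    show "gauge (\<lambda>x. ball x (\<rho> x))" using d(1) r(1) by (intro gauge_ball_dependent) (auto simp: \<rho>_def)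
    fix p assume "p tagged_division_of cbox a b \<and> (\<lambda>x. ball x (\<rho> x)) fine p"
    then have ptag: "p tagged_division_of {a..b}" and fine: "(\<lambda>x. ball x (\<rho> x)) fine p" by (auto simp: box_real)
    have fin: "finite p" using ptag by auto
    have pK: "\<exists>u v. u \<le> v \<and> K = {u..v} \<and> x \<in> K \<and> K \<subseteq> {a..b} \<and> K \<subseteq> ball x (\<rho> x)" if K: "(x, K) \<in> p" for x K
    proof -
      obtain u v where "K = {u..v}" using tagged_division_ofD(4)[OF ptag K] by (auto simp: box_real)
      moreover have "x \<in> K" "K \<subseteq> {a..b}" using tagged_division_ofD(2,3)[OF ptag K] by auto
      moreover have "K \<subseteq> ball x (\<rho> x)" using fine K unfolding fine_def by blast
      ultimately show ?thesis by auto
    qed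
    define \<Delta> where "\<Delta> i = f (Sup (snd i)) - f (Inf (snd i))" for i :: "real \<times> real set"
    define p1 where "p1 = {i\<in>p. fst i \<in> N}"
    have p1: "p1 \<subseteq> p" "finite p1" using fin by (auto simp: p1_def)
    have ba: "b - a = (\<Sum>i\<in>p. Sup (snd i) - Inf (snd i))" "f b - f a = (\<Sum>i\<in>p. \<Delta> i)"
      using additive_tagged_division_1[OF _ ptag, where f="\<lambda>x. x"] additive_tagged_division_1[OF _ ptag, of f] ab
      by (auto simp: case_prod_beta \<Delta>_def)
    have "norm (\<Sum>i\<in>p - p1. measure lborel (snd i) *\<^sub>R f' (fst i) - \<Delta> i) \<le> (\<Sum>i\<in>p - p1. e / 2 * (Sup (snd i) - Inf (snd i)))"
    proof (rule sum_norm_le)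
      fix i assume i: "i \<in> p - p1"
      obtain x K where xK: "i = (x, K)" by fastforce
      obtain u v where uv: "u \<le> v" "K = {u..v}" "x \<in> K" "K \<subseteq> {a..b}" "K \<subseteq> ball x (\<rho> x)" using pK i xK by blast
      have xN: "x \<in> {a..b} - N" using i uv by (auto simp: p1_def xK)
      have uvK: "u \<in> K" "v \<in> K" using uv by auto
      have *: "norm (f w - f x - (w - x) *\<^sub>R f' x) \<le> e / 2 * norm (w - x)" if "w \<in> K" for w
        using d(2)[OF xN] that uv xN by (auto simp: dist_real_def \<rho>_def abs_minus_commute)
      have "norm ((v - u) *\<^sub>R f' x - (f v - f u)) = norm (f u - f x - (u - x) *\<^sub>R f' x - (f v - f x - (v - x) *\<^sub>R f' x))"
        by (auto simp: algebra_simps)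
      also have "\<dots> \<le> e / 2 * norm (u - x) + e / 2 * norm (v - x)"
        by (rule order_trans[OF norm_triangle_ineq4]) (intro add_mono * uvK)
      also have "\<dots> = e / 2 * (v - u)" using uv by (simp add: field_simps)
      finally show "norm (measure lborel (snd i) *\<^sub>R f' (fst i) - \<Delta> i) \<le> e / 2 * (Sup (snd i) - Inf (snd i))"
        using uv by (simp add: xK \<Delta>_def)
    qed
    also have "\<dots> \<le> (\<Sum>i\<in>p. e / 2 * (Sup (snd i) - Inf (snd i)))"
    proof (rule sum_mono2[OF fin])
      fix i assume "i \<in> p - (p - p1)"
      then show "0 \<le> e / 2 * (Sup (snd i) - Inf (snd i))" using pK[of "fst i" "snd i"] e by auto
    qed auto
    also have "\<dots> = e * (b - a) / 2" unfolding ba(1) sum_distrib_left[symmetric] by simp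
    finally have A: "norm (\<Sum>i\<in>p - p1. measure lborel (snd i) *\<^sub>R f' (fst i) - \<Delta> i) \<le> e * (b - a) / 2" .
    have "(\<Sum>i\<in>p1. norm (f (Sup (snd i)) - f (Inf (snd i)))) < e * (b - a) / 2"
    proof (rule \<delta>(2)[OF p1(2)])
      have int: "Inf (snd i) \<le> Sup (snd i) \<and> {Inf (snd i)..Sup (snd i)} = snd i \<and> snd i \<subseteq> {a..b}" if "i \<in> p" for i
        using pK[of "fst i" "snd i"] that by auto
      then show "\<forall>i\<in>p1. Inf (snd i) \<le> Sup (snd i) \<and> {Inf (snd i)..Sup (snd i)} \<subseteq> {a..b}" using p1 by fastforce
      show "\<forall>i\<in>p1. \<forall>j\<in>p1. i \<noteq> j \<longrightarrow> {Inf (snd i)<..<Sup (snd i)} \<inter> {Inf (snd j)<..<Sup (snd j)} = {}"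
      proof (intro ballI impI)
        fix i j assume ij: "i \<in> p1" "j \<in> p1" "i \<noteq> j"
        then have "interior (snd i) \<inter> interior (snd j) = {}"
          using tagged_division_ofD(5)[OF ptag, of "fst i" "snd i" "fst j" "snd j"] p1 by auto
        moreover have "interior (snd l) = {Inf (snd l)<..<Sup (snd l)}" if "l \<in> p1" for l
          using int[of l] p1 that by (metis interior_atLeastAtMost_real subsetD)
        ultimately show "{Inf (snd i)<..<Sup (snd i)} \<inter> {Inf (snd j)<..<Sup (snd j)} = {}" using ij by simp
      qed
      have td: "p1 tagged_division_of (\<Union>(snd ` p1))"
        by (rule tagged_partial_division_of_Union_self[OF tagged_partial_division_subset[OF _ p1(1)]])
          (rule conjunct1[OF ptag[unfolded tagged_division_of_def]])
      have "(\<Sum>i\<in>p1. Sup (snd i) - Inf (snd i)) = (\<Sum>(x,K)\<in>p1. measure lborel K)"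
        using pK p1(1) by (intro sum.cong) fastforce+
      also have "\<dots> = (\<Sum>K\<in>snd ` p1. measure lborel K)"
        by (rule sum.over_tagged_division_lemma[OF td]) auto
      also have "\<dots> = (\<Sum>K\<in>snd ` p1. measure lebesgue K)"
        using pK p1(1) by (intro sum.cong) fastforce+
      also have "\<dots> = measure lebesgue (\<Union>(snd ` p1))"
        by (rule content_division[OF division_of_tagged_division[OF td]])
      also have "\<dots> \<le> measure lebesgue T"
      proof (rule measure_mono_fmeasurable[OF _ _ Tm(1)])
        show "\<Union>(snd ` p1) \<subseteq> T" using pK r(2) unfolding p1_def \<rho>_def by fastforce
        show "\<Union>(snd ` p1) \<in> sets lebesgue"
          using lmeasurable_division[OF division_of_tagged_division[OF td]] by auto
      qed
      also have "\<dots> < \<delta>" by (rule mT)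
      finally show "(\<Sum>i\<in>p1. Sup (snd i) - Inf (snd i)) < \<delta>" .
    qed
    then have B: "norm (\<Sum>i\<in>p1. measure lborel (snd i) *\<^sub>R f' (fst i) - \<Delta> i) \<le> e * (b - a) / 2"
      using f'N by (intro order_trans[OF norm_sum]) (simp add: p1_def \<Delta>_def norm_minus_commute)
    have "(\<Sum>(x, k)\<in>p. measure lborel k *\<^sub>R f' x) - (f b - f a) = (\<Sum>i\<in>p. measure lborel (snd i) *\<^sub>R f' (fst i) - \<Delta> i)"
      unfolding ba(2) by (simp add: sum_subtractf case_prod_beta)
    also have "\<dots> = (\<Sum>i\<in>p - p1. measure lborel (snd i) *\<^sub>R f' (fst i) - \<Delta> i) + (\<Sum>i\<in>p1. measure lborel (snd i) *\<^sub>R f' (fst i) - \<Delta> i)"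
      by (rule sum.subset_diff[OF p1(1) fin])
    finally have "norm ((\<Sum>(x, k)\<in>p. measure lborel k *\<^sub>R f' x) - (f b - f a)) \<le> e * (b - a) / 2 + e * (b - a) / 2"
      using order_trans[OF norm_triangle_ineq add_mono[OF A B]] by simp
    then show "norm ((\<Sum>(x, k)\<in>p. measure lborel k *\<^sub>R f' x) - (f b - f a)) \<le> e * measure lborel (cbox a b)"
      using ab by (simp add: box_real)
  qed
qed

text \<open>This is how an action is bounded from below: \<open>F\<close> is the Lagrangian, about
  whose measurability nothing is known, and \<open>g\<close> is a linear functional of the
  curve.\<close>

lemma abs_continuous_increment_le_nn_integral:
  fixes g g' :: "real \<Rightarrow> real"
  assumes ab: "a < b" and ac: "abs_continuous_on {a..b} g" and N: "negligible N"
    and g': "\<And>t. t \<in> {a<..<b} - N \<Longrightarrow> (g has_real_derivative g' t) (at t)"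
    and F: "\<And>t. t \<in> {a<..<b} - N \<Longrightarrow> ennreal (g' t) \<le> F t"
  shows "ennreal (g b - g a) \<le> (\<integral>\<^sup>+t\<in>{a..b}. F t \<partial>lborel)"
proof -
  define N' where "N' = N \<union> {a, b}"
  have N': "negligible N'" unfolding N'_def using N by (auto intro: negligible_Un)
  define G where "G t = (if t \<in> N' then 0 else g' t)" for t
  have G: "(G has_integral (g b - g a)) {a..b}"
  proof (rule abs_continuous_has_integral[OF ab ac N'])
    fix t assume t: "t \<in> {a..b} - N'"
    then have "(g has_real_derivative g' t) (at t)" using g' by (auto simp: N'_def)
    then show "(g has_vector_derivative G t) (at t within {a..b})"
      using t
        by (auto simp: G_def has_real_derivative_iff_has_vector_derivative intro: has_vector_derivative_at_within)
  qed (simp add: G_def)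
  define H where "H t = indicator {a..b} t * G t" for t
  have Hm[measurable]: "H \<in> borel_measurable lebesgue"
    using has_integral_implies_lebesgue_measurable[OF G] by (simp add: H_def[abs_def])
  have "ennreal (g b - g a) \<le> (\<integral>\<^sup>+t. ennreal (H t) \<partial>lebesgue)"
  \<comment> \<open>\<open>G\<close> is only gauge integrable. If its positive part has infinite
    integral there is nothing to prove; otherwise the positive part is Lebesgue integrable and
    dominates \<open>H\<close>.\<close>
  proof (cases "(\<integral>\<^sup>+t. ennreal (H t) \<partial>lebesgue) = \<infinity>")
    case False
    define P where "P t = max 0 (H t)" for t
    have Pm: "P \<in> borel_measurable lebesgue" unfolding P_def by measurable
    have eq: "(\<integral>\<^sup>+t. ennreal (P t) \<partial>lebesgue) = (\<integral>\<^sup>+t. ennreal (H t) \<partial>lebesgue)"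
      by (intro nn_integral_cong) (simp add: P_def max_def ennreal_neg)
    have int: "integrable lebesgue P"
      by (rule integrableI_nonneg[OF Pm]) (use False eq in \<open>auto simp: P_def less_top\<close>)
    have hP: "(P has_integral (integral\<^sup>L lebesgue P)) UNIV" by (rule has_integral_integral_lebesgue[OF int])
    have hH: "(H has_integral (g b - g a)) UNIV"
    proof -
      have "H = (\<lambda>t. if t \<in> {a..b} then G t else 0)" by (auto simp: H_def)
      then show ?thesis using G has_integral_restrict_UNIV[of "{a..b}" G] by simp
    qed
    have "g b - g a \<le> integral\<^sup>L lebesgue P"
      by (rule has_integral_le[OF hH hP]) (auto simp: P_def)
    then have "ennreal (g b - g a) \<le> ennreal (integral\<^sup>L lebesgue P)" by (rule ennreal_leI)
    also have "\<dots> = (\<integral>\<^sup>+t. ennreal (P t) \<partial>lebesgue)"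
      using int by (intro nn_integral_eq_integral[symmetric]) (auto simp: P_def)
    finally show ?thesis unfolding eq .
  qed simp
  also have "\<dots> \<le> (\<integral>\<^sup>+t. F t * indicator {a..b} t \<partial>lebesgue)"
  proof (rule nn_integral_mono_AE)
    have "AE t in lebesgue. t \<notin> N'" using N' by (simp add: negligible_iff_null_sets AE_not_in)
    then show "AE t in lebesgue. ennreal (H t) \<le> F t * indicator {a..b} t"
    proof (rule eventually_mono)
      fix t assume "t \<notin> N'"
      then show "ennreal (H t) \<le> F t * indicator {a..b} t"
        using F[of t] by (auto simp: H_def G_def N'_def indicator_def)
    qed
  qed
  finally show ?thesis by (simp add: nn_integral_completion)
qed

subsection \<open>Lower integrals of arbitrary functions\<close>

text \<open>The integrand of the action is not known to be measurable; on arbitrary functions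
  \<open>nn_integral\<close> is the lower integral, which is attained by a measurable minorant.\<close>

lemma nn_integral_measurable_minorant:
  fixes f :: "'a \<Rightarrow> ennreal"
  obtains g where "g \<in> borel_measurable M" "g \<le> f" "integral\<^sup>N M g = integral\<^sup>N M f"
proof -
  define A where "A = {g. simple_function M g \<and> g \<le> f}"
  have "(\<lambda>_. 0) \<in> A" by (auto simp: A_def le_fun_def)
  then have "A \<noteq> {}" by blast
  from ennreal_SUP_countable_SUP[OF this, of "integral\<^sup>S M"]
  obtain F :: "nat \<Rightarrow> ennreal" where F: "range F \<subseteq> integral\<^sup>S M ` A" "Sup (integral\<^sup>S M ` A) = Sup (range F)" by blast
  have "\<forall>n. \<exists>g\<in>A. F n = integral\<^sup>S M g" using F(1) by blast
  then obtain G where G: "\<And>n. G n \<in> A" "\<And>n. F n = integral\<^sup>S M (G n)" by metis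
  define g where "g x = (SUP n. G n x)" for x
  have Gm[measurable]: "G n \<in> borel_measurable M" for n using G(1)[of n]
    by (auto simp: A_def intro: borel_measurable_simple_function)
  show thesis
  proof
    show "g \<in> borel_measurable M" unfolding g_def by measurable
    show gf: "g \<le> f" unfolding g_def le_fun_def using G(1) by (auto simp: A_def le_fun_def intro: SUP_least)
    have "integral\<^sup>N M f = Sup (range F)" unfolding F(2)[symmetric] nn_integral_def A_def ..
    also have "\<dots> \<le> integral\<^sup>N M g"
    proof (rule SUP_least)
      fix n
      have "F n = integral\<^sup>N M (G n)" using G(1)[of n] unfolding G(2)
        by (simp add: A_def nn_integral_eq_simple_integral)
      also have "\<dots> \<le> integral\<^sup>N M g" unfolding g_def by (intro nn_integral_mono SUP_upper) auto
      finally show "F n \<le> integral\<^sup>N M g" .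
    qed
    finally show "integral\<^sup>N M g = integral\<^sup>N M f"
      using nn_integral_mono[of M g f] gf by (auto simp: le_fun_def intro: antisym)
  qed
qed

text \<open>Lower integrals are in general only superadditive. Over disjoint measurable sets
  additivity survives, since a measurable minorant on the union splits into measurable minorants on
  the parts.\<close>

lemma nn_integral_disjoint_Un:
  fixes f :: "'a \<Rightarrow> ennreal"
  assumes [measurable]: "A \<in> sets M" "B \<in> sets M" and AB: "A \<inter> B = {}"
  shows "(\<integral>\<^sup>+x\<in>A \<union> B. f x \<partial>M) = (\<integral>\<^sup>+x\<in>A. f x \<partial>M) + (\<integral>\<^sup>+x\<in>B. f x \<partial>M)"
proof (rule antisym)
  obtain g where g[measurable]: "g \<in> borel_measurable M" and gf: "g \<le> (\<lambda>x. f x * indicator (A \<union> B) x)"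
    and gi: "integral\<^sup>N M g = (\<integral>\<^sup>+x\<in>A \<union> B. f x \<partial>M)" by (rule nn_integral_measurable_minorant)
  have gp: "g x \<le> f x * indicator (A \<union> B) x" for x using gf by (simp add: le_fun_def)
  have "g x = g x * indicator A x + g x * indicator B x" for x
    using gp[of x] AB by (auto simp: indicator_def)
  then have "integral\<^sup>N M g = (\<integral>\<^sup>+x. g x * indicator A x + g x * indicator B x \<partial>M)" by (intro nn_integral_cong)
  also have "\<dots> = (\<integral>\<^sup>+x\<in>A. g x \<partial>M) + (\<integral>\<^sup>+x\<in>B. g x \<partial>M)" by (intro nn_integral_add) measurable
  also have "\<dots> \<le> (\<integral>\<^sup>+x\<in>A. f x \<partial>M) + (\<integral>\<^sup>+x\<in>B. f x \<partial>M)"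
  proof (intro add_mono nn_integral_mono)
    fix x show "g x * indicator A x \<le> f x * indicator A x" using gp[of x] by (auto simp: indicator_def)
    show "g x * indicator B x \<le> f x * indicator B x" using gp[of x] by (auto simp: indicator_def)
  qed
  finally show "(\<integral>\<^sup>+x\<in>A \<union> B. f x \<partial>M) \<le> (\<integral>\<^sup>+x\<in>A. f x \<partial>M) + (\<integral>\<^sup>+x\<in>B. f x \<partial>M)" by (simp add: gi)
next
  obtain g1 where g1[measurable]: "g1 \<in> borel_measurable M" and gf1: "g1 \<le> (\<lambda>x. f x * indicator A x)"
    and gi1: "integral\<^sup>N M g1 = (\<integral>\<^sup>+x\<in>A. f x \<partial>M)" by (rule nn_integral_measurable_minorant)
  obtain g2 where g2[measurable]: "g2 \<in> borel_measurable M" and gf2: "g2 \<le> (\<lambda>x. f x * indicator B x)"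
    and gi2: "integral\<^sup>N M g2 = (\<integral>\<^sup>+x\<in>B. f x \<partial>M)" by (rule nn_integral_measurable_minorant)
  have "integral\<^sup>N M g1 + integral\<^sup>N M g2 = (\<integral>\<^sup>+x. g1 x + g2 x \<partial>M)" by (intro nn_integral_add[symmetric]) measurable
  also have "\<dots> \<le> (\<integral>\<^sup>+x\<in>A \<union> B. f x \<partial>M)"
  proof (intro nn_integral_mono)
    fix x
    have "g1 x \<le> f x * indicator A x" "g2 x \<le> f x * indicator B x" using gf1 gf2 by (auto simp: le_fun_def)
    then show "g1 x + g2 x \<le> f x * indicator (A \<union> B) x" using AB by (cases "x \<in> A"; cases "x \<in> B") auto
  qed
  finally show "(\<integral>\<^sup>+x\<in>A. f x \<partial>M) + (\<integral>\<^sup>+x\<in>B. f x \<partial>M) \<le> (\<integral>\<^sup>+x\<in>A \<union> B. f x \<partial>M)" by (simp add: gi1 gi2)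
qed

text \<open>One inequality comes from transporting a measurable minorant. It holds for all
  \<open>f\<close> and \<open>c\<close>, and the inverse of such a map is of the same kind, which
  gives the other one.\<close>

lemma nn_integral_isometry_real:
  fixes f :: "real \<Rightarrow> ennreal" and c e :: real
  assumes e: "\<bar>e\<bar> = 1"
  shows "(\<integral>\<^sup>+x. f (c + e * x) \<partial>lborel) = (\<integral>\<^sup>+x. f x \<partial>lborel)"
proof -
  have *: "(\<integral>\<^sup>+x. f x \<partial>lborel) \<le> (\<integral>\<^sup>+x. f (c + e * x) \<partial>lborel)" for f :: "real \<Rightarrow> ennreal" and c
  proof -
    obtain g where g: "g \<in> borel_measurable lborel" "g \<le> f" "integral\<^sup>N lborel g = integral\<^sup>N lborel f"
      by (rule nn_integral_measurable_minorant)
    have "integral\<^sup>N lborel g = (\<integral>\<^sup>+x. g (c + e * x) \<partial>lborel)"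
      using nn_integral_real_affine[of g e c] g(1) e by auto
    also have "\<dots> \<le> (\<integral>\<^sup>+x. f (c + e * x) \<partial>lborel)" using g(2) by (intro nn_integral_mono) (simp add: le_fun_def)
    finally show ?thesis using g(3) by simp
  qed
  have ee: "e * e = 1" using e by (metis abs_mult_self_eq mult_1)
  have "c + e * (- e * c + e * x) = x" for x
    using ee by (simp add: algebra_simps)
  then show ?thesis
    using *[of f c] *[of "\<lambda>x. f (c + e * x)" "- e * c"] by simp
qed

subsection \<open>The mass norm\<close>

text \<open>The isometry from the mass norm to the norm of the library; its inverse is the same map
  for the inverse masses.\<close>

definition mass_scale :: "('n::finite \<Rightarrow> real) \<Rightarrow> ('a::euclidean_space, 'n) vec \<Rightarrow> ('a, 'n) vec" where
  "mass_scale m x = (\<chi> i. sqrt (m i) *\<^sub>R x $ i)"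

lemma mass_inner_scale:
  assumes "\<And>i. m i > 0" shows "mass_inner m x y = mass_scale m x \<bullet> mass_scale m y"
proof -
  have "m i * r = sqrt (m i) * (sqrt (m i) * r)" for i r
    using assms[of i] by (metis abs_of_pos mult.assoc real_sqrt_mult_self)
  then have "m i * (x $ i \<bullet> y $ i) = sqrt (m i) * (sqrt (m i) * (x $ i \<bullet> y $ i))" for i .
  then show ?thesis unfolding mass_inner_def mass_scale_def inner_vec_def by (intro sum.cong) simp_all
qed

lemma mass_norm_scale:
  assumes "\<And>i. m i > 0" shows "mass_norm m x = norm (mass_scale m x)"
  by (simp add: mass_norm_def mass_inner_scale[OF assms] norm_eq_sqrt_inner)

lemma linear_mass_scale: "linear (mass_scale m)"
  by (rule linearI) (simp_all add: mass_scale_def vec_eq_iff algebra_simps)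

lemma bounded_linear_mass_scale: "bounded_linear (mass_scale m)"
  using linear_mass_scale linear_conv_bounded_linear by blast

lemma mass_scale_diff: "mass_scale m (x - y) = mass_scale m x - mass_scale m y"
  by (rule linear_diff[OF linear_mass_scale])

lemma mass_scale_inverse:
  assumes "\<And>i. m i > 0"
  shows "mass_scale m (mass_scale (\<lambda>i. inverse (m i)) x) = x" "mass_scale (\<lambda>i. inverse (m i)) (mass_scale m x) = x"
proof -
  have "sqrt (m i) * sqrt (inverse (m i)) = 1" for i
    using assms[of i] by (simp add: real_sqrt_inverse)
  then show "mass_scale m (mass_scale (\<lambda>i. inverse (m i)) x) = x" "mass_scale (\<lambda>i. inverse (m i)) (mass_scale m x) = x"
    by (simp_all add: mass_scale_def vec_eq_iff mult.commute)
qed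

subsection \<open>The action\<close>

text \<open>The derivative is taken at \<open>t\<close> and not within the interval of integration,
  so that the integrand does not depend on that interval. Within the interval this changes it at the
  endpoints only.\<close>

definition lagrangian ::
    "('n::{finite,linorder} \<Rightarrow> real) \<Rightarrow> real \<Rightarrow> (real \<Rightarrow> ('a::euclidean_space, 'n) vec) \<Rightarrow> real \<Rightarrow> ennreal" where
  "lagrangian m h \<gamma> t =
     ennreal (1 / 2 * (mass_norm m (vector_derivative \<gamma> (at t)))\<^sup>2) + potential m (\<gamma> t) + ennreal h"

lemma action_eq_lagrangian: "action m h a b \<gamma> = (\<integral>\<^sup>+t\<in>{a..b}. lagrangian m h \<gamma> t \<partial>lborel)"
  unfolding action_def
proof (rule nn_integral_cong_AE)
  have "AE t in lborel. t \<noteq> a \<and> t \<noteq> b" using AE_lborel_singleton[of a] AE_lborel_singleton[of b] by auto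
  then show "AE t in lborel. (ennreal (1 / 2 * (mass_norm m (vector_derivative \<gamma> (at t within {a..b})))\<^sup>2) + potential m (\<gamma> t) + ennreal h) *
      indicator {a..b} t = lagrangian m h \<gamma> t * indicator {a..b} t"
  proof (rule eventually_mono)
    fix t assume "t \<noteq> a \<and> t \<noteq> b"
    then show "(ennreal (1 / 2 * (mass_norm m (vector_derivative \<gamma> (at t within {a..b})))\<^sup>2) + potential m (\<gamma> t) + ennreal h) *
      indicator {a..b} t = lagrangian m h \<gamma> t * indicator {a..b} t"
      by (cases "t \<in> {a..b}") (auto simp: lagrangian_def at_within_Icc_at)
  qed
qed

lemma action_split:
  assumes "a \<le> b" "b \<le> c"
  shows "action m h a c \<gamma> = action m h a b \<gamma> + action m h b c \<gamma>"
proof -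
  have "{a..c} = {a..b} \<union> {b<..c}" using assms by auto
  then have "action m h a c \<gamma> = (\<integral>\<^sup>+t\<in>{a..b}. lagrangian m h \<gamma> t \<partial>lborel) + (\<integral>\<^sup>+t\<in>{b<..c}. lagrangian m h \<gamma> t \<partial>lborel)"
    unfolding action_eq_lagrangian by (simp only:) (rule nn_integral_disjoint_Un; auto)
  also have "(\<integral>\<^sup>+t\<in>{b<..c}. lagrangian m h \<gamma> t \<partial>lborel) = (\<integral>\<^sup>+t\<in>{b..c}. lagrangian m h \<gamma> t \<partial>lborel)"
  proof (rule nn_integral_cong_AE)
    show "AE t in lborel. lagrangian m h \<gamma> t * indicator {b<..c} t = lagrangian m h \<gamma> t * indicator {b..c} t"
      using AE_lborel_singleton[of b] by (rule eventually_mono) (auto simp: indicator_def)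
  qed
  finally show ?thesis unfolding action_eq_lagrangian .
qed

lemma action_cong:
  assumes "\<And>t. t \<in> {a<..<b} \<Longrightarrow> \<gamma> t = \<delta> t"
  shows "action m h a b \<gamma> = action m h a b \<delta>"
  unfolding action_eq_lagrangian
proof (rule nn_integral_cong_AE)
  have "AE t in lborel. t \<noteq> a \<and> t \<noteq> b" using AE_lborel_singleton[of a] AE_lborel_singleton[of b] by auto
  then show "AE t in lborel. lagrangian m h \<gamma> t * indicator {a..b} t = lagrangian m h \<delta> t * indicator {a..b} t"
  proof (rule eventually_mono)
    fix t assume t: "t \<noteq> a \<and> t \<noteq> b"
    show "lagrangian m h \<gamma> t * indicator {a..b} t = lagrangian m h \<delta> t * indicator {a..b} t"
    proof (cases "t \<in> {a..b}")
      case True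
      with t have t': "t \<in> {a<..<b}" by auto
      then have "\<forall>\<^sub>F s in nhds t. s \<in> {a<..<b}" by (intro eventually_nhds_in_open) auto
      then have "\<forall>\<^sub>F s in nhds t. s \<in> UNIV \<longrightarrow> \<gamma> s = \<delta> s" using assms by (auto elim: eventually_mono)
      then have "vector_derivative \<gamma> (at t) = vector_derivative \<delta> (at t)"
        by (rule vector_derivative_cong_eq) auto
      then show ?thesis using assms[OF t'] by (simp add: lagrangian_def)
    qed simp
  qed
qed

lemma has_vector_derivative_isometry:
  fixes \<gamma> :: "real \<Rightarrow> 'b::real_normed_vector" and e c :: real
  assumes e: "\<bar>e\<bar> = 1"
  shows "((\<lambda>s. \<gamma> (c + e * s)) has_vector_derivative D) (at t) \<longleftrightarrow> (\<gamma> has_vector_derivative e *\<^sub>R D) (at (c + e * t))"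
proof -
  have *: "((\<lambda>s. \<gamma> (c + e * s)) has_vector_derivative e *\<^sub>R D) (at t)"
    if "(\<gamma> has_vector_derivative D) (at (c + e * t))"
    for c t D and \<gamma> :: "real \<Rightarrow> 'b"
  proof -
    have "((\<lambda>s. c + e * s) has_vector_derivative e) (at t)" by (auto intro!: derivative_eq_intros)
    from vector_diff_chain_at[OF this that] show ?thesis by (simp add: o_def)
  qed
  have ee: "e * e = 1" using e by (metis abs_mult_self_eq mult_1)
  have inv: "c + e * (- e * c + e * x) = x" for x
    using ee by (simp add: algebra_simps)
  have inv2: "- e * c + e * (c + e * t) = t"
    using ee by (simp add: algebra_simps)
  show ?thesis
  proof
    assume "((\<lambda>s. \<gamma> (c + e * s)) has_vector_derivative D) (at t)"
    then have "((\<lambda>s. \<gamma> (c + e * s)) has_vector_derivative D) (at (- e * c + e * (c + e * t)))" by (simp only: inv2)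
    from *[OF this] show "(\<gamma> has_vector_derivative e *\<^sub>R D) (at (c + e * t))" by (simp only: inv)
  next
    assume "(\<gamma> has_vector_derivative e *\<^sub>R D) (at (c + e * t))"
    from *[OF this] show "((\<lambda>s. \<gamma> (c + e * s)) has_vector_derivative D) (at t)" using ee by simp
  qed
qed

lemma action_isometry:
  fixes c e :: real
  assumes m: "\<And>i. m i > 0" and e: "\<bar>e\<bar> = 1" and ab: "a \<le> b"
  shows "action m h a b (\<lambda>s. \<gamma> (c + e * s)) =
    action m h (min (c + e * a) (c + e * b)) (max (c + e * a) (c + e * b)) \<gamma>"
proof -
  have "mass_norm m (vector_derivative (\<lambda>s. \<gamma> (c + e * s)) (at t)) = mass_norm m (vector_derivative \<gamma> (at (c + e * t)))"
    for t
  proof (cases "\<exists>D. (\<gamma> has_vector_derivative D) (at (c + e * t))")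
    case True
    then obtain D where D: "(\<gamma> has_vector_derivative D) (at (c + e * t))" by blast
    have "e * e = 1" using e by (metis abs_mult_self_eq mult_1)
    then have "((\<lambda>s. \<gamma> (c + e * s)) has_vector_derivative e *\<^sub>R D) (at t)"
      using D has_vector_derivative_isometry[OF e, of \<gamma> c "e *\<^sub>R D" t] by simp
    then have "vector_derivative (\<lambda>s. \<gamma> (c + e * s)) (at t) = e *\<^sub>R D" by (rule vector_derivative_at)
    moreover have "vector_derivative \<gamma> (at (c + e * t)) = D" using D by (rule vector_derivative_at)
    ultimately show ?thesis using e by (simp add: mass_norm_scale[OF m] linear_scale[OF linear_mass_scale])
  next
    case False
    \<comment> \<open>Without a derivative, \<open>vector_derivative\<close> chooses from a
      predicate that is false everywhere, the same one for both curves. Hence the integrands agree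
      at every point, for arbitrary \<open>\<gamma>\<close>.\<close>
    then have "(\<lambda>D. ((\<lambda>s. \<gamma> (c + e * s)) has_vector_derivative D) (at t)) = (\<lambda>D. (\<gamma> has_vector_derivative D) (at (c + e * t)))"
      using has_vector_derivative_isometry[OF e, of \<gamma> c _ t] by blast
    then show ?thesis by (simp add: vector_derivative_def)
  qed
  then have l: "lagrangian m h (\<lambda>s. \<gamma> (c + e * s)) t = lagrangian m h \<gamma> (c + e * t)" for t
    by (simp add: lagrangian_def)
  have i: "indicator {a..b} t = (indicator {min (c + e * a) (c + e * b)..max (c + e * a) (c + e * b)} (c + e * t) :: ennreal)"
    for t
  proof -
    have "e = 1 \<or> e = -1" using e by linarith
    then show ?thesis using ab by (auto simp: indicator_def)
  qed
  show ?thesis unfolding action_eq_lagrangian l i by (rule nn_integral_isometry_real[OF e])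
qed

subsection \<open>The Jacobi-Maupertuis distance\<close>

lemma jm_dist_le_action:
  assumes "s0 < s1" "abs_continuous_on {s0..s1} \<gamma>"
  shows "jm_dist m h (\<gamma> s0) (\<gamma> s1) \<le> action m h s0 s1 \<gamma>"
  unfolding jm_dist_def using assms by (intro Inf_lower) blast

lemma jm_dist_less_curve:
  assumes "jm_dist m h x y < c"
  obtains s0 s1 \<gamma> where "s0 < s1" "abs_continuous_on {s0..s1} \<gamma>" "\<gamma> s0 = x" "\<gamma> s1 = y" "action m h s0 s1 \<gamma> < c"
  using assms unfolding jm_dist_def Inf_less_iff by blast

lemma jm_dist_sym_le:
  fixes x y :: "('a::euclidean_space, 'n::{finite,linorder}) vec"
  assumes m: "\<And>i. m i > 0" shows "jm_dist m h y x \<le> jm_dist m h x y"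
  unfolding jm_dist_def[of m h x y]
proof (rule Inf_greatest, clarify)
  fix s0 s1 :: real and \<gamma> :: "real \<Rightarrow> ('a, 'n) vec"
  assume s: "s0 < s1" and ac: "abs_continuous_on {s0..s1} \<gamma>"
  have ac': "abs_continuous_on {-s1..-s0} (\<lambda>t. \<gamma> (0 + (-1) * t))"
    by (rule abs_continuous_on_compose[OF ac zero_less_one]) auto
  have "jm_dist m h (\<gamma> s1) (\<gamma> s0) \<le> action m h (-s1) (-s0) (\<lambda>t. \<gamma> (0 + (-1) * t))"
    using jm_dist_le_action[OF _ ac'] s by simp
  also have "\<dots> = action m h s0 s1 \<gamma>"
    using s by (subst action_isometry[OF m]) auto
  finally show "jm_dist m h (\<gamma> s1) (\<gamma> s0) \<le> action m h s0 s1 \<gamma>" .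
qed

lemma jm_dist_sym: "(\<And>i. m i > 0) \<Longrightarrow> jm_dist m h x y = jm_dist m h y x"
  by (intro antisym jm_dist_sym_le)

lemma jm_dist_triangle:
  fixes x y z :: "('a::euclidean_space, 'n::{finite,linorder}) vec"
  assumes m: "\<And>i. m i > 0"
  shows "jm_dist m h x z \<le> jm_dist m h x y + jm_dist m h y z"
proof (rule ennreal_le_epsilon)
  fix \<epsilon> :: real assume fin: "jm_dist m h x y + jm_dist m h y z < top" and e: "0 < \<epsilon>"
  have "jm_dist m h x y < jm_dist m h x y + ennreal (\<epsilon> / 2)" "jm_dist m h y z < jm_dist m h y z + ennreal (\<epsilon> / 2)"
    using fin e by (auto simp: ennreal_add_less_top less_top)
  note lt = this
  obtain s0 s1 \<gamma> where
    1: "s0 < s1" "abs_continuous_on {s0..s1} \<gamma>" "\<gamma> s0 = x" "\<gamma> s1 = y" "action m h s0 s1 \<gamma> < jm_dist m h x y + ennreal (\<epsilon> / 2)"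
    by (rule jm_dist_less_curve[OF lt(1)])
  obtain r0 r1 \<delta> where
    2: "r0 < r1" "abs_continuous_on {r0..r1} \<delta>" "\<delta> r0 = y" "\<delta> r1 = z" "action m h r0 r1 \<delta> < jm_dist m h y z + ennreal (\<epsilon> / 2)"
    by (rule jm_dist_less_curve[OF lt(2)])
  define c where "c = r0 - s1"
  define s2 where "s2 = r1 - c"
  have s12: "s1 < s2" using 2 by (simp add: s2_def c_def)
  define \<delta>' where "\<delta>' t = \<delta> (c + 1 * t)" for t
  have \<delta>': "abs_continuous_on {s1..s2} \<delta>'" unfolding \<delta>'_def
    by (rule abs_continuous_on_compose[OF 2(2) zero_less_one]) (auto simp: c_def s2_def)
  have \<delta>'v: "\<delta>' s1 = y" "\<delta>' s2 = z" using 2 by (auto simp: \<delta>'_def c_def s2_def)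
  \<comment> \<open>Gluing by addition: each clamped curve is constant where the other one moves,
    and the common value \<open>y\<close> is subtracted. Absolute continuity thus follows from that
    of sums.\<close>
  define \<eta> where "\<eta> t = \<gamma> (max s0 (min s1 t)) + (\<delta>' (max s1 (min s2 t)) + (\<lambda>_. - y) t)" for t
  have \<eta>: "abs_continuous_on {s0..s2} \<eta>" unfolding \<eta>_def
  proof (rule abs_continuous_on_add[OF _ abs_continuous_on_add])
    show "abs_continuous_on {s0..s2} (\<lambda>t. \<gamma> (max s0 (min s1 t)))" using 1 by (intro abs_continuous_on_clamp) auto
    show "abs_continuous_on {s0..s2} (\<lambda>t. \<delta>' (max s1 (min s2 t)))" using \<delta>' s12
      by (intro abs_continuous_on_clamp) auto
    show "abs_continuous_on {s0..s2} (\<lambda>_. - y)" by (rule abs_continuous_on_lipschitz[where L=0]) auto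
  qed
  have \<eta>1: "\<eta> t = \<gamma> t" if "t \<in> {s0..s1}" for t using that 1 s12 \<delta>'v by (auto simp: \<eta>_def)
  have \<eta>2: "\<eta> t = \<delta>' t" if "t \<in> {s1..s2}" for t using that 1 s12 \<delta>'v by (auto simp: \<eta>_def)
  have "jm_dist m h x z \<le> action m h s0 s2 \<eta>"
    using jm_dist_le_action[OF _ \<eta>, of m h] \<eta>1[of s0] \<eta>2[of s2] 1 s12 \<delta>'v by auto
  also have "\<dots> = action m h s0 s1 \<eta> + action m h s1 s2 \<eta>" using 1 s12 by (intro action_split) auto
  also have "action m h s0 s1 \<eta> = action m h s0 s1 \<gamma>" by (rule action_cong) (auto simp: \<eta>1)
  also have "action m h s1 s2 \<eta> = action m h s1 s2 \<delta>'" by (rule action_cong) (auto simp: \<eta>2)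
  also have "action m h s1 s2 \<delta>' = action m h r0 r1 \<delta>"
    unfolding \<delta>'_def using s12 by (subst action_isometry[OF m]) (auto simp: c_def s2_def)
  also have "action m h s0 s1 \<gamma> + action m h r0 r1 \<delta> \<le> (jm_dist m h x y + ennreal (\<epsilon> / 2)) + (jm_dist m h y z + ennreal (\<epsilon> / 2))"
    using 1(5) 2(5) by (intro add_mono) auto
  also have "\<dots> = jm_dist m h x y + jm_dist m h y z + (ennreal (\<epsilon> / 2) + ennreal (\<epsilon> / 2))" by (simp add: ac_simps)
  also have "ennreal (\<epsilon> / 2) + ennreal (\<epsilon> / 2) = ennreal \<epsilon>" using e by (simp flip: ennreal_plus)
  finally show "jm_dist m h x z \<le> jm_dist m h x y + jm_dist m h y z + ennreal \<epsilon>" .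
qed

text \<open>With \<open>k = sqrt (2 * h)\<close>, the linear functional
  \<open>k * (_ \<bullet> u)\<close> in the direction of the displacement acts as a calibration: its
  derivative is at most \<open>k\<close> times the speed, and this is at most half the squared speed
  plus \<open>h\<close> because \<open>(norm (mass_scale m v) - k)\<^sup>2 \<ge> 0\<close>.\<close>

lemma jm_dist_ge_norm:
  fixes x y :: "('a::euclidean_space, 'n::{finite,linorder}) vec"
  assumes m: "\<And>i. m i > 0" and h: "h \<ge> 0"
  shows "ennreal (sqrt (2 * h) * mass_norm m (x - y)) \<le> jm_dist m h x y"
  unfolding jm_dist_def
proof (rule Inf_greatest, clarify)
  fix s0 s1 :: real and \<gamma> :: "real \<Rightarrow> ('a, 'n) vec"
  assume s: "s0 < s1" and ac: "abs_continuous_on {s0..s1} \<gamma>"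
  define k where "k = sqrt (2 * h)"
  have k: "k \<ge> 0" "k * k = 2 * h" using h by (auto simp: k_def)
  define u where "u = sgn (mass_scale m (\<gamma> s1) - mass_scale m (\<gamma> s0))"
  have u1: "norm u \<le> 1" unfolding u_def by (simp add: norm_sgn)
  define g where "g t = k * (mass_scale m (\<gamma> t) \<bullet> u)" for t
  have lin: "bounded_linear (\<lambda>x. k * (mass_scale m x \<bullet> u))"
    by (intro bounded_linear_const_mult bounded_linear_compose[OF bounded_linear_inner_left bounded_linear_mass_scale])
  obtain N where N: "negligible N" "\<And>t. t \<in> {s0<..<s1} - N \<Longrightarrow> \<gamma> differentiable (at t)"
    using abs_continuous_differentiable_ae[OF ac] by blast
  have "ennreal (g s1 - g s0) \<le> (\<integral>\<^sup>+t\<in>{s0..s1}. lagrangian m h \<gamma> t \<partial>lborel)"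
  proof (rule abs_continuous_increment_le_nn_integral[OF s _ N(1)])
    show "abs_continuous_on {s0..s1} g" unfolding g_def by (rule abs_continuous_on_bounded_linear[OF ac lin])
    fix t assume t: "t \<in> {s0<..<s1} - N"
    define v where "v = vector_derivative \<gamma> (at t)"
    have "(\<gamma> has_vector_derivative v) (at t)" unfolding v_def using N(2)[OF t] vector_derivative_works by blast
    from bounded_linear.has_vector_derivative[OF lin this]
    show "(g has_real_derivative k * (mass_scale m v \<bullet> u)) (at t)"
      by (simp add: g_def[abs_def] has_real_derivative_iff_has_vector_derivative)
    have "mass_scale m v \<bullet> u \<le> norm (mass_scale m v)"
      using Cauchy_Schwarz_ineq2[of "mass_scale m v" u] mult_left_mono[OF u1 norm_ge_zero[of "mass_scale m v"]]
        by linarith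
    then have "k * (mass_scale m v \<bullet> u) \<le> k * norm (mass_scale m v)" using k by (intro mult_left_mono)
    also have "\<dots> \<le> 1 / 2 * (norm (mass_scale m v))\<^sup>2 + h"
      using zero_le_power2[of "norm (mass_scale m v) - k"] k(2) by (simp add: power2_eq_square algebra_simps)
    finally have "ennreal (k * (mass_scale m v \<bullet> u)) \<le> ennreal (1 / 2 * (norm (mass_scale m v))\<^sup>2 + h)"
      by (rule ennreal_leI)
    also have "\<dots> = ennreal (1 / 2 * (norm (mass_scale m v))\<^sup>2) + ennreal h" using h by (intro ennreal_plus) auto
    also have "\<dots> \<le> lagrangian m h \<gamma> t"
      unfolding lagrangian_def mass_norm_scale[OF m] v_def by (intro add_right_mono) (simp add: add_increasing2)
    finally show "ennreal (k * (mass_scale m v \<bullet> u)) \<le> lagrangian m h \<gamma> t" .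
  qed
  also have "g s1 - g s0 = k * norm (mass_scale m (\<gamma> s1) - mass_scale m (\<gamma> s0))"
    unfolding g_def right_diff_distrib[symmetric] inner_diff_left[symmetric] u_def
    by (cases "mass_scale m (\<gamma> s1) = mass_scale m (\<gamma> s0)") (simp_all add: sgn_div_norm dot_square_norm power2_eq_square)
  finally show "ennreal (sqrt (2 * h) * mass_norm m (\<gamma> s0 - \<gamma> s1)) \<le> action m h s0 s1 \<gamma>"
    unfolding action_eq_lagrangian mass_norm_scale[OF m] mass_scale_diff k_def by (simp add: norm_minus_commute)
qed

text \<open>The intermediate value theorem along an almost minimizing curve. The strict inequalities
  keep the crossing time away from the endpoints, so that both pieces have positive duration, as
  \<open>jm_dist\<close> demands of its competitors.\<close>

lemma jm_dist_intermediate_point: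
  fixes x y :: "('a::euclidean_space, 'n::{finite,linorder}) vec"
  assumes fin: "jm_dist m h x y < top" and e: "\<epsilon> > 0"
    and F: "continuous_on UNIV F" and l: "F x < l \<and> l < F y \<or> F y < l \<and> l < (F x :: real)"
  shows "\<exists>p. F p = l \<and> jm_dist m h x p + jm_dist m h p y \<le> jm_dist m h x y + ennreal \<epsilon>"
proof -
  have "jm_dist m h x y < jm_dist m h x y + ennreal \<epsilon>" using fin e by (auto simp: less_top)
  then obtain s0 s1 \<gamma> where g: "s0 < s1" "abs_continuous_on {s0..s1} \<gamma>" "\<gamma> s0 = x" "\<gamma> s1 = y"
    "action m h s0 s1 \<gamma> < jm_dist m h x y + ennreal \<epsilon>" by (rule jm_dist_less_curve)
  have "continuous_on {s0..s1} (\<lambda>t. F (\<gamma> t))"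
    using continuous_on_compose2[OF F abs_continuous_on_imp_continuous_on[OF g(2)]] by auto
  then have "\<exists>r. s0 \<le> r \<and> r \<le> s1 \<and> F (\<gamma> r) = l"
    using l IVT'[of "\<lambda>t. F (\<gamma> t)" s0 l s1] IVT2'[of "\<lambda>t. F (\<gamma> t)" s1 l s0] g by auto
  then obtain r where r: "s0 \<le> r" "r \<le> s1" "F (\<gamma> r) = l" by blast
  then have r': "s0 < r" "r < s1" using l g by (auto simp: less_le)
  have "jm_dist m h x (\<gamma> r) \<le> action m h s0 r \<gamma>"
    using jm_dist_le_action[OF r'(1) abs_continuous_on_subset[OF g(2)], of m h] r g(3) by simp
  moreover have "jm_dist m h (\<gamma> r) y \<le> action m h r s1 \<gamma>"
    using jm_dist_le_action[OF r'(2) abs_continuous_on_subset[OF g(2)], of m h] r g(4) by simp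
  ultimately have "jm_dist m h x (\<gamma> r) + jm_dist m h (\<gamma> r) y \<le> action m h s0 r \<gamma> + action m h r s1 \<gamma>"
    by (rule add_mono)
  also have "\<dots> = action m h s0 s1 \<gamma>" by (rule action_split[symmetric]) (use r in auto)
  also have "\<dots> \<le> jm_dist m h x y + ennreal \<epsilon>" using g(5) by simp
  finally show ?thesis using r(3) by blast
qed

section \<open>Absolute continuity of power functions\<close>

lemma monotone_increments_le:
  fixes F :: "real \<Rightarrow> real"
  assumes D: "finite D" "\<And>p. p \<in> D \<Longrightarrow> a \<le> fst p \<and> fst p \<le> snd p \<and> snd p \<le> b"
    and disj: "\<And>p q. p \<in> D \<Longrightarrow> q \<in> D \<Longrightarrow> p \<noteq> q \<Longrightarrow> {fst p<..<snd p} \<inter> {fst q<..<snd q} = {}"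
    and F: "\<And>u v. a \<le> u \<Longrightarrow> u \<le> v \<Longrightarrow> v \<le> b \<Longrightarrow> F u \<le> F v" and ab: "a \<le> b"
  shows "(\<Sum>p\<in>D. F (snd p) - F (fst p)) \<le> F b - F a"
proof -
  \<comment> \<open>The increments are the lengths of the open image intervals, which are disjoint
    by monotonicity and lie in \<open>{F a..F b}\<close>. Comparing measures replaces a sorting of
    the intervals.\<close>
  define J where "J p = {F (fst p)<..<F (snd p)}" for p
  have m: "measure lebesgue (J p) = F (snd p) - F (fst p)" if "p \<in> D" for p
    using D(2)[OF that] F[of "fst p" "snd p"] by (simp add: J_def)
  have Jl: "J p \<in> lmeasurable" for p by (simp add: J_def lmeasurable_box flip: box_real)
  have "(\<Sum>p\<in>D. F (snd p) - F (fst p)) = (\<Sum>p\<in>D. measure lebesgue (J p))" using m by simp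
  also have "\<dots> = measure lebesgue (\<Union>p\<in>D. J p)"
  proof (rule measure_finite_Union[symmetric, OF D(1)])
    show "disjoint_family_on J D" unfolding disjoint_family_on_def
    proof (intro ballI impI)
      fix p q assume pq: "p \<in> D" "q \<in> D" "p \<noteq> q"
      have "snd p \<le> fst q \<or> snd q \<le> fst p \<or> fst p = snd p \<or> fst q = snd q"
      proof (rule ccontr)
        assume n: "\<not> ?thesis"
        then have "max (fst p) (fst q) < min (snd p) (snd q)" using D(2)[OF pq(1)] D(2)[OF pq(2)] by auto
        then obtain r where "max (fst p) (fst q) < r" "r < min (snd p) (snd q)" using dense by blast
        then have "r \<in> {fst p<..<snd p} \<inter> {fst q<..<snd q}" by auto
        then show False using disj pq by blast
      qed
      then have "F (snd p) \<le> F (fst q) \<or> F (snd q) \<le> F (fst p) \<or> fst p = snd p \<or> fst q = snd q"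
        using F D(2)[OF pq(1)] D(2)[OF pq(2)] by (meson order_trans)
      then show "J p \<inter> J q = {}" by (auto simp: J_def)
    qed
    show "emeasure lebesgue (J p) \<noteq> \<infinity>" for p using fmeasurableD2[OF Jl] by (metis infinity_ennreal_def)
  qed (use Jl in auto)
  also have "\<dots> \<le> measure lebesgue {F a..F b}"
  proof (rule measure_mono_fmeasurable)
    show "(\<Union>p\<in>D. J p) \<subseteq> {F a..F b}"
    proof
      fix t assume "t \<in> (\<Union>p\<in>D. J p)"
      then obtain p where p: "p \<in> D" "F (fst p) < t" "t < F (snd p)" by (auto simp: J_def)
      have "F a \<le> F (fst p)" "F (snd p) \<le> F b" using D(2)[OF p(1)] F by auto
      with p show "t \<in> {F a..F b}" by auto
    qed
    show "(\<Union>p\<in>D. J p) \<in> sets lebesgue" using D(1) Jl by (intro sets.finite_UN) auto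
    show "{F a..F b} \<in> lmeasurable" by (simp flip: box_real)
  qed
  also have "\<dots> = F b - F a" using F[of a b] ab by simp
  finally show ?thesis .
qed

text \<open>The derivative may be unbounded near 0, but up to \<open>\<eta>\<close> a monotone
  function has increments of total size at most \<open>f \<eta> - f 0\<close>; beyond
  \<open>\<eta>\<close> it is Lipschitz.\<close>

lemma abs_continuous_on_monotone:
  fixes f :: "real \<Rightarrow> real"
  assumes mono: "\<And>u v. 0 \<le> u \<Longrightarrow> u \<le> v \<Longrightarrow> v \<le> 1 \<Longrightarrow> f u \<le> f v"
    and c0: "\<And>\<epsilon>. \<epsilon> > 0 \<Longrightarrow> \<exists>\<eta>. 0 < \<eta> \<and> \<eta> \<le> 1 \<and> f \<eta> - f 0 < \<epsilon>"
    and lip: "\<And>\<eta>. 0 < \<eta> \<Longrightarrow> \<eta> \<le> 1 \<Longrightarrow> \<exists>L>0. \<forall>u v. \<eta> \<le> u \<and> u \<le> v \<and> v \<le> 1 \<longrightarrow> f v - f u \<le> L * (v - u)"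
  shows "abs_continuous_on {0..1} f"
proof (rule abs_continuous_onI)
  fix \<epsilon> :: real assume e: "\<epsilon> > 0"
  obtain \<eta> where \<eta>: "0 < \<eta>" "\<eta> \<le> 1" "f \<eta> - f 0 < \<epsilon> / 2" using c0[of "\<epsilon> / 2"] e by auto
  obtain L where L: "L > 0" "\<forall>u v. \<eta> \<le> u \<and> u \<le> v \<and> v \<le> 1 \<longrightarrow> f v - f u \<le> L * (v - u)" using lip[OF \<eta>(1,2)] by blast
  show "\<exists>\<delta>>0. \<forall>D. finite D \<longrightarrow> (\<forall>p\<in>D. fst p \<le> snd p \<and> {fst p..snd p} \<subseteq> {0..1}) \<longrightarrow>
      (\<forall>p\<in>D. \<forall>q\<in>D. p \<noteq> q \<longrightarrow> {fst p<..<snd p} \<inter> {fst q<..<snd q} = {}) \<longrightarrow>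
      (\<Sum>p\<in>D. snd p - fst p) < \<delta> \<longrightarrow> (\<Sum>p\<in>D. norm (f (snd p) - f (fst p))) < \<epsilon>"
  proof (intro exI[of _ "\<epsilon> / (2 * L)"] conjI allI impI)
    show "0 < \<epsilon> / (2 * L)" using e L by simp
    fix D :: "(real \<times> real) set"
    assume D: "finite D" "\<forall>p\<in>D. fst p \<le> snd p \<and> {fst p..snd p} \<subseteq> {0..1}"
      "\<forall>p\<in>D. \<forall>q\<in>D. p \<noteq> q \<longrightarrow> {fst p<..<snd p} \<inter> {fst q<..<snd q} = {}" "(\<Sum>p\<in>D. snd p - fst p) < \<epsilon> / (2 * L)"
    have D': "0 \<le> fst p \<and> fst p \<le> snd p \<and> snd p \<le> 1" if "p \<in> D" for p using D(2) that by force
    \<comment> \<open>\<open>F\<close> carries the part of each increment before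
      \<open>\<eta>\<close>, so that intervals containing \<open>\<eta>\<close> need no separate
      treatment.\<close>
    define F where "F t = f (min t \<eta>)" for t
    have "norm (f (snd p) - f (fst p)) \<le> (F (snd p) - F (fst p)) + L * (snd p - fst p)" if "p \<in> D" for p
    proof -
      have "norm (f (snd p) - f (fst p)) = f (snd p) - f (fst p)" using D'[OF that] mono by simp
      also have "\<dots> = (F (snd p) - F (fst p)) + (f (max (snd p) \<eta>) - f (max (fst p) \<eta>))"
        by (simp add: F_def min_def max_def)
      also have "f (max (snd p) \<eta>) - f (max (fst p) \<eta>) \<le> L * (max (snd p) \<eta> - max (fst p) \<eta>)"
        using L(2) D'[OF that] \<eta> by auto
      also have "\<dots> \<le> L * (snd p - fst p)" using L(1) D'[OF that] by (intro mult_left_mono) auto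
      finally show ?thesis by simp
    qed
    then have "(\<Sum>p\<in>D. norm (f (snd p) - f (fst p))) \<le> (\<Sum>p\<in>D. (F (snd p) - F (fst p)) + L * (snd p - fst p))"
      by (rule sum_mono)
    also have "\<dots> = (\<Sum>p\<in>D. F (snd p) - F (fst p)) + L * (\<Sum>p\<in>D. snd p - fst p)"
      by (simp only: sum.distrib sum_distrib_left)
    also have "(\<Sum>p\<in>D. F (snd p) - F (fst p)) \<le> F 1 - F 0"
    proof (rule monotone_increments_le[OF D(1)])
      fix u v :: real assume "0 \<le> u" "u \<le> v" "v \<le> 1"
      then show "F u \<le> F v" unfolding F_def using \<eta> by (intro mono) auto
    qed (use D' D(3) in auto)
    also have "F 1 - F 0 < \<epsilon> / 2" using \<eta> by (simp add: F_def min_def)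
    also have "L * (\<Sum>p\<in>D. snd p - fst p) < \<epsilon> / 2" using D(4) L(1) by (simp add: field_simps)
    finally show "(\<Sum>p\<in>D. norm (f (snd p) - f (fst p))) < \<epsilon>" by simp
  qed
qed

lemma abs_continuous_on_powr:
  fixes \<beta> :: real assumes b: "0 < \<beta>" "\<beta> < 1"
  shows "abs_continuous_on {0..1} (\<lambda>t. t powr \<beta>)"
proof (rule abs_continuous_on_monotone)
  show "u powr \<beta> \<le> v powr \<beta>" if "0 \<le> u" "u \<le> v" for u v using that b by (intro powr_mono2) auto
  show "\<exists>\<eta>. 0 < \<eta> \<and> \<eta> \<le> 1 \<and> \<eta> powr \<beta> - 0 powr \<beta> < \<epsilon>" if e: "\<epsilon> > 0" for \<epsilon>
  proof -
    define \<eta> where "\<eta> = min 1 ((\<epsilon> / 2) powr (1 / \<beta>))"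
    have "0 < \<eta>" "\<eta> \<le> 1" using e by (auto simp: \<eta>_def)
    have "\<eta> powr \<beta> \<le> ((\<epsilon> / 2) powr (1 / \<beta>)) powr \<beta>" using b \<open>0 < \<eta>\<close> by (intro powr_mono2) (auto simp: \<eta>_def)
    also have "\<dots> = \<epsilon> / 2" using b e by (simp add: powr_powr)
    finally show ?thesis using \<open>0 < \<eta>\<close> \<open>\<eta> \<le> 1\<close> e by (intro exI[of _ \<eta>]) auto
  qed
  show "\<exists>L>0. \<forall>u v. \<eta> \<le> u \<and> u \<le> v \<and> v \<le> 1 \<longrightarrow> v powr \<beta> - u powr \<beta> \<le> L * (v - u)" if \<eta>: "0 < \<eta>" "\<eta> \<le> 1" for \<eta>
  proof (intro exI[of _ "\<beta> * \<eta> powr (\<beta> - 1)"] conjI allI impI)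
    show "0 < \<beta> * \<eta> powr (\<beta> - 1)" using b \<eta> by simp
    fix u v assume uv: "\<eta> \<le> u \<and> u \<le> v \<and> v \<le> 1"
    show "v powr \<beta> - u powr \<beta> \<le> \<beta> * \<eta> powr (\<beta> - 1) * (v - u)"
    proof (cases "u < v")
      case True
      have "\<exists>z>u. z < v \<and> v powr \<beta> - u powr \<beta> = (v - u) * (\<beta> * z powr (\<beta> - 1))"
        by (rule MVT2[OF True]) (use uv \<eta> in \<open>auto intro!: derivative_eq_intros\<close>)
      then obtain z where z: "z > u" "z < v" "v powr \<beta> - u powr \<beta> = (v - u) * (\<beta> * z powr (\<beta> - 1))" by blast
      have "z powr (\<beta> - 1) \<le> \<eta> powr (\<beta> - 1)" using z uv \<eta> b by (intro powr_mono2') auto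
      then have "(v - u) * (\<beta> * z powr (\<beta> - 1)) \<le> (v - u) * (\<beta> * \<eta> powr (\<beta> - 1))"
        using True b by (intro mult_left_mono) auto
      then show ?thesis using z(3) by (simp add: mult.commute)
    qed (use uv in auto)
  qed
qed

subsection \<open>Upper bounds for the Jacobi-Maupertuis distance\<close>

definition pair_mass :: "('n::{finite,linorder} \<Rightarrow> real) \<Rightarrow> real" where
  "pair_mass m = (\<Sum>(i, j)\<in>{(i, j). i < j}. m i * m j)"

lemma pair_mass_nonneg: "(\<And>i. m i > 0) \<Longrightarrow> pair_mass m \<ge> 0"
  unfolding pair_mass_def by (intro sum_nonneg) (auto intro!: mult_nonneg_nonneg less_imp_le)

lemma potential_le:
  fixes x :: "('a::euclidean_space, 'n::{finite,linorder}) vec"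
  assumes m: "\<And>i. m i > 0" and r: "r > 0" "\<And>i j. i \<noteq> j \<Longrightarrow> r \<le> norm (x $ i - x $ j)"
  shows "potential m x \<le> ennreal (pair_mass m / r)"
proof -
  have "potential m x \<le> (\<Sum>p\<in>{(i, j). i < j}. ennreal (m (fst p) * m (snd p) / r))"
    unfolding potential_def case_prod_beta
  proof (rule sum_mono)
    fix p :: "'n \<times> 'n" assume "p \<in> {p. fst p < snd p}"
    then have n: "r \<le> norm (x $ fst p - x $ snd p)" using r(2) by auto
    have mm: "0 \<le> m (fst p) * m (snd p)" using m by (simp add: less_imp_le)
    have "ennreal (m (fst p) * m (snd p)) / ennreal (norm (x $ fst p - x $ snd p)) = ennreal (m (fst p) * m (snd p) / norm (x $ fst p - x $ snd p))"
      using n r(1) mm by (intro divide_ennreal) auto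
    also have "\<dots> \<le> ennreal (m (fst p) * m (snd p) / r)"
      using n r(1) mm by (intro ennreal_leI divide_left_mono mult_pos_pos) auto
    finally show "ennreal (m (fst p) * m (snd p)) / ennreal (norm (x $ fst p - x $ snd p)) \<le> ennreal (m (fst p) * m (snd p) / r)" .
  qed
  also have "(\<Sum>p\<in>{(i, j). i < j}. ennreal (m (fst p) * m (snd p) / r)) = ennreal (\<Sum>p\<in>{(i, j). i < j}. m (fst p) * m (snd p) / r)"
    using m r(1) by (intro sum_ennreal) (auto intro!: divide_nonneg_pos mult_nonneg_nonneg less_imp_le)
  also have "(\<Sum>p\<in>{(i, j). i < j}. m (fst p) * m (snd p) / r) = pair_mass m / r"
    by (simp add: pair_mass_def case_prod_beta sum_divide_distrib)
  finally show ?thesis .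
qed

lemma nn_integral_Icc_eq:
  fixes f :: "real \<Rightarrow> real"
  assumes "(f has_integral I) {a..b}" "\<And>t. t \<in> {a..b} \<Longrightarrow> 0 \<le> f t"
  shows "(\<integral>\<^sup>+t\<in>{a..b}. ennreal (f t) \<partial>lborel) = ennreal I"
proof -
  have "(\<integral>\<^sup>+t\<in>{a..b}. ennreal (f t) \<partial>lborel) = (\<integral>\<^sup>+t. ennreal (indicator {a..b} t * f t) \<partial>lborel)"
    by (intro nn_integral_cong) (auto simp: indicator_def)
  also have "\<dots> = ennreal I"
    by (rule nn_integral_has_integral_lebesgue) (use assms in auto)
  finally show ?thesis .
qed

text \<open>The segment is run at the speed \<open>sqrt (2 * h)\<close>, at which the kinetic energy
  equals \<open>h\<close> and the cost without potential is exactly \<open>sqrt (2 * h)\<close> per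
  unit length. The potential is integrated over the duration, which is the length divided by the
  speed.\<close>

lemma jm_dist_segment_le:
  fixes x y :: "('a::euclidean_space, 'n::{finite,linorder}) vec"
  assumes m: "\<And>i. m i > 0" and h: "h > 0" and xy: "x \<noteq> y"
    and G: "(G has_integral I) {0..1}" "\<And>\<tau>. \<tau> \<in> {0..1} \<Longrightarrow> 0 \<le> G \<tau>"
    and U: "\<And>\<tau>. \<tau> \<in> {0..1} \<Longrightarrow> potential m (x + \<tau> *\<^sub>R (y - x)) \<le> ennreal (G \<tau>)"
  shows "jm_dist m h x y \<le> ennreal (sqrt (2 * h) * mass_norm m (y - x) + mass_norm m (y - x) / sqrt (2 * h) * I)"
proof -
  define k where "k = sqrt (2 * h)"
  define L where "L = mass_norm m (y - x)"
  have k: "k > 0" "k * k = 2 * h" using h by (auto simp: k_def)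
  have "mass_scale m (y - x) \<noteq> 0" using xy mass_scale_inverse(2)[of m "y - x", OF m] linear_0[OF linear_mass_scale]
    by (metis right_minus_eq)
  then have L: "L > 0" by (simp add: L_def mass_norm_scale[OF m])
  define T where "T = L / k"
  have T: "T > 0" using L k by (simp add: T_def)
  define \<gamma> where "\<gamma> t = x + (t / T) *\<^sub>R (y - x)" for t
  have d: "(\<gamma> has_vector_derivative (1 / T) *\<^sub>R (y - x)) (at t)" for t
    unfolding \<gamma>_def using T by (auto intro!: derivative_eq_intros)
  have ac: "abs_continuous_on {0..T} \<gamma>"
  proof (rule abs_continuous_on_lipschitz[where L="norm (y - x) / T"])
    fix u v :: real assume "u \<le> v"
    have "\<gamma> v - \<gamma> u = ((v - u) / T) *\<^sub>R (y - x)" by (simp add: \<gamma>_def diff_divide_distrib scaleR_left_diff_distrib)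
    then show "norm (\<gamma> v - \<gamma> u) \<le> norm (y - x) / T * (v - u)" using \<open>u \<le> v\<close> T by (simp add: mult.commute)
  qed
  have "mass_norm m ((1 / T) *\<^sub>R (y - x)) = L / T"
    using T by (simp add: L_def mass_norm_scale[OF m] linear_scale[OF linear_mass_scale])
  also have "\<dots> = k" using L k by (simp add: T_def)
  finally have sp: "1 / 2 * (mass_norm m (vector_derivative \<gamma> (at t)))\<^sup>2 = h" for t
    using vector_derivative_at[OF d[of t]] k(2) by (simp add: power2_eq_square)
  have GT: "((\<lambda>t. 2 * h + G ((1 / T) * t)) has_integral (2 * h * T + T * I)) {0..T}"
  proof (rule has_integral_add)
    show "((\<lambda>t. 2 * h) has_integral 2 * h * T) {0..T}" using has_integral_const_real[of "2 * h" 0 T] T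
      by (simp add: mult.commute)
    have "((\<lambda>t. G ((1 / T) * t)) has_integral (1 / \<bar>1 / T\<bar>) *\<^sub>R I) ((\<lambda>x. x / (1 / T)) ` {0..1})"
      using G(1) T by (intro has_integral_stretch_real) auto
    moreover have "(\<lambda>x. x / (1 / T)) ` {0..1} = {0..T}"
    proof -
      have "(\<lambda>x. x / (1 / T)) ` {0..1} = (*) T ` {0..1}" by (intro image_cong) auto
      also have "\<dots> = {0..T}" using image_mult_atLeastAtMost[OF T, of 0 1] by simp
      finally show ?thesis .
    qed
    ultimately show "((\<lambda>t. G ((1 / T) * t)) has_integral T * I) {0..T}" using T by simp
  qed
  have "jm_dist m h x y \<le> action m h 0 T \<gamma>"
    using jm_dist_le_action[OF T ac, of m h] T by (simp add: \<gamma>_def)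
  also have "\<dots> \<le> (\<integral>\<^sup>+t\<in>{0..T}. ennreal (2 * h + G ((1 / T) * t)) \<partial>lborel)"
    unfolding action_eq_lagrangian
  proof (intro nn_integral_mono)
    fix t :: real
    show "lagrangian m h \<gamma> t * indicator {0..T} t \<le> ennreal (2 * h + G ((1 / T) * t)) * indicator {0..T} t"
    proof (cases "t \<in> {0..T}")
      case True
      then have t: "t / T \<in> {0..1}" using T by auto
      have "lagrangian m h \<gamma> t \<le> ennreal h + ennreal (G (t / T)) + ennreal h"
        unfolding lagrangian_def sp using U[OF t] by (intro add_mono) (auto simp: \<gamma>_def)
      also have "\<dots> = ennreal (2 * h + G ((1 / T) * t))" using G(2)[OF t] h by (simp flip: ennreal_plus)
      finally show ?thesis using True by simp
    qed simp
  qed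
  also have "\<dots> = ennreal (2 * h * T + T * I)"
  proof (rule nn_integral_Icc_eq[OF GT])
    fix t assume "t \<in> {0..T}"
    then have "t / T \<in> {0..1}" using T by auto
    from G(2)[OF this] show "0 \<le> 2 * h + G ((1 / T) * t)" using h by simp
  qed
  also have "2 * h * T + T * I = k * L + L / k * I" unfolding k(2)[symmetric] T_def using k(1) by simp
  finally show ?thesis unfolding k_def L_def .
qed

text \<open>In dimension at least 2 a line through 0 is a null set, and finitely many null sets do
  not cover the space.\<close>

lemma generic_direction:
  fixes S :: "'a::euclidean_space set"
  assumes "finite S" "DIM('a) \<ge> 2"
  shows "\<exists>e. \<forall>u\<in>S. e \<notin> span {u}"
proof -
  have "negligible (span {u})" for u :: 'a
  proof (rule negligible_lowdim)
    have "dim (span {u}) \<le> card {u}" by (simp only: dim_span) (rule dim_le_card', simp)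
    then show "dim (span {u}) < DIM('a)" using assms(2) by simp
  qed
  then have "negligible (\<Union>u\<in>S. span {u})" using assms(1) by (intro negligible_Union) auto
  then have "(\<Union>u\<in>S. span {u}) \<noteq> UNIV" using non_negligible_UNIV by metis
  then show ?thesis by blast
qed

text \<open>Near a collision the point moves away from \<open>x\<close> like \<open>t\<^bsup>2/3\<^esup>\<close>, as in a parabolic ejection, which
  makes both the kinetic energy and the potential integrable.\<close>

lemma jm_dist_generic_finite:
  fixes x z :: "('a::euclidean_space, 'n::{finite,linorder}) vec"
  assumes m: "\<And>i. m i > 0" and h: "h > 0" and r: "r > 0"
    and sep: "\<And>i j s. i \<noteq> j \<Longrightarrow> 0 < s \<Longrightarrow> s \<le> 1 \<Longrightarrow> r * s \<le> norm ((x + s *\<^sub>R (z - x)) $ i - (x + s *\<^sub>R (z - x)) $ j)"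
  shows "jm_dist m h x z < top"
proof -
  define p where "p t = t powr (2/3)" for t :: real
  define \<gamma> where "\<gamma> t = x + p t *\<^sub>R (z - x)" for t
  have "abs_continuous_on {0..1} (\<lambda>t. x + p t *\<^sub>R (z - x))"
  proof (rule abs_continuous_on_add)
    show "abs_continuous_on {0..1} (\<lambda>t::real. x)" by (rule abs_continuous_on_lipschitz[where L=0]) auto
    show "abs_continuous_on {0..1} (\<lambda>t. p t *\<^sub>R (z - x))"
      unfolding p_def
        by (rule abs_continuous_on_bounded_linear[OF abs_continuous_on_powr bounded_linear_scaleR_left]) auto
  qed
  then have ac: "abs_continuous_on {0..1} \<gamma>" by (simp add: \<gamma>_def[abs_def])
  define A where "A = 1 / 2 * (2 / 3 * mass_norm m (z - x))\<^sup>2 + pair_mass m / r"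
  have A: "A \<ge> 0" unfolding A_def using pair_mass_nonneg[of m, OF m] r by simp
  have lag: "lagrangian m h \<gamma> t \<le> ennreal (A * t powr (-2/3) + h)" if t: "0 < t" "t \<le> 1" for t
  proof -
    have "(p has_real_derivative (2/3 * t powr (-1/3))) (at t)"
      unfolding p_def using t by (auto intro!: derivative_eq_intros)
    then have "((\<lambda>t. p t *\<^sub>R (z - x)) has_vector_derivative (2/3 * t powr (-1/3)) *\<^sub>R (z - x)) (at t)"
      unfolding has_real_derivative_iff_has_vector_derivative
        by (rule bounded_linear.has_vector_derivative[OF bounded_linear_scaleR_left])
    from has_vector_derivative_add[OF has_vector_derivative_const[of x] this]
    have "(\<gamma> has_vector_derivative (2/3 * t powr (-1/3)) *\<^sub>R (z - x)) (at t)" by (simp add: \<gamma>_def[abs_def])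
    then have "mass_norm m (vector_derivative \<gamma> (at t)) = mass_norm m ((2/3 * t powr (-1/3)) *\<^sub>R (z - x))"
      by (simp add: vector_derivative_at)
    also have "\<dots> = (2/3 * mass_norm m (z - x)) * t powr (-1/3)"
      by (simp add: mass_norm_scale[OF m] linear_scale[OF linear_mass_scale])
    finally have eq: "mass_norm m (vector_derivative \<gamma> (at t)) = (2/3 * mass_norm m (z - x)) * t powr (-1/3)" .
    have "1 / 2 * (mass_norm m (vector_derivative \<gamma> (at t)))\<^sup>2 = 1 / 2 * (2 / 3 * mass_norm m (z - x))\<^sup>2 * (t powr (-1/3))\<^sup>2"
      unfolding eq by (simp only: power_mult_distrib mult.assoc)
    also have "(t powr (-1/3))\<^sup>2 = t powr (-2/3)" using t by (simp add: power2_eq_square flip: powr_add)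
    finally have kin: "1 / 2 * (mass_norm m (vector_derivative \<gamma> (at t)))\<^sup>2 = 1 / 2 * (2 / 3 * mass_norm m (z - x))\<^sup>2 * t powr (-2/3)" .
    have p: "0 < p t" "p t \<le> 1" using t powr_mono2[of "2/3" t 1] by (auto simp: p_def)
    have "potential m (\<gamma> t) \<le> ennreal (pair_mass m / (r * p t))"
      unfolding \<gamma>_def using p r sep by (intro potential_le m) auto
    also have "pair_mass m / (r * p t) = pair_mass m / r * t powr (-2/3)"
      using t by (simp add: p_def powr_minus_divide)
    finally have pot: "potential m (\<gamma> t) \<le> ennreal (pair_mass m / r * t powr (-2/3))" .
    have "lagrangian m h \<gamma> t \<le> ennreal (1 / 2 * (2 / 3 * mass_norm m (z - x))\<^sup>2 * t powr (-2/3)) + ennreal (pair_mass m / r * t powr (-2/3)) + ennreal h"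
      unfolding lagrangian_def kin by (intro add_mono pot order_refl)
    also have "\<dots> = ennreal (1 / 2 * (2 / 3 * mass_norm m (z - x))\<^sup>2 * t powr (-2/3) + pair_mass m / r * t powr (-2/3) + h)"
      using h r pair_mass_nonneg[of m, OF m] by (simp flip: ennreal_plus)
    also have "\<dots> = ennreal (A * t powr (-2/3) + h)" by (simp add: A_def distrib_right)
    finally show ?thesis .
  qed
  have "jm_dist m h x z \<le> action m h 0 1 \<gamma>"
    using jm_dist_le_action[OF zero_less_one ac, of m h] by (simp add: \<gamma>_def p_def)
  also have "\<dots> \<le> (\<integral>\<^sup>+t\<in>{0..1}. ennreal (A * t powr (-2/3) + h) \<partial>lborel)"
    unfolding action_eq_lagrangian
  proof (rule nn_integral_mono_AE)
    show "AE t in lborel. lagrangian m h \<gamma> t * indicator {0..1} t \<le> ennreal (A * t powr (-2/3) + h) * indicator {0..1} t"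
      using AE_lborel_singleton[of 0]
    proof (rule eventually_mono)
      fix t :: real assume "t \<noteq> 0"
      then show "lagrangian m h \<gamma> t * indicator {0..1} t \<le> ennreal (A * t powr (-2/3) + h) * indicator {0..1} t"
        using lag[of t] by (cases "t \<in> {0..1}") auto
    qed
  qed
  also have "\<dots> = ennreal (A * 3 + h)"
  proof (rule nn_integral_Icc_eq)
    have "((\<lambda>t::real. t powr (-2/3)) has_integral (1 powr (-2/3 + 1) / (-2/3 + 1))) {0..1}"
      by (rule has_integral_powr_from_0) auto
    then have "((\<lambda>t::real. t powr (-2/3)) has_integral 3) {0..1}" by simp
    from has_integral_mult_right[OF this, of A]
    have "((\<lambda>t. A * t powr (-2/3)) has_integral A * 3) {0..1}" .
    moreover have "((\<lambda>t. h) has_integral h) {0..1::real}" using has_integral_const_real[of h 0 1] by simp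
    ultimately show "((\<lambda>t. A * t powr (-2/3) + h) has_integral (A * 3 + h)) {0..1}" by (rule has_integral_add)
  qed (use A h in auto)
  also have "\<dots> < top" by simp
  finally show ?thesis .
qed

text \<open>Both points may be collisions, and the segment between them may meet further ones. The
  detour goes through \<open>z\<close>, where the bodies sit at distinct integer positions on a line
  whose direction \<open>e\<close> is parallel to no mutual difference in \<open>x\<close> or
  \<open>y\<close>. On the segments to \<open>z\<close> the mutual distances are then at least
  proportional to the parameter \<open>s\<close>.\<close>

lemma jm_dist_finite:
  fixes x y :: "('a::euclidean_space, 'n::{finite,linorder}) vec"
  assumes m: "\<And>i. m i > 0" and h: "h > 0" and dim: "DIM('a) \<ge> 2"
  shows "jm_dist m h x y < top"
proof -
  obtain \<iota> :: "'n \<Rightarrow> nat" where \<iota>: "inj \<iota>"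
    using finite_imp_inj_to_nat_seg[OF finite_class.finite_UNIV] by blast
  define S where "S = (\<lambda>(i, j). x $ i - x $ j) ` UNIV \<union> (\<lambda>(i, j). y $ i - y $ j) ` UNIV"
  have "finite S" by (simp add: S_def)
  from generic_direction[OF this dim] obtain e where e: "\<forall>u\<in>S. e \<notin> span {u}" by blast
  define z where "z = (\<chi> i. real (\<iota> i) *\<^sub>R e)"
  have fin: "jm_dist m h w z < top" if w: "\<And>i j. w $ i - w $ j \<in> S" for w
  proof -
    have "\<forall>q\<in>UNIV. \<exists>r>0. \<forall>v\<in>span {w $ fst q - w $ snd q}. r \<le> dist e v"
      using e w by (intro ballI separate_point_closed closed_span) auto
    then obtain r where r: "\<And>q. r q > 0" "\<And>q v. v \<in> span {w $ fst q - w $ snd q} \<Longrightarrow> r q \<le> dist e v"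
      by (metis UNIV_I)
    define r0 where "r0 = Min (range r)"
    have r0: "r0 > 0" "r0 \<le> r q" for q using r(1) by (auto simp: r0_def)
    show ?thesis
    proof (rule jm_dist_generic_finite[OF m h r0(1)])
      fix i j :: 'n and s :: real assume ij: "i \<noteq> j" and s: "0 < s" "s \<le> 1"
      define n where "n = real (\<iota> i) - real (\<iota> j)"
      have "\<iota> i \<noteq> \<iota> j" using ij \<iota> by (auto dest: injD)
      then have n: "1 \<le> \<bar>n\<bar>" unfolding n_def by linarith
      define u where "u = w $ i - w $ j"
      \<comment> \<open>Up to the factor \<open>s * n\<close> the difference of two bodies is
        \<open>e\<close> minus a multiple of \<open>u\<close>, so its norm is bounded below by the
        distance of \<open>e\<close> to the line of \<open>u\<close>; and \<open>n\<close> is a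
        nonzero integer.\<close>
      have eq: "(w + s *\<^sub>R (z - w)) $ i - (w + s *\<^sub>R (z - w)) $ j = (s * n) *\<^sub>R (e - (- ((1 - s) / (s * n))) *\<^sub>R u)"
      proof -
        have "(w + s *\<^sub>R (z - w)) $ i - (w + s *\<^sub>R (z - w)) $ j = (s * n) *\<^sub>R e + (1 - s) *\<^sub>R u"
          by (simp add: z_def n_def u_def algebra_simps)
        moreover have "(s * n) *\<^sub>R ((- ((1 - s) / (s * n))) *\<^sub>R u) = - ((1 - s) *\<^sub>R u)" using s n by auto
        ultimately show ?thesis by (simp only: scaleR_diff_right) simp
      qed
      have "r0 \<le> dist e ((- ((1 - s) / (s * n))) *\<^sub>R u)"
        using r0(2)[of "(i, j)"] r(2)[of _ "(i, j)"] unfolding u_def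
          by (metis fst_conv insertI1 order_trans snd_conv span_base span_scale)
      then have "s * r0 \<le> s * (\<bar>n\<bar> * dist e ((- ((1 - s) / (s * n))) *\<^sub>R u))"
        using s n r0(1) by (intro mult_left_mono order_trans[OF _ mult_right_mono[OF n]]) auto
      then show "r0 * s \<le> norm ((w + s *\<^sub>R (z - w)) $ i - (w + s *\<^sub>R (z - w)) $ j)"
        unfolding eq norm_scaleR dist_norm using s by (simp add: abs_mult mult.commute mult.left_commute)
    qed
  qed
  have "jm_dist m h x y \<le> jm_dist m h x z + jm_dist m h z y" by (rule jm_dist_triangle[OF m])
  also have "jm_dist m h z y = jm_dist m h y z" by (rule jm_dist_sym[OF m])
  also have "jm_dist m h x z + jm_dist m h y z < top"
  proof -
    have "x $ i - x $ j \<in> S" for i j unfolding S_def by (rule UnI1, rule image_eqI[of _ _ "(i, j)"]) auto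
    moreover have "y $ i - y $ j \<in> S" for i j unfolding S_def by (rule UnI2, rule image_eqI[of _ _ "(i, j)"]) auto
    ultimately show ?thesis using fin[of x] fin[of y] by (simp add: ennreal_add_less_top)
  qed
  finally show ?thesis .
qed

subsection \<open>Gradient of the potential\<close>

lemma open_Omega: "open (Omega :: ('a::euclidean_space, 'n::finite) vec set)"
proof -
  have "Omega = (\<Inter>p\<in>{p. fst p \<noteq> snd p}. {x :: ('a, 'n) vec. x $ fst p \<noteq> x $ snd p})" by (auto simp: Omega_def)
  also have "open \<dots>" by (intro open_INT ballI open_Collect_neq continuous_intros) auto
  finally show ?thesis .
qed

text \<open>The segment from \<open>u\<close> to \<open>v\<close> may pass through the singularity,
  so the difference is expanded algebraically: one term from \<open>u - v\<close> and three from
  \<open>1 / norm u ^ 3 - 1 / norm v ^ 3\<close>, each at most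
  \<open>norm (u - v) / r ^ 3\<close>.\<close>

lemma inverse_square_field_lipschitz:
  fixes u v :: "'b::real_inner"
  assumes r: "r > 0" "r \<le> norm u" "r \<le> norm v"
  shows "norm ((1 / norm u ^ 3) *\<^sub>R u - (1 / norm v ^ 3) *\<^sub>R v) \<le> 4 * norm (u - v) / r ^ 3"
proof -
  define p q where "p = norm u" and "q = norm v"
  have pq: "p > 0" "q > 0" "r \<le> p" "r \<le> q" using r by (auto simp: p_def q_def)
  have qp: "\<bar>q - p\<bar> \<le> norm (u - v)" unfolding p_def q_def using norm_triangle_ineq3[of u v]
    by (simp add: abs_minus_commute)
  have inv: "1 / (x * y * z) \<le> 1 / r ^ 3" if "r \<le> x" "r \<le> y" "r \<le> z" for x y z
  proof -
    have "r * r * r \<le> x * y * z" using that r(1) by (intro mult_mono) auto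
    then show ?thesis using r(1) that by (intro divide_left_mono) (auto simp: power3_eq_cube)
  qed
  have "(1 / norm u ^ 3) *\<^sub>R u - (1 / norm v ^ 3) *\<^sub>R v = (1 / p ^ 3) *\<^sub>R (u - v) + (1 / p ^ 3 - 1 / q ^ 3) *\<^sub>R v"
    by (simp add: p_def q_def algebra_simps)
  then have "norm ((1 / norm u ^ 3) *\<^sub>R u - (1 / norm v ^ 3) *\<^sub>R v) \<le> 1 / p ^ 3 * norm (u - v) + \<bar>1 / p ^ 3 - 1 / q ^ 3\<bar> * q"
    using norm_triangle_ineq[of "(1 / p ^ 3) *\<^sub>R (u - v)" "(1 / p ^ 3 - 1 / q ^ 3) *\<^sub>R v"] pq by (simp add: q_def)
  also have "1 / p ^ 3 - 1 / q ^ 3 = (q - p) * (1 / (p * p * q) + 1 / (p * q * q) + 1 / (p * p * p)) / q"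
    using pq by (simp add: field_simps power3_eq_cube)
  also have "\<bar>\<dots>\<bar> * q = \<bar>q - p\<bar> * (1 / (p * p * q) + 1 / (p * q * q) + 1 / (p * p * p))"
    using pq by (simp add: abs_mult)
  also have "1 / p ^ 3 * norm (u - v) + \<bar>q - p\<bar> * (1 / (p * p * q) + 1 / (p * q * q) + 1 / (p * p * p)) \<le>
     1 / r ^ 3 * norm (u - v) + norm (u - v) * (1 / r ^ 3 + 1 / r ^ 3 + 1 / r ^ 3)"
    using inv pq qp r(1) by (intro add_mono mult_mono) (auto simp: power3_eq_cube)
  also have "\<dots> = 4 * norm (u - v) / r ^ 3" by simp
  finally show ?thesis .
qed

lemma has_derivative_inverse_norm:
  fixes u :: "'b::real_inner" assumes u: "u \<noteq> 0"
  shows "((\<lambda>u. 1 / norm u) has_derivative (\<lambda>w. - (((1 / norm u ^ 3) *\<^sub>R u) \<bullet> w))) (at u)"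
proof -
  have "((\<lambda>u. inverse (norm u)) has_derivative (\<lambda>w. - (inverse (norm u) * (w \<bullet> sgn u) * inverse (norm u)))) (at u)"
    by (rule Deriv.has_derivative_inverse[OF _ has_derivative_norm]) (use u in auto)
  moreover have "inverse (norm u) * (w \<bullet> sgn u) * inverse (norm u) = ((1 / norm u ^ 3) *\<^sub>R u) \<bullet> w" for w
    using u by (simp add: sgn_div_norm power3_eq_cube field_simps inner_commute)
  ultimately show ?thesis by (simp add: inverse_eq_divide)
qed

text \<open>The weak form, tested against \<open>w\<close>, avoids solving for the components of the
  gradient and can be subtracted for two configurations. It follows from uniqueness of the
  derivative.\<close>

lemma mass_gradient_potential:
  fixes x g :: "('a::euclidean_space, 'n::{finite,linorder}) vec"
  assumes m: "\<And>i. m i > 0" and x: "x \<in> Omega"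
    and g: "has_mass_gradient m (\<lambda>y. enn2real (potential m y)) x g"
  shows "mass_inner m g w = - (\<Sum>(i, j)\<in>{(i, j). i < j}. m i * m j *
    (((1 / norm (x $ i - x $ j) ^ 3) *\<^sub>R (x $ i - x $ j)) \<bullet> (w $ i - w $ j)))"
proof -
  define P where "P = {(i::'n, j). i < j}"
  have d1: "((\<lambda>y. m i * m j * (1 / norm (y $ i - y $ j))) has_derivative
     (\<lambda>w. m i * m j * (- (((1 / norm (x $ i - x $ j) ^ 3) *\<^sub>R (x $ i - x $ j)) \<bullet> (w $ i - w $ j))))) (at x)" if "i \<noteq> j" for i j
  proof -
    have "x $ i - x $ j \<noteq> 0" using x that by (auto simp: Omega_def)
    from has_derivative_inverse_norm[OF this]
    have "((\<lambda>y. 1 / norm (y $ i - y $ j)) has_derivative (\<lambda>w. - (((1 / norm (x $ i - x $ j) ^ 3) *\<^sub>R (x $ i - x $ j)) \<bullet> (w $ i - w $ j)))) (at x)"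
      by (rule has_derivative_compose[rotated, where f = "\<lambda>y. y $ i - y $ j"])
        (intro has_derivative_diff bounded_linear_imp_has_derivative bounded_linear_vec_nth)
    then show ?thesis by (rule has_derivative_mult_right)
  qed
  have "((\<lambda>y. \<Sum>p\<in>P. m (fst p) * m (snd p) * (1 / norm (y $ fst p - y $ snd p))) has_derivative
     (\<lambda>w. \<Sum>p\<in>P. m (fst p) * m (snd p) * (- (((1 / norm (x $ fst p - x $ snd p) ^ 3) *\<^sub>R (x $ fst p - x $ snd p)) \<bullet> (w $ fst p - w $ snd p))))) (at x)"
    by (intro has_derivative_sum d1) (auto simp: P_def)
  then have "((\<lambda>y. enn2real (potential m y)) has_derivative
     (\<lambda>w. \<Sum>p\<in>P. m (fst p) * m (snd p) * (- (((1 / norm (x $ fst p - x $ snd p) ^ 3) *\<^sub>R (x $ fst p - x $ snd p)) \<bullet> (w $ fst p - w $ snd p))))) (at x)"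
    by (rule has_derivative_transform_within_open[OF _ open_Omega x])
      (simp add: enn2real_potential[OF m] P_def case_prod_beta)
  from has_derivative_unique[OF this g[unfolded has_mass_gradient_def]]
  show ?thesis by (auto simp: fun_eq_iff P_def case_prod_beta sum_negf)
qed

lemma norm_le_mass_norm:
  assumes m: "\<And>i. m i > 0"
  shows "\<exists>K>0. \<forall>x :: ('a::euclidean_space, 'n::finite) vec. norm x \<le> K * mass_norm m x"
proof -
  interpret bounded_linear "mass_scale (\<lambda>i. inverse (m i)) :: ('a, 'n) vec \<Rightarrow> _" by (rule bounded_linear_mass_scale)
  obtain K where K: "K > 0" "\<And>x :: ('a, 'n) vec. norm (mass_scale (\<lambda>i. inverse (m i)) x) \<le> norm x * K"
    using pos_bounded by blast
  have "norm x \<le> K * mass_norm m x" for x :: "('a, 'n) vec"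
    using K(2)[of "mass_scale m x"] by (simp add: mass_scale_inverse[OF m] mass_norm_scale[OF m] mult.commute)
  with K(1) show ?thesis by blast
qed

text \<open>Testing the weak form with \<open>g\<close> itself bounds
  \<open>(mass_norm m g)\<^sup>2\<close> by a multiple of \<open>mass_norm m g\<close>, which
  cancels. The pair forces \<open>f\<close> are left free so that the bound applies to one gradient
  and to the difference of two.\<close>

lemma mass_norm_le_of_pair_forces:
  fixes g :: "('a::euclidean_space, 'n::{finite,linorder}) vec" and f :: "'n \<Rightarrow> 'n \<Rightarrow> 'a"
  assumes m: "\<And>i. m i > 0" and K: "K > 0" "\<And>x :: ('a, 'n) vec. norm x \<le> K * mass_norm m x"
    and g: "mass_inner m g g = - (\<Sum>(i, j)\<in>{(i, j). i < j}. m i * m j * (f i j \<bullet> (g $ i - g $ j)))"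
    and f: "\<And>i j. i \<noteq> j \<Longrightarrow> norm (f i j) \<le> b"
  shows "mass_norm m g \<le> 2 * K * pair_mass m * b"
proof -
  define n where "n = mass_norm m g"
  have n0: "n \<ge> 0" by (simp add: n_def mass_norm_scale[OF m])
  have t: "- (m i * m j * (f i j \<bullet> (g $ i - g $ j))) \<le> m i * m j * (2 * K * b * n)" if "i \<noteq> j" for i j
  proof -
    have gi: "norm (g $ l) \<le> K * n" for l using order_trans[OF Finite_Cartesian_Product.norm_nth_le K(2)[of g]]
      by (simp add: n_def)
    have "- (f i j \<bullet> (g $ i - g $ j)) \<le> norm (f i j) * norm (g $ i - g $ j)"
      using Cauchy_Schwarz_ineq2[of "f i j" "g $ i - g $ j"] by linarith
    also have "norm (g $ i - g $ j) \<le> K * n + K * n" using norm_triangle_ineq4[of "g $ i" "g $ j"] gi[of i] gi[of j]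
      by linarith
    then have "norm (f i j) * norm (g $ i - g $ j) \<le> b * (K * n + K * n)"
      using f[OF that] by (intro mult_mono) (auto intro: order_trans[OF norm_ge_zero])
    finally have "- (f i j \<bullet> (g $ i - g $ j)) \<le> 2 * K * b * n" by (simp add: algebra_simps)
    then have "m i * m j * (- (f i j \<bullet> (g $ i - g $ j))) \<le> m i * m j * (2 * K * b * n)"
      using m by (intro mult_left_mono) (auto intro: less_imp_le)
    then show ?thesis by simp
  qed
  have "n * n = mass_inner m g g"
    by (simp add: n_def mass_norm_scale[OF m] mass_inner_scale[OF m] power2_norm_eq_inner flip: power2_eq_square)
  also have "\<dots> = (\<Sum>p\<in>{(i, j). i < j}. - (m (fst p) * m (snd p) * (f (fst p) (snd p) \<bullet> (g $ fst p - g $ snd p))))"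
    unfolding g by (simp add: sum_negf case_prod_beta)
  also have "\<dots> \<le> (\<Sum>p\<in>{(i, j). i < j}. m (fst p) * m (snd p) * (2 * K * b * n))"
    by (intro sum_mono t) auto
  also have "\<dots> = pair_mass m * (2 * K * b * n)" unfolding pair_mass_def
    by (simp add: sum_distrib_right case_prod_beta)
  finally have "n * n \<le> (2 * K * pair_mass m * b) * n" by (simp add: mult_ac)
  \<comment> \<open>With a single body no pair determines the sign of \<open>b\<close>, but then
    \<open>pair_mass m\<close> is an empty sum.\<close>
  moreover have "pair_mass m = 0 \<or> b \<ge> 0"
  proof (cases "\<exists>i j :: 'n. i \<noteq> j")
    case True then show ?thesis using f norm_ge_zero order_trans by blast
  next
    case False
    then have "{(i::'n, j). i < j} = {}" by (auto simp: less_le)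
    then show ?thesis by (simp add: pair_mass_def)
  qed
  then have "0 \<le> 2 * K * pair_mass m * b" using K(1) pair_mass_nonneg[of m, OF m] by auto
  ultimately show ?thesis using n0 unfolding n_def[symmetric] by (cases "n = 0") auto
qed

subsection \<open>Asymptotics of hyperbolic motions\<close>

text \<open>By homogeneity: the mutual distances in \<open>\<xi> *\<^sub>R a\<close> are at least
  \<open>r * \<xi>\<close>, and moving each body by at most \<open>r * \<xi> / 4\<close> leaves half
  of that. The factor \<open>K\<close> converts the mass norm.\<close>

lemma shape_cone_separated:
  fixes a :: "('a::euclidean_space, 'n::{finite,linorder}) vec"
  assumes m: "\<And>i. m i > 0" and a: "a \<in> Omega"
  shows "\<exists>\<kappa>>0. \<exists>\<rho>>0. \<forall>x \<xi> i j. \<xi> > 0 \<longrightarrow> mass_norm m (x - \<xi> *\<^sub>R a) \<le> \<kappa> * \<xi> \<longrightarrow> i \<noteq> j \<longrightarrow> \<rho> * \<xi> \<le> norm (x $ i - x $ j)"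
proof -
  obtain K where K: "K > 0" "\<And>x :: ('a, 'n) vec. norm x \<le> K * mass_norm m x" using norm_le_mass_norm[of m, OF m]
    by blast
  \<comment> \<open>The inserted 1 keeps the minimum meaningful when there are no pairs.\<close>
  define r where "r = Min (insert 1 ((\<lambda>p. norm (a $ fst p - a $ snd p)) ` {p. fst p \<noteq> snd p}))"
  have r: "r > 0" unfolding r_def using a by (subst Min_gr_iff) (auto simp: Omega_def)
  have ra: "r \<le> norm (a $ i - a $ j)" if "i \<noteq> j" for i j
    unfolding r_def using that by (intro Min_le) (auto intro!: image_eqI[of _ _ "(i, j)"])
  show ?thesis
  proof (rule exI[of _ "r / (4 * K)"], rule conjI[rotated], rule exI[of _ "r / 2"], rule conjI[rotated], intro allI impI)
    fix x :: "('a, 'n) vec" and \<xi> :: real and i j :: 'n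
    assume xi: "\<xi> > 0" and x: "mass_norm m (x - \<xi> *\<^sub>R a) \<le> r / (4 * K) * \<xi>" and ij: "i \<noteq> j"
    have "norm (x - \<xi> *\<^sub>R a) \<le> K * (r / (4 * K) * \<xi>)" using K x by (meson mult_left_mono order_trans less_imp_le)
    then have n: "norm (x - \<xi> *\<^sub>R a) \<le> r / 4 * \<xi>" using K by simp
    have l: "norm (x $ l - \<xi> *\<^sub>R a $ l) \<le> r / 4 * \<xi>" for l
      using order_trans[OF Finite_Cartesian_Product.norm_nth_le n, of l] by simp
    have "\<xi> * r \<le> norm (\<xi> *\<^sub>R (a $ i - a $ j))" using xi ra[OF ij] by simp
    also have "\<xi> *\<^sub>R (a $ i - a $ j) = (x $ i - x $ j) - (x $ i - \<xi> *\<^sub>R a $ i) + (x $ j - \<xi> *\<^sub>R a $ j)"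
      by (simp add: algebra_simps)
    also have "norm \<dots> \<le> norm (x $ i - x $ j) + norm (x $ i - \<xi> *\<^sub>R a $ i) + norm (x $ j - \<xi> *\<^sub>R a $ j)"
      by (rule order_trans[OF norm_triangle_ineq add_mono[OF norm_triangle_ineq4 order_refl]])
    finally show "r / 2 * \<xi> \<le> norm (x $ i - x $ j)" using l[of i] l[of j] by (simp add: mult.commute)
  qed (use r K in auto)
qed

lemma vector_increment_le:
  fixes f :: "real \<Rightarrow> 'b::real_normed_vector"
  assumes st: "s \<le> t"
    and f: "\<And>x. s \<le> x \<Longrightarrow> x \<le> t \<Longrightarrow> (f has_vector_derivative f' x) (at x)"
    and p: "\<And>x. s \<le> x \<Longrightarrow> x \<le> t \<Longrightarrow> (\<phi> has_real_derivative \<phi>' x) (at x)"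
    and le: "\<And>x. s \<le> x \<Longrightarrow> x \<le> t \<Longrightarrow> norm (f' x) \<le> \<phi>' x"
  shows "norm (f t - f s) \<le> \<phi> t - \<phi> s"
proof (cases "s < t")
  case True
  show ?thesis
  proof (rule differentiable_bound_general[OF True, where f'=f' and \<phi>'=\<phi>'])
    show "continuous_on {s..t} f" using f
      by (intro continuous_at_imp_continuous_on ballI has_vector_derivative_continuous) auto
    show "continuous_on {s..t} \<phi>" using p by (intro continuous_at_imp_continuous_on ballI DERIV_isCont) auto
  qed (use f p le in \<open>auto simp: has_real_derivative_iff_has_vector_derivative\<close>)
qed (use st in simp)

lemma power_sqrt_tendsto_zero: "((\<lambda>t. c * sqrt t / t) \<longlongrightarrow> 0) at_top" "((\<lambda>t::real. c / t) \<longlongrightarrow> 0) at_top"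
  by real_asymp+

text \<open>The force along a motion with limit shape decays like \<open>t\<^sup>-\<^sup>2\<close>, hence the velocity converges at
  rate \<open>1/t\<close>; the position then differs from \<open>t a\<close> by at most a logarithm, for which the cruder
  bound \<open>\<surd>t\<close> suffices below.\<close>

lemma hyperbolic_motion_asymptotics:
  fixes x :: "real \<Rightarrow> ('a::euclidean_space, 'n::{finite,linorder}) vec"
  assumes m: "\<And>i. m i > 0"
    and v: "\<And>t. t > t0 \<Longrightarrow> (x has_vector_derivative v t) (at t)"
    and acc: "\<And>t. t > t0 \<Longrightarrow> (v has_vector_derivative f t) (at t)"
    and f: "\<And>t. t > t0 \<Longrightarrow> has_mass_gradient m (\<lambda>y. enn2real (potential m y)) (x t) (f t)"
    and Om: "\<And>t. t > t0 \<Longrightarrow> x t \<in> Omega"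
    and a: "has_limit_shape m x a"
  shows "\<exists>C T. T \<ge> 1 \<and> T > t0 \<and> (\<forall>t\<ge>T. mass_norm m (v t - a) \<le> C / t \<and> mass_norm m (x t - t *\<^sub>R a) \<le> C * sqrt t)"
proof -
  have aO: "a \<in> Omega" and ao: "(\<lambda>t. mass_norm m (x t - t *\<^sub>R a)) \<in> o[at_top](\<lambda>t. t)"
    using a by (auto simp: has_limit_shape_def)
  obtain K where K: "K > 0" "\<And>x :: ('a, 'n) vec. norm x \<le> K * mass_norm m x" using norm_le_mass_norm[of m, OF m]
    by blast
  obtain \<kappa> \<rho> where kr: "\<kappa> > 0" "\<rho> > 0" "\<forall>x \<xi> i j. \<xi> > 0 \<longrightarrow> mass_norm m (x - \<xi> *\<^sub>R a) \<le> \<kappa> * \<xi> \<longrightarrow> i \<noteq> j \<longrightarrow> \<rho> * \<xi> \<le> norm (x $ i - x $ j)"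
    using shape_cone_separated[of m a, OF m aO] by blast
  have mn: "mass_norm m y = norm (mass_scale m y)" for y :: "('a, 'n) vec" by (rule mass_norm_scale[OF m])
  from landau_o.smallD[OF ao kr(1)] have "\<forall>\<^sub>F t in at_top. mass_norm m (x t - t *\<^sub>R a) \<le> \<kappa> * \<bar>t\<bar>" by (simp add: mn)
  then obtain T0 where T0: "\<And>t. t \<ge> T0 \<Longrightarrow> mass_norm m (x t - t *\<^sub>R a) \<le> \<kappa> * \<bar>t\<bar>" unfolding eventually_at_top_linorder
    by blast
  define T where "T = max (max T0 1) (t0 + 1)"
  have T: "T \<ge> 1" "T > t0" "T \<ge> T0" by (auto simp: T_def)
  define C where "C = 2 * K * pair_mass m / \<rho>\<^sup>2"
  have C0: "C \<ge> 0" using K kr pair_mass_nonneg[of m, OF m] by (simp add: C_def)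
  have sep: "\<rho> * t \<le> norm (x t $ i - x t $ j)" if "t \<ge> T" "i \<noteq> j" for t i j
  proof -
    have t: "t > 0" "t \<ge> T0" using that(1) T by auto
    have "mass_norm m (x t - t *\<^sub>R a) \<le> \<kappa> * t" using T0[OF t(2)] t(1) by simp
    then show ?thesis using kr(3) t(1) that(2) by blast
  qed
  have fb: "norm (mass_scale m (f t)) \<le> C / t\<^sup>2" if t: "t \<ge> T" for t
  proof -
    have t0: "t > t0" "t > 0" using t T by auto
    have r: "\<rho> * t > 0" using kr t0 by simp
    have "mass_norm m (f t) \<le> 2 * K * pair_mass m * (1 / (\<rho> * t)\<^sup>2)"
    proof (rule mass_norm_le_of_pair_forces[OF m K mass_gradient_potential[OF m Om[OF t0(1)] f[OF t0(1)]]])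
      fix i j :: 'n assume ij: "i \<noteq> j"
      have s: "\<rho> * t \<le> norm (x t $ i - x t $ j)" by (rule sep[OF t ij])
      define u where "u = x t $ i - x t $ j"
      have u: "\<rho> * t \<le> norm u" "norm u > 0" using s r unfolding u_def by linarith+
      have "norm ((1 / norm u ^ 3) *\<^sub>R u) = 1 / (norm u)\<^sup>2"
        using u(2) by (simp add: power3_eq_cube power2_eq_square)
      also have "\<dots> \<le> 1 / (\<rho> * t)\<^sup>2"
        by (intro frac_le power_mono u(1)) (use r in auto)
      finally show "norm ((1 / norm (x t $ i - x t $ j) ^ 3) *\<^sub>R (x t $ i - x t $ j)) \<le> 1 / (\<rho> * t)\<^sup>2"
        unfolding u_def .
    qed
    also have "\<dots> = C / t\<^sup>2" by (simp add: C_def power_mult_distrib)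
    finally show ?thesis by (simp add: mn)
  qed
  define V where "V t = mass_scale m (v t)" for t
  have Vd: "(V has_vector_derivative mass_scale m (f t)) (at t)" if "t > t0" for t
    unfolding V_def[abs_def] by (rule bounded_linear.has_vector_derivative[OF bounded_linear_mass_scale acc[OF that]])
  have Vinc: "norm (V t - V s) \<le> C / s - C / t" if "T \<le> s" "s \<le> t" for s t
  proof -
    have "norm (V t - V s) \<le> - (C / t) - - (C / s)"
    proof (rule vector_increment_le[OF that(2), where f' = "\<lambda>t. mass_scale m (f t)" and \<phi> = "\<lambda>t. - (C / t)" and \<phi>' = "\<lambda>t. C / t\<^sup>2"])
      show "((\<lambda>t. - (C / t)) has_real_derivative C / y\<^sup>2) (at y)" if "s \<le> y" for y
        using that \<open>T \<le> s\<close> T by (auto intro!: derivative_eq_intros simp: power2_eq_square)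
    qed (use that T Vd fb in auto)
    then show ?thesis by simp
  qed
  \<comment> \<open>The bound \<open>C / t\<^sup>2\<close> on the force is integrable, so the
    velocity converges; its limit \<open>b\<close> is identified with the shape only at the end,
    from the positions.\<close>
  have "Cauchy (\<lambda>n. V (real n))"
  proof (rule CauchyI)
    fix e :: real assume e: "0 < e"
    obtain M where M: "real M > max T (C / e)" using reals_Archimedean2 by blast
    have *: "norm (V (real p) - V (real q)) < e" if "M \<le> q" "q \<le> p" for p q
    proof -
      have q: "real q > T" "real q > C / e" "real q \<le> real p" using M that by auto
      have "norm (V (real p) - V (real q)) \<le> C / real q - C / real p" using q by (intro Vinc) auto
      also have "\<dots> \<le> C / real q" using C0 by simp
      also have "\<dots> < e" using q e T by (simp add: field_simps)
      finally show ?thesis .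
    qed
    show "\<exists>M. \<forall>p\<ge>M. \<forall>q\<ge>M. norm (V (real p) - V (real q)) < e"
    proof (intro exI[of _ M] allI impI)
      fix p q assume "M \<le> p" "M \<le> q"
      then show "norm (V (real p) - V (real q)) < e"
        using *[of q p] *[of p q] by (cases "q \<le> p") (auto simp: norm_minus_commute)
    qed
  qed
  then obtain b where b: "(\<lambda>n. V (real n)) \<longlonglongrightarrow> b" using Cauchy_convergent_iff convergent_def by blast
  have Vb: "norm (V s - b) \<le> C / s" if s: "T \<le> s" for s
  proof (rule tendsto_le[OF sequentially_bot tendsto_const])
    show "(\<lambda>n. norm (V s - V (real n))) \<longlonglongrightarrow> norm (V s - b)" by (intro tendsto_intros b)
    show "\<forall>\<^sub>F n in sequentially. norm (V s - V (real n)) \<le> C / s"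
      using eventually_ge_at_top[of "nat \<lceil>s\<rceil>"]
    proof (rule eventually_mono)
      fix n assume "nat \<lceil>s\<rceil> \<le> n"
      then have "s \<le> real n" by linarith
      from Vinc[OF s this] show "norm (V s - V (real n)) \<le> C / s"
        using C0 s T \<open>s \<le> real n\<close> by (simp add: norm_minus_commute) (smt (verit) divide_nonneg_pos)
    qed
  qed
  define X where "X t = mass_scale m (x t) - t *\<^sub>R b" for t
  have Xd: "(X has_vector_derivative (V t - b)) (at t)" if "t > t0" for t
  proof -
    have "((\<lambda>t. mass_scale m (x t)) has_vector_derivative V t) (at t)"
      unfolding V_def by (rule bounded_linear.has_vector_derivative[OF bounded_linear_mass_scale v[OF that]])
    moreover have "((\<lambda>t. t *\<^sub>R b) has_vector_derivative b) (at t)" by (auto intro!: derivative_eq_intros)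
    ultimately show ?thesis unfolding X_def[abs_def] by (rule has_vector_derivative_diff)
  qed
  \<comment> \<open>\<open>norm (X T)\<close> is absorbed into the multiple of
    \<open>sqrt t\<close>, as \<open>t \<ge> 1\<close>. The velocity error \<open>C / t\<close> is
    enlarged to \<open>C / sqrt t\<close> before it is integrated, which avoids the
    logarithm.\<close>
  define C' where "C' = norm (X T) + 2 * C"
  have C': "C' \<ge> 0" "C \<le> C'" using C0 by (auto simp: C'_def)
  have Xb: "norm (X t) \<le> C' * sqrt t" if t: "T \<le> t" for t
  proof -
    have "norm (X t - X T) \<le> 2 * C * sqrt t - 2 * C * sqrt T"
    proof (rule vector_increment_le[OF t, where \<phi>' = "\<lambda>t. C / sqrt t"])
      fix y assume y: "T \<le> y"
      then show "(X has_vector_derivative (V y - b)) (at y)" using T by (intro Xd) auto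
      show "((\<lambda>t. 2 * C * sqrt t) has_real_derivative C / sqrt y) (at y)"
        using y T by (auto intro!: derivative_eq_intros simp: field_simps)
      have "sqrt y \<le> y" using y T mult_left_mono[of 1 y y] by (intro real_le_lsqrt) (auto simp: power2_eq_square)
      then have "C / y \<le> C / sqrt y" using y T C0 by (intro divide_left_mono) auto
      with Vb[OF y] show "norm (V y - b) \<le> C / sqrt y" by linarith
    qed
    then have "norm (X t) \<le> norm (X T) * 1 + 2 * C * sqrt t"
      using norm_triangle_ineq2[of "X t" "X T"] C0 T by (smt (verit) mult_nonneg_nonneg real_sqrt_ge_zero)
    also have "\<dots> \<le> norm (X T) * sqrt t + 2 * C * sqrt t"
      using t T by (intro add_right_mono mult_left_mono) auto
    finally show ?thesis by (simp add: C'_def distrib_right)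
  qed
  \<comment> \<open>Both \<open>t *\<^sub>R b\<close> and \<open>t *\<^sub>R mass_scale m a\<close>
    approximate the scaled position up to \<open>o(t)\<close>.\<close>
  have "b = mass_scale m a"
  proof (rule ccontr)
    assume "b \<noteq> mass_scale m a"
    then have e: "norm (b - mass_scale m a) / 2 > 0" by simp
    from landau_o.smallD[OF ao e] have "\<forall>\<^sub>F t in at_top. mass_norm m (x t - t *\<^sub>R a) \<le> norm (b - mass_scale m a) / 2 * \<bar>t\<bar>"
      by (simp add: mn)
    moreover have "\<forall>\<^sub>F t in at_top. C' * sqrt t / t < norm (b - mass_scale m a) / 2"
      by (rule order_tendstoD(2)[OF power_sqrt_tendsto_zero(1) e])
    ultimately have "\<forall>\<^sub>F t in at_top. mass_norm m (x t - t *\<^sub>R a) \<le> norm (b - mass_scale m a) / 2 * \<bar>t\<bar> \<and>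
        C' * sqrt t / t < norm (b - mass_scale m a) / 2 \<and> t \<ge> T"
      using eventually_ge_at_top[of T] by eventually_elim auto
    then obtain t where t: "mass_norm m (x t - t *\<^sub>R a) \<le> norm (b - mass_scale m a) / 2 * \<bar>t\<bar>"
        "C' * sqrt t / t < norm (b - mass_scale m a) / 2" "t \<ge> T"
      using eventually_happens'[OF trivial_limit_at_top_linorder] by blast
    have t1: "t > 0" using t T by auto
    have "t *\<^sub>R (b - mass_scale m a) = mass_scale m (x t - t *\<^sub>R a) - X t"
      by (simp add: X_def mass_scale_diff linear_scale[OF linear_mass_scale] algebra_simps)
    then have "t * norm (b - mass_scale m a) \<le> norm (mass_scale m (x t - t *\<^sub>R a)) + norm (X t)"
      using norm_triangle_ineq4[of "mass_scale m (x t - t *\<^sub>R a)" "X t"] t1 by (metis abs_of_pos norm_scaleR)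
    also have "\<dots> < norm (b - mass_scale m a) / 2 * t + norm (b - mass_scale m a) / 2 * t"
      using t(1,2) t1 Xb[OF t(3)] by (intro add_le_less_mono) (auto simp: mn field_simps)
    finally show False by (simp add: mult.commute)
  qed
  then have "mass_norm m (v t - a) \<le> C' / t \<and> mass_norm m (x t - t *\<^sub>R a) \<le> C' * sqrt t" if "t \<ge> T" for t
  proof -
    have "mass_norm m (v t - a) = norm (V t - b)" using \<open>b = mass_scale m a\<close> by (simp add: mn V_def mass_scale_diff)
    moreover have "mass_norm m (x t - t *\<^sub>R a) = norm (X t)"
      using \<open>b = mass_scale m a\<close> by (simp add: mn X_def mass_scale_diff linear_scale[OF linear_mass_scale])
    moreover have "C / t \<le> C' / t" using C' that T by (intro divide_right_mono) auto
    ultimately show ?thesis using Vb[OF that] Xb[OF that] by linarith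
  qed
  then show ?thesis using T by blast
qed

lemma mass_inner_diff_left: "mass_inner m (x - y) z = mass_inner m x z - mass_inner m y z"
  by (simp add: mass_inner_def inner_diff_left right_diff_distrib sum_subtractf)

text \<open>Both positions are within \<open>O(sqrt t)\<close> of \<open>t *\<^sub>R a\<close>,
  where the pair forces have a Lipschitz constant of order \<open>t\<close> to the power -3. The
  accelerations thus differ by order \<open>t powr (-5/2)\<close>, which is still integrable after
  one integration from infinity.\<close>

lemma hyperbolic_motions_same_shape_bounded:
  fixes x1 x2 :: "real \<Rightarrow> ('a::euclidean_space, 'n::{finite,linorder}) vec"
  assumes m: "\<And>i. m i > 0"
    and v1: "\<And>t. t > t0 \<Longrightarrow> (x1 has_vector_derivative v1 t) (at t)"
    and acc1: "\<And>t. t > t0 \<Longrightarrow> (v1 has_vector_derivative f1 t) (at t)"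
    and f1: "\<And>t. t > t0 \<Longrightarrow> has_mass_gradient m (\<lambda>y. enn2real (potential m y)) (x1 t) (f1 t)"
    and Om1: "\<And>t. t > t0 \<Longrightarrow> x1 t \<in> Omega"
    and v2: "\<And>t. t > t0 \<Longrightarrow> (x2 has_vector_derivative v2 t) (at t)"
    and acc2: "\<And>t. t > t0 \<Longrightarrow> (v2 has_vector_derivative f2 t) (at t)"
    and f2: "\<And>t. t > t0 \<Longrightarrow> has_mass_gradient m (\<lambda>y. enn2real (potential m y)) (x2 t) (f2 t)"
    and Om2: "\<And>t. t > t0 \<Longrightarrow> x2 t \<in> Omega"
    and a1: "has_limit_shape m x1 a" and a2: "has_limit_shape m x2 a"
  shows "\<exists>C T. \<forall>t\<ge>T. mass_norm m (x1 t - x2 t) \<le> C"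
proof -
  have aO: "a \<in> Omega" using a1 by (auto simp: has_limit_shape_def)
  have mn: "mass_norm m y = norm (mass_scale m y)" for y :: "('a, 'n) vec" by (rule mass_norm_scale[OF m])
  obtain K where K: "K > 0" "\<And>x :: ('a, 'n) vec. norm x \<le> K * mass_norm m x" using norm_le_mass_norm[of m, OF m]
    by blast
  obtain \<kappa> \<rho> where kr: "\<kappa> > 0" "\<rho> > 0" "\<forall>x \<xi> i j. \<xi> > 0 \<longrightarrow> mass_norm m (x - \<xi> *\<^sub>R a) \<le> \<kappa> * \<xi> \<longrightarrow> i \<noteq> j \<longrightarrow> \<rho> * \<xi> \<le> norm (x $ i - x $ j)"
    using shape_cone_separated[of m a, OF m aO] by blast
  obtain C1 T1 where A1: "T1 \<ge> 1" "T1 > t0" "\<forall>t\<ge>T1. mass_norm m (v1 t - a) \<le> C1 / t \<and> mass_norm m (x1 t - t *\<^sub>R a) \<le> C1 * sqrt t"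
    using hyperbolic_motion_asymptotics[of m t0 x1 v1 f1 a, OF m v1 acc1 f1 Om1 a1] by blast
  obtain C2 T2 where A2: "T2 \<ge> 1" "T2 > t0" "\<forall>t\<ge>T2. mass_norm m (v2 t - a) \<le> C2 / t \<and> mass_norm m (x2 t - t *\<^sub>R a) \<le> C2 * sqrt t"
    using hyperbolic_motion_asymptotics[of m t0 x2 v2 f2 a, OF m v2 acc2 f2 Om2 a2] by blast
  have "\<forall>\<^sub>F t in at_top. max C1 C2 * sqrt t / t < \<kappa>" by (rule order_tendstoD(2)[OF power_sqrt_tendsto_zero(1) kr(1)])
  then obtain T0 where T0: "\<And>t. t \<ge> T0 \<Longrightarrow> max C1 C2 * sqrt t / t < \<kappa>" unfolding eventually_at_top_linorder by blast
  define T where "T = max T0 (max T1 T2)"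
  have T: "T \<ge> 1" "T > t0" "T \<ge> T0" "T \<ge> T1" "T \<ge> T2" using A1 A2 by (auto simp: T_def)
  have sep: "\<rho> * t \<le> norm (x1 t $ i - x1 t $ j)" "\<rho> * t \<le> norm (x2 t $ i - x2 t $ j)" if "t \<ge> T" "i \<noteq> j" for t i j
  proof -
    have t: "t > 0" "t \<ge> T0" "t \<ge> T1" "t \<ge> T2" using that(1) T by auto
    have q: "max C1 C2 * sqrt t \<le> \<kappa> * t" using T0[OF t(2)] t(1) by (simp add: field_simps)
    have "C1 * sqrt t \<le> max C1 C2 * sqrt t" "C2 * sqrt t \<le> max C1 C2 * sqrt t" using t
      by (auto intro: mult_right_mono)
    then have "mass_norm m (x1 t - t *\<^sub>R a) \<le> \<kappa> * t" "mass_norm m (x2 t - t *\<^sub>R a) \<le> \<kappa> * t"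
      using A1(3) A2(3) t q by (meson order_trans)+
    then show "\<rho> * t \<le> norm (x1 t $ i - x1 t $ j)" "\<rho> * t \<le> norm (x2 t $ i - x2 t $ j)" using kr(3) t(1) that(2)
      by blast+
  qed
  have C12: "C1 + C2 \<ge> 0"
  proof -
    have "0 \<le> C1 / T" "0 \<le> C2 / T" using A1(3) A2(3) T mn norm_ge_zero by (metis order_trans)+
    then show ?thesis using T by (simp add: zero_le_divide_iff)
  qed
  have zb: "mass_norm m (x1 t - x2 t) \<le> (C1 + C2) * sqrt t" "mass_norm m (v1 t - v2 t) \<le> (C1 + C2) / t" if "t \<ge> T"
    for t
  proof -
    have d: "mass_norm m (p - q) \<le> mass_norm m (p - r) + mass_norm m (q - r)" for p q r :: "('a, 'n) vec"
      unfolding mn mass_scale_diff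
        using norm_triangle_ineq4[of "mass_scale m p - mass_scale m r" "mass_scale m q - mass_scale m r"] by simp
    have t: "t \<ge> T1" "t \<ge> T2" using that T by auto
    show "mass_norm m (x1 t - x2 t) \<le> (C1 + C2) * sqrt t"
      using d[of "x1 t" "x2 t" "t *\<^sub>R a"] A1(3) A2(3) t by (simp add: distrib_right) (meson add_mono order_trans)
    show "mass_norm m (v1 t - v2 t) \<le> (C1 + C2) / t"
      using d[of "v1 t" "v2 t" a] A1(3) A2(3) t by (simp add: add_divide_distrib) (meson add_mono order_trans)
  qed
  \<comment> \<open>The 4 is the Lipschitz factor of the pair force,
    \<open>2 * (K * (C1 + C2))\<close> bounds the change of a mutual difference per
    \<open>sqrt t\<close>, and \<open>2 * K * pair_mass m\<close> passes from pair forces to the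
    gradient.\<close>
  define c where "c = 2 * K * pair_mass m * (4 * (2 * (K * (C1 + C2))) / \<rho> ^ 3)"
  have c0: "c \<ge> 0" using K kr pair_mass_nonneg[of m, OF m] C12 by (simp add: c_def)
  have fb: "mass_norm m (f1 t - f2 t) \<le> c * t powr (-5/2)" if t: "t \<ge> T" for t
  proof -
    have t0: "t > t0" "t > 0" using t T by auto
    have r: "\<rho> * t > 0" using kr t0 by simp
    define F where "F x i j = (1 / norm (x $ i - x $ j) ^ 3) *\<^sub>R (x $ i - x $ j)" for x :: "('a, 'n) vec" and i j
    have "mass_norm m (f1 t - f2 t) \<le> 2 * K * pair_mass m * (4 * (2 * (K * ((C1 + C2) * sqrt t))) / (\<rho> * t) ^ 3)"
    proof (rule mass_norm_le_of_pair_forces[OF m K, where f = "\<lambda>i j. F (x1 t) i j - F (x2 t) i j"])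
      show "mass_inner m (f1 t - f2 t) (f1 t - f2 t) = - (\<Sum>(i, j)\<in>{(i, j). i < j}. m i * m j *
          ((F (x1 t) i j - F (x2 t) i j) \<bullet> ((f1 t - f2 t) $ i - (f1 t - f2 t) $ j)))"
        unfolding mass_inner_diff_left[of m "f1 t" "f2 t"] mass_gradient_potential[OF m Om1[OF t0(1)] f1[OF t0(1)]]
          mass_gradient_potential[OF m Om2[OF t0(1)] f2[OF t0(1)]]
        by (simp only: F_def case_prod_unfold inner_diff_left right_diff_distrib sum_subtractf)
      fix i j :: 'n assume ij: "i \<noteq> j"
      have "norm (F (x1 t) i j - F (x2 t) i j) \<le> 4 * norm ((x1 t $ i - x1 t $ j) - (x2 t $ i - x2 t $ j)) / (\<rho> * t) ^ 3"
        unfolding F_def by (rule inverse_square_field_lipschitz[OF r sep[OF t ij]])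
      also have "\<dots> \<le> 4 * (2 * (K * ((C1 + C2) * sqrt t))) / (\<rho> * t) ^ 3"
      proof (intro divide_right_mono mult_left_mono)
        have n: "norm ((x1 t - x2 t) $ l) \<le> K * ((C1 + C2) * sqrt t)" for l
          using Finite_Cartesian_Product.norm_nth_le[of "x1 t - x2 t" l] K(2)[of "x1 t - x2 t"] mult_left_mono[OF zb(1)[OF t], of K] K(1)
            by linarith
        have "(x1 t $ i - x1 t $ j) - (x2 t $ i - x2 t $ j) = (x1 t - x2 t) $ i - (x1 t - x2 t) $ j" by simp
        also have "norm \<dots> \<le> norm ((x1 t - x2 t) $ i) + norm ((x1 t - x2 t) $ j)" by (rule norm_triangle_ineq4)
        finally show "norm ((x1 t $ i - x1 t $ j) - (x2 t $ i - x2 t $ j)) \<le> 2 * (K * ((C1 + C2) * sqrt t))"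
          using n[of i] n[of j] by linarith
      qed (use r in auto)
      finally show "norm (F (x1 t) i j - F (x2 t) i j) \<le> 4 * (2 * (K * ((C1 + C2) * sqrt t))) / (\<rho> * t) ^ 3" .
    qed
    also have "\<dots> = c * (sqrt t / t ^ 3)" by (simp add: c_def power_mult_distrib)
    also have "sqrt t / t ^ 3 = t powr (-5/2)"
    proof -
      have "sqrt t / t ^ 3 = t powr (1/2) / t powr 3" using t0 by (simp add: powr_half_sqrt)
      also have "\<dots> = t powr (1/2 - 3)" by (rule powr_diff[symmetric])
      finally show ?thesis by simp
    qed
    finally show ?thesis .
  qed
  define Z where "Z t = mass_scale m (x1 t - x2 t)" for t
  define W where "W t = mass_scale m (v1 t - v2 t)" for t
  have Zd: "(Z has_vector_derivative W t) (at t)" if "t > t0" for t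
    unfolding Z_def[abs_def] W_def
    by (intro bounded_linear.has_vector_derivative[OF bounded_linear_mass_scale] has_vector_derivative_diff v1 v2 that)
  have Wd: "(W has_vector_derivative mass_scale m (f1 t - f2 t)) (at t)" if "t > t0" for t
    unfolding W_def[abs_def]
    by (intro bounded_linear.has_vector_derivative[OF bounded_linear_mass_scale] has_vector_derivative_diff acc1 acc2 that)
  \<comment> \<open>Integrating backwards from infinity, where the difference of the velocities
    vanishes, gives decay; integrating from \<open>T\<close> would leave a constant and hence a
    linear bound for the positions.\<close>
  have Wb: "norm (W s) \<le> 2/3 * c * s powr (-3/2)" if s: "s \<ge> T" for s
  proof -
    have *: "norm (W s) \<le> (C1 + C2) / t + 2/3 * c * s powr (-3/2)" if st: "s \<le> t" for t
    proof -
      have "norm (W t - W s) \<le> - (2/3 * c * t powr (-3/2)) - - (2/3 * c * s powr (-3/2))"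
      proof (rule vector_increment_le[OF st, where f' = "\<lambda>t. mass_scale m (f1 t - f2 t)" and \<phi> = "\<lambda>t. - (2/3 * c * t powr (-3/2))" and \<phi>' = "\<lambda>t. c * t powr (-5/2)"])
        fix y assume y: "s \<le> y"
        show "(W has_vector_derivative mass_scale m (f1 y - f2 y)) (at y)" using y s T by (intro Wd) auto
        show "((\<lambda>t. - (2/3 * c * t powr (-3/2))) has_real_derivative c * y powr (-5/2)) (at y)"
          using y s T by (auto intro!: derivative_eq_intros)
        show "norm (mass_scale m (f1 y - f2 y)) \<le> c * y powr (-5/2)" using fb[of y] y s by (simp add: mn)
      qed
      moreover have "norm (W t) \<le> (C1 + C2) / t" using zb(2)[of t] st s by (simp add: mn W_def)
      moreover have "0 \<le> 2/3 * c * t powr (-3/2)" using c0 by simp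
      ultimately show ?thesis using norm_triangle_ineq2[of "W s" "W t"] norm_minus_commute[of "W s" "W t"] by linarith
    qed
    have "((\<lambda>t. (C1 + C2) / t + 2/3 * c * s powr (-3/2)) \<longlongrightarrow> 0 + 2/3 * c * s powr (-3/2)) at_top"
      by (intro tendsto_add power_sqrt_tendsto_zero(2) tendsto_const)
    then have "norm (W s) \<le> 0 + 2/3 * c * s powr (-3/2)"
    proof (rule tendsto_lowerbound)
      show "\<forall>\<^sub>F t in at_top. norm (W s) \<le> (C1 + C2) / t + 2/3 * c * s powr (-3/2)"
        by (rule eventually_mono[OF eventually_ge_at_top[of s]]) (rule *)
    qed simp
    then show ?thesis by simp
  qed
  have "mass_norm m (x1 t - x2 t) \<le> norm (Z T) + 4/3 * c * T powr (-1/2)" if t: "t \<ge> T" for t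
  proof -
    have "norm (Z t - Z T) \<le> - (4/3 * c * t powr (-1/2)) - - (4/3 * c * T powr (-1/2))"
    proof (rule vector_increment_le[OF t, where f' = W and \<phi> = "\<lambda>t. - (4/3 * c * t powr (-1/2))" and \<phi>' = "\<lambda>t. 2/3 * c * t powr (-3/2)"])
      fix y assume y: "T \<le> y"
      show "(Z has_vector_derivative W y) (at y)" using y T by (intro Zd) auto
      show "((\<lambda>t. - (4/3 * c * t powr (-1/2))) has_real_derivative 2/3 * c * y powr (-3/2)) (at y)"
        using y T by (auto intro!: derivative_eq_intros)
    qed (use Wb in auto)
    moreover have "0 \<le> 4/3 * c * t powr (-1/2)" using c0 by simp
    ultimately have "norm (Z t) \<le> norm (Z T) + 4/3 * c * T powr (-1/2)" using norm_triangle_ineq2[of "Z t" "Z T"]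
      by linarith
    then show ?thesis by (simp add: Z_def mn)
  qed
  then show ?thesis by blast
qed

lemma hyperbolic_geodesic_rayE:
  fixes \<gamma> :: "real \<Rightarrow> ('a::euclidean_space, 'n::{finite,linorder}) vec"
  assumes "hyperbolic_geodesic_ray m h t0 \<gamma>"
  obtains v f a where "\<And>t. t > t0 \<Longrightarrow> (\<gamma> has_vector_derivative v t) (at t)"
    "\<And>t. t > t0 \<Longrightarrow> (v has_vector_derivative f t) (at t)"
    "\<And>t. t > t0 \<Longrightarrow> has_mass_gradient m (\<lambda>y. enn2real (potential m y)) (\<gamma> t) (f t)"
    "\<And>t. t > t0 \<Longrightarrow> \<gamma> t \<in> Omega" "has_limit_shape m \<gamma> a"
    "\<And>t. t > t0 \<Longrightarrow> 1 / 2 * (mass_norm m (v t))\<^sup>2 - enn2real (potential m (\<gamma> t)) = h"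
proof -
  have at: "at t within {t0<..} = at t" if "t > t0" for t using that by (intro at_within_open) auto
  have M: "motion m {t0<..} \<gamma>" and a: "\<exists>a. has_limit_shape m \<gamma> a" and E: "has_energy m {t0<..} \<gamma> h"
    using assms by (auto simp: hyperbolic_geodesic_ray_def hyperbolic_motion_def)
  from a obtain a where a: "has_limit_shape m \<gamma> a" by blast
  have Om: "\<gamma> t \<in> Omega" if "t > t0" for t using M that by (auto simp: motion_def)
  from M obtain v f where vf: "\<forall>t\<in>{t0<..}. (\<gamma> has_vector_derivative v t) (at t within {t0<..}) \<and>
        (v has_vector_derivative f t) (at t within {t0<..}) \<and>
        has_mass_gradient m (\<lambda>y. enn2real (potential m y)) (\<gamma> t) (f t)" unfolding motion_def by blast
  have vf': "(\<gamma> has_vector_derivative v t) (at t) \<and> (v has_vector_derivative f t) (at t)" if "t > t0" for t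
  proof -
    have "t \<in> {t0<..}" using that by simp
    from bspec[OF vf this, unfolded at[OF that]] show ?thesis by blast
  qed
  then have v: "(\<gamma> has_vector_derivative v t) (at t)" if "t > t0" for t using that by blast
  show thesis
  proof (rule that[OF v _ _ Om a])
    show "(v has_vector_derivative f t) (at t)" if "t > t0" for t using vf' that by blast
    show "has_mass_gradient m (\<lambda>y. enn2real (potential m y)) (\<gamma> t) (f t)" if "t > t0" for t using vf that by auto
    fix t assume t: "t > t0"
    have "vector_derivative \<gamma> (at t within {t0<..}) = v t" unfolding at[OF t]
      by (rule vector_derivative_at[OF v[OF t]])
    moreover have "1 / 2 * (mass_norm m (vector_derivative \<gamma> (at t within {t0<..})))\<^sup>2 - enn2real (potential m (\<gamma> t)) = h"
      using E t unfolding has_energy_def by blast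
    ultimately show "1 / 2 * (mass_norm m (v t))\<^sup>2 - enn2real (potential m (\<gamma> t)) = h" by (simp only:)
  qed
qed

text \<open>Far out the potential vanishes and the velocity tends to \<open>a\<close>, so the energy
  determines the norm of \<open>a\<close>. By conservation of energy the Lagrangian along the ray
  equals the squared speed, which tends to \<open>2 * h\<close>.\<close>

lemma ray_energy_and_action:
  fixes \<gamma> :: "real \<Rightarrow> ('a::euclidean_space, 'n::{finite,linorder}) vec"
  assumes m: "\<And>i. m i > 0" and h: "h > 0" and ray: "hyperbolic_geodesic_ray m h t0 \<gamma>" and a: "has_limit_shape m \<gamma> a"
  shows "(mass_norm m a)\<^sup>2 = 2 * h"
    and "\<epsilon> > 0 \<Longrightarrow> \<exists>T>t0. \<forall>t\<ge>T. action m h T t \<gamma> \<le> ennreal ((2 * h + \<epsilon>) * (t - T))"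
proof -
  obtain v f b where
    v: "\<And>t. t > t0 \<Longrightarrow> (\<gamma> has_vector_derivative v t) (at t)" and
    acc: "\<And>t. t > t0 \<Longrightarrow> (v has_vector_derivative f t) (at t)" and
    f: "\<And>t. t > t0 \<Longrightarrow> has_mass_gradient m (\<lambda>y. enn2real (potential m y)) (\<gamma> t) (f t)" and
    Om: "\<And>t. t > t0 \<Longrightarrow> \<gamma> t \<in> Omega" and "has_limit_shape m \<gamma> b" and
    E: "\<And>t. t > t0 \<Longrightarrow> 1 / 2 * (mass_norm m (v t))\<^sup>2 - enn2real (potential m (\<gamma> t)) = h"
    by (rule hyperbolic_geodesic_rayE[OF ray]) (rule that)
  have aO: "a \<in> Omega" using a by (auto simp: has_limit_shape_def)
  have mn: "mass_norm m y = norm (mass_scale m y)" for y :: "('a, 'n) vec" by (rule mass_norm_scale[OF m])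
  obtain \<kappa> \<rho> where kr: "\<kappa> > 0" "\<rho> > 0" "\<forall>x \<xi> i j. \<xi> > 0 \<longrightarrow> mass_norm m (x - \<xi> *\<^sub>R a) \<le> \<kappa> * \<xi> \<longrightarrow> i \<noteq> j \<longrightarrow> \<rho> * \<xi> \<le> norm (x $ i - x $ j)"
    using shape_cone_separated[of m a, OF m aO] by blast
  obtain C T1 where A: "T1 \<ge> 1" "T1 > t0" "\<forall>t\<ge>T1. mass_norm m (v t - a) \<le> C / t \<and> mass_norm m (\<gamma> t - t *\<^sub>R a) \<le> C * sqrt t"
    using hyperbolic_motion_asymptotics[of m t0 \<gamma> v f a, OF m v acc f Om a] by blast
  have ev: "\<forall>\<^sub>F t in at_top. t \<ge> T1 \<and> C * sqrt t / t < \<kappa>"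
    using order_tendstoD(2)[OF power_sqrt_tendsto_zero(1)[of C] kr(1)] eventually_ge_at_top[of T1]
      by eventually_elim auto
  have U: "\<forall>\<^sub>F t in at_top. norm (enn2real (potential m (\<gamma> t))) \<le> (pair_mass m / \<rho>) / t"
    using ev
  proof (rule eventually_mono)
    fix t assume t: "t \<ge> T1 \<and> C * sqrt t / t < \<kappa>"
    then have t0: "t > 0" "C * sqrt t \<le> \<kappa> * t" using A by (auto simp: field_simps)
    have "mass_norm m (\<gamma> t - t *\<^sub>R a) \<le> \<kappa> * t" using A(3) t t0 by (meson order_trans)
    then have "potential m (\<gamma> t) \<le> ennreal (pair_mass m / (\<rho> * t))" using kr t0 by (intro potential_le m) auto
    then have "enn2real (potential m (\<gamma> t)) \<le> pair_mass m / (\<rho> * t)"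
      using kr t0 pair_mass_nonneg[of m, OF m] by (intro enn2real_leI) auto
    then show "norm (enn2real (potential m (\<gamma> t))) \<le> (pair_mass m / \<rho>) / t" by simp
  qed
  have "((\<lambda>t. enn2real (potential m (\<gamma> t))) \<longlongrightarrow> 0) at_top"
    by (rule tendsto_0_le[OF power_sqrt_tendsto_zero(2)[of "pair_mass m / \<rho>"], where K=1]) (use U eventually_gt_at_top[of 0] in \<open>eventually_elim, use pair_mass_nonneg[of m, OF m] kr in \<open>simp\<close>\<close>)
  moreover have "((\<lambda>t. mass_norm m (v t)) \<longlongrightarrow> mass_norm m a) at_top"
  proof -
    have "((\<lambda>t. mass_scale m (v t) - mass_scale m a) \<longlongrightarrow> 0) at_top"
    proof (rule Lim_null_comparison[OF _ power_sqrt_tendsto_zero(2)[of C]])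
      show "\<forall>\<^sub>F t in at_top. norm (mass_scale m (v t) - mass_scale m a) \<le> C / t"
        using eventually_ge_at_top[of T1] by (rule eventually_mono) (use A(3) in \<open>simp add: mn mass_scale_diff\<close>)
    qed
    then have "((\<lambda>t. mass_scale m (v t)) \<longlongrightarrow> mass_scale m a) at_top" by (simp add: LIM_zero_iff)
    then show ?thesis unfolding mn by (rule tendsto_norm)
  qed
  note v_lim = this
  ultimately have "((\<lambda>t. 1 / 2 * (mass_norm m (v t))\<^sup>2 - enn2real (potential m (\<gamma> t))) \<longlongrightarrow> 1 / 2 * (mass_norm m a)\<^sup>2 - 0) at_top"
    by (intro tendsto_diff tendsto_mult tendsto_power tendsto_const)
  moreover have "((\<lambda>t. 1 / 2 * (mass_norm m (v t))\<^sup>2 - enn2real (potential m (\<gamma> t))) \<longlongrightarrow> h) at_top"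
    by (rule tendsto_eventually, rule eventually_mono[OF eventually_gt_at_top[of t0]]) (rule E)
  ultimately have "1 / 2 * (mass_norm m a)\<^sup>2 - 0 = h" by (rule tendsto_unique[OF trivial_limit_at_top_linorder])
  then show a2: "(mass_norm m a)\<^sup>2 = 2 * h" by simp
  assume e: "\<epsilon> > 0"
  have "((\<lambda>t. (mass_norm m (v t))\<^sup>2) \<longlongrightarrow> 2 * h) at_top" using tendsto_power[OF v_lim, of 2] by (simp add: a2)
  then have "\<forall>\<^sub>F t in at_top. (mass_norm m (v t))\<^sup>2 < 2 * h + \<epsilon>" using e by (intro order_tendstoD(2)) auto
  then obtain T2 where T2: "\<And>t. t \<ge> T2 \<Longrightarrow> (mass_norm m (v t))\<^sup>2 < 2 * h + \<epsilon>" unfolding eventually_at_top_linorder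
    by blast
  define T where "T = max T2 (t0 + 1)"
  show "\<exists>T>t0. \<forall>t\<ge>T. action m h T t \<gamma> \<le> ennreal ((2 * h + \<epsilon>) * (t - T))"
  proof (intro exI[of _ T] conjI allI impI)
    show "T > t0" by (simp add: T_def)
    fix t assume t: "t \<ge> T"
    have l: "lagrangian m h \<gamma> s \<le> ennreal (2 * h + \<epsilon>)" if "s \<ge> T" for s
    proof -
      have s: "s > t0" "s \<ge> T2" using that by (auto simp: T_def)
      define u where "u = enn2real (potential m (\<gamma> s))"
      have "potential m (\<gamma> s) \<noteq> top" using potential_eq_top_iff[of m "\<gamma> s", OF m] Om[OF s(1)] by simp
      then have p: "potential m (\<gamma> s) = ennreal u" unfolding u_def by (simp add: less_top)
      have u: "u \<ge> 0" by (simp add: u_def)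
      have "lagrangian m h \<gamma> s = ennreal (1 / 2 * (mass_norm m (v s))\<^sup>2) + ennreal u + ennreal h"
        unfolding lagrangian_def p using vector_derivative_at[OF v[OF s(1)]] by simp
      also have "\<dots> = ennreal (1 / 2 * (mass_norm m (v s))\<^sup>2 + u + h)" using u h by (simp flip: ennreal_plus)
      also have "\<dots> \<le> ennreal (2 * h + \<epsilon>)"
        using E[OF s(1)] T2[OF s(2)] u_def by (intro ennreal_leI) linarith
      finally show ?thesis .
    qed
    have "action m h T t \<gamma> \<le> (\<integral>\<^sup>+s\<in>{T..t}. ennreal (2 * h + \<epsilon>) \<partial>lborel)"
      unfolding action_eq_lagrangian by (intro nn_integral_mono) (use l in \<open>auto simp: indicator_def\<close>)
    also have "\<dots> = ennreal (2 * h + \<epsilon>) * ennreal (t - T)" using t by (simp add: nn_integral_cmult)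
    also have "\<dots> = ennreal ((2 * h + \<epsilon>) * (t - T))" using h e t by (simp add: ennreal_mult)
    finally show "action m h T t \<gamma> \<le> ennreal ((2 * h + \<epsilon>) * (t - T))" .
  qed
qed

text \<open>The two pieces of the minimizing arc up to \<open>t\<close> compete for the two
  distances, and their actions add up to that of the arc.\<close>

lemma ray_jm_dist_additive:
  assumes ray: "hyperbolic_geodesic_ray m h t0 \<gamma>" and m: "\<And>i. m i > 0" and st: "t0 < s" "s < t"
  shows "jm_dist m h (\<gamma> t0) (\<gamma> t) = jm_dist m h (\<gamma> t0) (\<gamma> s) + jm_dist m h (\<gamma> s) (\<gamma> t)"
proof (rule antisym)
  show "jm_dist m h (\<gamma> t0) (\<gamma> t) \<le> jm_dist m h (\<gamma> t0) (\<gamma> s) + jm_dist m h (\<gamma> s) (\<gamma> t)"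
    by (rule jm_dist_triangle[OF m])
  have ac: "abs_continuous_on {t0..t} \<gamma>" and eq: "\<And>r. r > t0 \<Longrightarrow> action m h t0 r \<gamma> = jm_dist m h (\<gamma> t0) (\<gamma> r)"
    using ray st by (auto simp: hyperbolic_geodesic_ray_def)
  have "abs_continuous_on {s..t} \<gamma>" using ac by (rule abs_continuous_on_subset) (use st in auto)
  then have "jm_dist m h (\<gamma> s) (\<gamma> t) \<le> action m h s t \<gamma>" by (rule jm_dist_le_action[OF st(2)])
  then have "jm_dist m h (\<gamma> t0) (\<gamma> s) + jm_dist m h (\<gamma> s) (\<gamma> t) \<le> action m h t0 s \<gamma> + action m h s t \<gamma>"
    unfolding eq[OF st(1)] by (rule add_left_mono)
  also have "\<dots> = jm_dist m h (\<gamma> t0) (\<gamma> t)" using action_split[of t0 s t m h \<gamma>] eq[of t] st by simp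
  finally show "jm_dist m h (\<gamma> t0) (\<gamma> s) + jm_dist m h (\<gamma> s) (\<gamma> t) \<le> jm_dist m h (\<gamma> t0) (\<gamma> t)" .
qed

subsection \<open>Rays in a metric that is asymptotically a multiple of the Euclidean one\<close>

text \<open>Concavity of the square root: \<open>sqrt (l\<^sup>2 + r) \<le> l + r / (2 * l)\<close>
  with \<open>l = norm q\<close> and
  \<open>r = 2 * (q \<bullet> z) + (norm z)\<^sup>2\<close>.\<close>

lemma norm_add_le_linear:
  fixes q z :: "'w::real_inner" assumes "q \<noteq> 0"
  shows "norm (q + z) \<le> norm q + (q \<bullet> z) / norm q + (norm z)\<^sup>2 / (2 * norm q)"
proof -
  define l e where "l = norm q" and "e = (q \<bullet> z) / l + (norm z)\<^sup>2 / (2 * l)"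
  have l: "l > 0" using assms by (simp add: l_def)
  have eq: "(norm (q + z))\<^sup>2 = l\<^sup>2 + 2 * (q \<bullet> z) + (norm z)\<^sup>2"
    unfolding l_def power2_norm_eq_inner by (simp add: inner_add_left inner_add_right inner_commute)
  have le: "2 * l * e = 2 * (q \<bullet> z) + (norm z)\<^sup>2" using l by (simp add: e_def field_simps)
  have sq: "(l + e)\<^sup>2 = (norm (q + z))\<^sup>2 + e\<^sup>2" unfolding eq using le by (simp add: power2_sum)
  have "2 * l * (l + e) = (norm (q + z))\<^sup>2 + l\<^sup>2" unfolding eq using le by (simp add: power2_eq_square algebra_simps)
  also have "\<dots> \<ge> 0" by simp
  finally have "l + e \<ge> 0" using l by (simp add: zero_le_mult_iff)
  have "(norm (q + z))\<^sup>2 \<le> (l + e)\<^sup>2" unfolding sq by simp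
  then have "norm (q + z) \<le> l + e" using \<open>l + e \<ge> 0\<close> by (rule power2_le_imp_le)
  then show ?thesis by (simp add: l_def e_def)
qed

text \<open>Removing \<open>q\<close> from \<open>t *\<^sub>R a\<close> shortens it by the full
  length of \<open>q\<close>, up to the defect \<open>\<delta> * t\<close>. Equality in the triangle
  inequality would force parallel directions; the law of cosines makes this quantitative.\<close>

lemma direction_close:
  fixes a q :: "'w::real_inner"
  assumes k: "norm a = k" "k > 0" and e: "\<epsilon> > 0" "t > 0" "\<delta> \<ge> 0" and q: "norm q = \<epsilon> * t"
    and le: "norm (t *\<^sub>R a - q) \<le> (k - \<epsilon> + \<delta>) * t"
  shows "(norm ((k / norm q) *\<^sub>R q - a))\<^sup>2 \<le> k * (2 * k * \<delta> + \<delta>\<^sup>2) / \<epsilon>"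
proof -
  define c where "c = (a \<bullet> q) / t"
  have aq: "a \<bullet> q = t * c" using e by (simp add: c_def)
  have "(norm (t *\<^sub>R a - q))\<^sup>2 \<le> ((k - \<epsilon> + \<delta>) * t)\<^sup>2" by (intro power_mono le) simp
  also have "(norm (t *\<^sub>R a - q))\<^sup>2 = t\<^sup>2 * (norm a)\<^sup>2 - 2 * t * (a \<bullet> q) + (norm q)\<^sup>2"
    unfolding power2_norm_eq_inner by (simp add: inner_diff_left inner_diff_right inner_commute power2_eq_square)
  also have "\<dots> = t\<^sup>2 * (k\<^sup>2 - 2 * c + \<epsilon>\<^sup>2)" unfolding k(1) q aq by (simp add: algebra_simps power2_eq_square)
  finally have "t\<^sup>2 * (k\<^sup>2 - 2 * c + \<epsilon>\<^sup>2) \<le> t\<^sup>2 * (k - \<epsilon> + \<delta>)\<^sup>2" by (simp add: power_mult_distrib mult.commute)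
  then have "k\<^sup>2 - 2 * c + \<epsilon>\<^sup>2 \<le> (k - \<epsilon> + \<delta>)\<^sup>2" using e by simp
  then have "2 * (k * \<epsilon> - c) \<le> 2 * k * \<delta> + \<delta>\<^sup>2 - 2 * \<epsilon> * \<delta>" by (simp add: power2_eq_square algebra_simps)
  also have "\<dots> \<le> 2 * k * \<delta> + \<delta>\<^sup>2" using e by simp
  finally have c: "2 * (k * \<epsilon> - c) \<le> 2 * k * \<delta> + \<delta>\<^sup>2" .
  define r where "r = norm q"
  have r: "r = \<epsilon> * t" "r > 0" using q e by (auto simp: r_def)
  have "(norm ((k / r) *\<^sub>R q - a))\<^sup>2 = (k / r)\<^sup>2 * r\<^sup>2 - 2 * (k / r) * (a \<bullet> q) + (norm a)\<^sup>2"
    unfolding r_def power2_norm_eq_inner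
      by (simp add: inner_diff_left inner_diff_right inner_commute power2_eq_square)
  also have "(k / r)\<^sup>2 * r\<^sup>2 = k\<^sup>2" using r(2) by (simp add: power_divide)
  also have "2 * (k / r) * (a \<bullet> q) = 2 * k * c / \<epsilon>" unfolding aq r(1) using e by simp
  also have "k\<^sup>2 - 2 * k * c / \<epsilon> + (norm a)\<^sup>2 = k * (2 * (k * \<epsilon> - c)) / \<epsilon>"
    unfolding k(1) using e by (simp add: field_simps power2_eq_square)
  also have "\<dots> \<le> k * (2 * k * \<delta> + \<delta>\<^sup>2) / \<epsilon>" using c k e by (intro divide_right_mono mult_left_mono) auto
  finally show ?thesis by (simp add: r_def)
qed

text \<open>The path from 0 to \<open>p\<close> through the midpoint displaced by \<open>w\<close>
  is nearly as short as the segment, so \<open>w\<close> is controlled by the square root of the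
  excess. The condition on \<open>p \<bullet> w\<close> excludes short displacements along
  \<open>p\<close>, which cost nothing.\<close>

lemma midpoint_deviation:
  fixes p w :: "'w::real_inner"
  assumes p: "p \<noteq> 0" and le: "norm ((1/2) *\<^sub>R p + w) + norm ((1/2) *\<^sub>R p - w) \<le> norm p + \<delta>"
    and pw: "\<bar>p \<bullet> w\<bar> \<le> norm p * norm w / 2"
  shows "(norm w)\<^sup>2 \<le> 2 * norm p * \<delta> + \<delta>\<^sup>2"
proof -
  define u v P where "u = norm ((1/2) *\<^sub>R p + w)" and "v = norm ((1/2) *\<^sub>R p - w)" and "P = norm p"
  have P: "P > 0" using p by (simp add: P_def)
  have u2: "u\<^sup>2 = P\<^sup>2 / 4 + p \<bullet> w + (norm w)\<^sup>2" and v2: "v\<^sup>2 = P\<^sup>2 / 4 - p \<bullet> w + (norm w)\<^sup>2"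
    unfolding u_def v_def P_def power2_norm_eq_inner
    by (simp_all add: inner_add_left inner_add_right inner_diff_left inner_diff_right inner_commute)
  have uvP: "P \<le> u + v"
  proof -
    have "p = ((1/2) *\<^sub>R p + w) + ((1/2) *\<^sub>R p - w)" by (simp flip: scaleR_left_distrib)
    then show ?thesis unfolding P_def u_def v_def using norm_triangle_ineq[of "(1/2) *\<^sub>R p + w" "(1/2) *\<^sub>R p - w"]
      by (simp only:)
  qed
  have "(u - v)\<^sup>2 * P\<^sup>2 \<le> (u - v)\<^sup>2 * (u + v)\<^sup>2" using uvP P by (intro mult_left_mono power_mono) auto
  also have "\<dots> = (u\<^sup>2 - v\<^sup>2)\<^sup>2" by (simp add: power2_eq_square algebra_simps)
  also have "u\<^sup>2 - v\<^sup>2 = 2 * (p \<bullet> w)" unfolding u2 v2 by simp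
  also have "(2 * (p \<bullet> w))\<^sup>2 = 4 * \<bar>p \<bullet> w\<bar>\<^sup>2" by (simp add: power2_eq_square)
  also have "\<dots> \<le> 4 * (P * norm w / 2)\<^sup>2" using pw unfolding P_def by (intro mult_left_mono power_mono) auto
  also have "\<dots> = (norm w)\<^sup>2 * P\<^sup>2" by (simp add: power2_eq_square)
  finally have uv: "(u - v)\<^sup>2 \<le> (norm w)\<^sup>2" using P by simp
  \<comment> \<open>Parallelogram law; the term \<open>(u - v)\<^sup>2\<close> takes back at most
    one of the four copies of \<open>(norm w)\<^sup>2\<close>.\<close>
  have "P\<^sup>2 + 4 * (norm w)\<^sup>2 = (u + v)\<^sup>2 + (u - v)\<^sup>2" using u2 v2 by (simp add: power2_sum power2_diff)
  also have "(u + v)\<^sup>2 \<le> (P + \<delta>)\<^sup>2" using le P uvP unfolding u_def v_def P_def by (intro power_mono) auto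
  finally have "3 * (norm w)\<^sup>2 \<le> 2 * P * \<delta> + \<delta>\<^sup>2" using uv by (simp add: power2_sum)
  moreover have "0 \<le> (norm w)\<^sup>2" by simp
  ultimately show ?thesis unfolding P_def by linarith
qed

text \<open>\<open>d_intermediate\<close> replaces the existence of nearly minimizing curves: such a curve from \<open>x\<close> to \<open>y\<close> meets
  every level of \<open>F\<close> between \<open>F x\<close> and \<open>F y\<close>.\<close>

locale asymptotic_geometry =
  fixes d :: "'w::euclidean_space \<Rightarrow> 'w \<Rightarrow> real" and k :: real
  assumes k: "k > 0"
    and d_sym: "d x y = d y x"
    and d_triangle: "d x z \<le> d x y + d y z"
    and d_ge: "k * norm (x - y) \<le> d x y"
    and d_intermediate: "\<And>(F :: 'w \<Rightarrow> real) \<epsilon> x y l. continuous_on UNIV F \<Longrightarrow> \<epsilon> > 0 \<Longrightarrow> F x < l \<and> l < F y \<or> F y < l \<and> l < F x \<Longrightarrow>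
      \<exists>p. F p = l \<and> d x p + d p y \<le> d x y + \<epsilon>"
begin

text \<open>\<open>cone_bounds a\<close> bounds \<open>d\<close> by the cost of segments in a cone around the half-line of \<open>a\<close>, on which the
  potential is at most a multiple of \<open>1 / t\<close> at distance of order \<open>t\<close>.\<close>

definition cone_bounds :: "'w \<Rightarrow> real \<Rightarrow> real \<Rightarrow> bool" where
  "cone_bounds a \<kappa> C \<longleftrightarrow> \<kappa> > 0 \<and> C \<ge> 0 \<and>
    (\<forall>t x y. t > 0 \<longrightarrow> x \<noteq> y \<longrightarrow> norm (x - t *\<^sub>R a) \<le> \<kappa> * t \<longrightarrow> norm (y - t *\<^sub>R a) \<le> \<kappa> * t \<longrightarrow>
      d x y \<le> k * norm (x - y) + C * norm (x - y) / t) \<and>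
    (\<forall>\<alpha> \<beta> x y. 0 < \<alpha> \<longrightarrow> \<alpha> < \<beta> \<longrightarrow> x \<noteq> y \<longrightarrow> norm (x - \<alpha> *\<^sub>R a) \<le> \<kappa> * \<alpha> \<longrightarrow> norm (y - \<beta> *\<^sub>R a) \<le> \<kappa> * \<beta> \<longrightarrow>
      d x y \<le> k * norm (x - y) + C * (norm (x - y) / (\<beta> - \<alpha>)) * ln (\<beta> / \<alpha>))"

text \<open>The properties of a geodesic ray that the metric argument consumes. The rate
  \<open>k\<^sup>2\<close> in the last one is the speed \<open>k\<close> times the least cost
  \<open>k\<close> per unit length.\<close>

definition ray :: "(real \<Rightarrow> 'w) \<Rightarrow> real \<Rightarrow> 'w \<Rightarrow> bool" where
  "ray \<gamma> t0 a \<longleftrightarrow> norm a = k \<and> (\<exists>\<kappa> C. cone_bounds a \<kappa> C) \<and>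
    (\<forall>s t. t0 < s \<longrightarrow> s < t \<longrightarrow> d (\<gamma> t0) (\<gamma> t) = d (\<gamma> t0) (\<gamma> s) + d (\<gamma> s) (\<gamma> t)) \<and>
    (\<forall>\<epsilon>>0. \<forall>\<^sub>F t in at_top. norm (\<gamma> t - t *\<^sub>R a) \<le> \<epsilon> * t) \<and>
    (\<forall>\<epsilon>>0. \<forall>\<^sub>F t in at_top. d (\<gamma> t0) (\<gamma> t) \<le> (k\<^sup>2 + \<epsilon>) * t)"

definition bus :: "(real \<Rightarrow> 'w) \<Rightarrow> real \<Rightarrow> 'w \<Rightarrow> real" where
  "bus \<gamma> t0 x = Lim at_top (\<lambda>t. d x (\<gamma> t) - d (\<gamma> t) (\<gamma> t0))"

lemma d_nonneg: "d x y \<ge> 0"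
  by (rule order_trans[OF mult_nonneg_nonneg d_ge]) (use k in auto)

lemma rayD:
  assumes "ray \<gamma> t0 a"
  shows "norm a = k" "\<exists>\<kappa> C. cone_bounds a \<kappa> C"
    "\<And>s t. t0 < s \<Longrightarrow> s < t \<Longrightarrow> d (\<gamma> t0) (\<gamma> t) = d (\<gamma> t0) (\<gamma> s) + d (\<gamma> s) (\<gamma> t)"
    "\<And>\<epsilon>. \<epsilon> > 0 \<Longrightarrow> \<forall>\<^sub>F t in at_top. norm (\<gamma> t - t *\<^sub>R a) \<le> \<epsilon> * t"
    "\<And>\<epsilon>. \<epsilon> > 0 \<Longrightarrow> \<forall>\<^sub>F t in at_top. d (\<gamma> t0) (\<gamma> t) \<le> (k\<^sup>2 + \<epsilon>) * t"
  using assms unfolding ray_def by blast+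

text \<open>Additivity along the ray makes the expression nonincreasing for \<open>t > t0\<close>,
  and the triangle inequality bounds it from below; so \<open>Lim\<close> in the definition denotes
  a genuine limit.\<close>

lemma bus_tendsto:
  assumes "ray \<gamma> t0 a"
  shows "((\<lambda>t. d x (\<gamma> t) - d (\<gamma> t) (\<gamma> t0)) \<longlongrightarrow> bus \<gamma> t0 x) at_top"
proof -
  define f where "f t = d x (\<gamma> t) - d (\<gamma> t) (\<gamma> t0)" for t
  define l where "l = Inf (f ` {t0<..})"
  have mono: "f t \<le> f s" if "t0 < s" "s \<le> t" for s t
  proof (cases "s = t")
    case False
    then have "d (\<gamma> t0) (\<gamma> t) = d (\<gamma> t0) (\<gamma> s) + d (\<gamma> s) (\<gamma> t)" using that by (intro rayD(3)[OF assms]) auto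
    then show ?thesis using d_triangle[of x "\<gamma> t" "\<gamma> s"] d_sym[of "\<gamma> t" "\<gamma> t0"] d_sym[of "\<gamma> s" "\<gamma> t0"] unfolding f_def
      by linarith
  qed simp
  have lb: "- d x (\<gamma> t0) \<le> f t" for t
    using d_triangle[of "\<gamma> t" "\<gamma> t0" x] d_sym[of "\<gamma> t" x] unfolding f_def by linarith
  have bdd: "bdd_below (f ` {t0<..})" by (rule bdd_belowI2[where m = "- d x (\<gamma> t0)"]) (rule lb)
  have "(f \<longlongrightarrow> l) at_top"
  proof (rule order_tendstoI)
    fix a assume a: "a < l"
    show "\<forall>\<^sub>F t in at_top. a < f t" using eventually_gt_at_top[of t0]
    proof (rule eventually_mono)
      fix t assume "t0 < t"
      then have "l \<le> f t" unfolding l_def by (intro cInf_lower[OF _ bdd]) auto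
      then show "a < f t" using a by simp
    qed
  next
    fix a assume "l < a"
    then obtain s where s: "s > t0" "f s < a" unfolding l_def using cInf_less_iff[OF _ bdd, of a] by auto
    show "\<forall>\<^sub>F t in at_top. f t < a" using eventually_ge_at_top[of s]
    proof (rule eventually_mono)
      fix t assume "s \<le> t"
      then show "f t < a" using mono[OF s(1)] s(2) by (meson le_less_trans)
    qed
  qed
  moreover from this have "bus \<gamma> t0 x = l" unfolding bus_def f_def[symmetric] by (intro tendsto_Lim) auto
  ultimately show ?thesis unfolding f_def by simp
qed

lemma bus_le:
  assumes "ray \<gamma> t0 a" shows "bus \<gamma> t0 x \<le> d x y + bus \<gamma> t0 y"
proof -
  have "((\<lambda>t. d x y + (d y (\<gamma> t) - d (\<gamma> t) (\<gamma> t0))) \<longlongrightarrow> d x y + bus \<gamma> t0 y) at_top"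
    by (intro tendsto_add tendsto_const bus_tendsto[OF assms])
  moreover have "\<forall>\<^sub>F t in at_top. d x (\<gamma> t) - d (\<gamma> t) (\<gamma> t0) \<le> d x y + (d y (\<gamma> t) - d (\<gamma> t) (\<gamma> t0))"
    using d_triangle[of x _ y] by (intro always_eventually allI) (simp add: algebra_simps)
  ultimately show ?thesis by (intro tendsto_le[OF trivial_limit_at_top_linorder _ bus_tendsto[OF assms]])
qed

text \<open>By additivity the expression under the limit is constant as soon as
  \<open>t > s\<close>.\<close>

lemma bus_ray:
  assumes "ray \<gamma> t0 a" "s > t0" shows "bus \<gamma> t0 (\<gamma> s) = - d (\<gamma> t0) (\<gamma> s)"
proof -
  have "\<forall>\<^sub>F t in at_top. d (\<gamma> s) (\<gamma> t) - d (\<gamma> t) (\<gamma> t0) = - d (\<gamma> t0) (\<gamma> s)"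
    using eventually_gt_at_top[of s]
  proof (rule eventually_mono)
    fix t assume "s < t"
    from rayD(3)[OF assms this] show "d (\<gamma> s) (\<gamma> t) - d (\<gamma> t) (\<gamma> t0) = - d (\<gamma> t0) (\<gamma> s)"
      using d_sym[of "\<gamma> t" "\<gamma> t0"] by linarith
  qed
  then have "((\<lambda>t. d (\<gamma> s) (\<gamma> t) - d (\<gamma> t) (\<gamma> t0)) \<longlongrightarrow> - d (\<gamma> t0) (\<gamma> s)) at_top" by (rule tendsto_eventually)
  from tendsto_unique[OF trivial_limit_at_top_linorder bus_tendsto[OF assms(1)] this] show ?thesis .
qed

end

section \<open>Equal limit shapes: first variation of the distance far out\<close>

context asymptotic_geometry begin

text \<open>A nearly minimizing curve from \<open>x\<close> to \<open>\<gamma> t\<close> arrives in the direction of \<open>a\<close>. Hence the distance from \<open>x\<close>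
  varies like a linear form near \<open>\<gamma> t\<close>, with a limit form that does not depend on \<open>x\<close>.\<close>

lemma d_first_variation:
  assumes ray: "ray \<gamma> t0 a" and y: "\<forall>\<^sub>F t in at_top. norm (y t - \<gamma> t) \<le> B" and eta: "\<eta> > 0"
  shows "\<forall>\<^sub>F t in at_top. d x (y t) - d x (\<gamma> t) \<le> a \<bullet> (y t - \<gamma> t) + \<eta>"
proof -
  obtain \<kappa> C where cone: "cone_bounds a \<kappa> C" using rayD(2)[OF ray] by blast
  then have \<kappa>: "\<kappa> > 0" and C: "C \<ge> 0" by (auto simp: cone_bounds_def)
  have na: "norm a = k" by (rule rayD(1)[OF ray])
  define B' where "B' = max B 1"
  have B': "B' \<ge> 1" "B \<le> B'" by (auto simp: B'_def)
  \<comment> \<open>Relative radius of the sphere around \<open>\<gamma> t\<close> on which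
    \<open>p\<close> is taken: small enough to stay in the cone, to leave \<open>x\<close> outside
    the sphere, and to keep the potential cost \<open>2 * C * \<epsilon>\<close> of the last piece
    within \<open>\<eta> / 4\<close>.\<close>
  define \<epsilon> where "\<epsilon> = min (min (\<kappa> / 2) (k / 4)) (\<eta> / (8 * (C + 1)))"
  have \<epsilon>0: "\<epsilon> > 0" using \<kappa> eta C k by (auto simp: \<epsilon>_def)
  have "\<epsilon> \<le> \<kappa> / 2" "\<epsilon> \<le> k / 4" "\<epsilon> \<le> \<eta> / (8 * (C + 1))"
    unfolding \<epsilon>_def by (meson min.cobounded1 min.cobounded2 order_trans)+
  then have \<epsilon>1: "2 * \<epsilon> \<le> \<kappa>" "\<epsilon> \<le> k / 4" "\<epsilon> \<le> \<eta> / (8 * (C + 1))" by linarith+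
  have "C * \<epsilon> \<le> (C + 1) * \<epsilon>" using \<epsilon>0 by simp
  also have "\<dots> \<le> (C + 1) * (\<eta> / (8 * (C + 1)))" using C \<epsilon>1 by (intro mult_left_mono) auto
  also have "\<dots> = \<eta> / 8" using C by (simp add: field_simps)
  finally have \<epsilon>2: "2 * C * \<epsilon> \<le> \<eta> / 4" by simp
  \<comment> \<open>Chosen so that \<open>direction_close\<close> gives a deviation of at most
    \<open>\<eta> / (8 * B')\<close>, which paired with \<open>norm z \<le> B'\<close> costs at most
    \<open>\<eta> / 8\<close>.\<close>
  define \<delta>' where "\<delta>' = min 1 (\<epsilon> * (\<eta> / (8 * B'))\<^sup>2 / (k * (2 * k + 1)))"
  have \<delta>': "\<delta>' > 0" using \<epsilon>0 eta B' k by (auto simp: \<delta>'_def)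
  have \<delta>'1: "\<delta>' \<le> 1" "\<delta>' \<le> \<epsilon> * (\<eta> / (8 * B'))\<^sup>2 / (k * (2 * k + 1))" unfolding \<delta>'_def by simp_all
  have \<delta>'2: "k * (2 * k * \<delta>' + \<delta>'\<^sup>2) / \<epsilon> \<le> (\<eta> / (8 * B'))\<^sup>2"
  proof -
    have "\<delta>'\<^sup>2 \<le> \<delta>'" using \<delta>' \<delta>'1 by (simp add: power2_eq_square mult_left_le)
    then have "k * (2 * k * \<delta>' + \<delta>'\<^sup>2) \<le> k * (2 * k * \<delta>' + \<delta>')" using k by (intro mult_left_mono) auto
    also have "\<dots> = k * (2 * k + 1) * \<delta>'" by (simp add: algebra_simps)
    also have "\<dots> \<le> k * (2 * k + 1) * (\<epsilon> * (\<eta> / (8 * B'))\<^sup>2 / (k * (2 * k + 1)))"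
      using k by (intro mult_left_mono \<delta>'1) auto
    also have "\<dots> = \<epsilon> * (\<eta> / (8 * B'))\<^sup>2"
    proof -
      have "k * (2 * k + 1) > 0" using k by (intro mult_pos_pos) auto
      then show ?thesis unfolding times_divide_eq_right by (intro nonzero_mult_div_cancel_left) linarith
    qed
    finally show ?thesis using \<epsilon>0 by (simp add: pos_divide_le_eq mult.commute)
  qed
  \<comment> \<open>The errors in the estimate of \<open>k * norm (t *\<^sub>R a - q)\<close> add up
    to \<open>(3 * \<delta> + 2 * k * \<delta>) * t\<close>, which has to be
    \<open>k * \<delta>' * t\<close>.\<close>
  define \<delta> where "\<delta> = k * \<delta>' / (3 + 2 * k)"
  have \<delta>: "\<delta> > 0" using k \<delta>' by (simp add: \<delta>_def)
  have "3 * \<delta> + 2 * k * \<delta> = (3 + 2 * k) * \<delta>" by (simp add: algebra_simps)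
  also have "\<dots> = k * \<delta>'" using k by (simp add: \<delta>_def)
  finally have \<delta>2: "3 * \<delta> + 2 * k * \<delta> = k * \<delta>'" .
  define M where "M = d x (\<gamma> t0) / \<delta> + norm x / \<delta> + norm x * 4 / k + \<eta> / \<delta> + 2 * B' / \<epsilon> + 8 * k * B'\<^sup>2 / (\<epsilon> * \<eta>)"
  have nn: "0 \<le> d x (\<gamma> t0) / \<delta>" "0 \<le> norm x / \<delta>" "0 \<le> norm x * 4 / k" "0 \<le> \<eta> / \<delta>" "0 \<le> 2 * B' / \<epsilon>" "0 \<le> 8 * k * B'\<^sup>2 / (\<epsilon> * \<eta>)"
    using d_nonneg[of x "\<gamma> t0"] \<delta> \<epsilon>0 eta B' k by auto
  have k4: "k / 4 > 0" using k by simp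
  have "\<forall>\<^sub>F t in at_top. norm (y t - \<gamma> t) \<le> B \<and> norm (\<gamma> t - t *\<^sub>R a) \<le> \<epsilon> * t \<and> norm (\<gamma> t - t *\<^sub>R a) \<le> \<delta> * t \<and>
     norm (\<gamma> t - t *\<^sub>R a) \<le> k / 4 * t \<and> d (\<gamma> t0) (\<gamma> t) \<le> (k\<^sup>2 + \<delta>) * t \<and> t > M"
    by (intro eventually_conj y rayD(4)[OF ray \<epsilon>0] rayD(4)[OF ray \<delta>] rayD(4)[OF ray k4] rayD(5)[OF ray \<delta>] eventually_gt_at_top)
  then show ?thesis
  proof (rule eventually_mono, elim conjE)
    fix t assume t1: "norm (y t - \<gamma> t) \<le> B" and t2: "norm (\<gamma> t - t *\<^sub>R a) \<le> \<epsilon> * t"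
      and t3: "norm (\<gamma> t - t *\<^sub>R a) \<le> \<delta> * t"
      and t3': "norm (\<gamma> t - t *\<^sub>R a) \<le> k / 4 * t" and t4: "d (\<gamma> t0) (\<gamma> t) \<le> (k\<^sup>2 + \<delta>) * t" and t5: "t > M"
    have t: "t > 0" "d x (\<gamma> t0) / \<delta> \<le> t" "norm x / \<delta> \<le> t" "norm x * 4 / k \<le> t" "\<eta> / \<delta> \<le> t" "2 * B' / \<epsilon> \<le> t" "8 * k * B'\<^sup>2 / (\<epsilon> * \<eta>) \<le> t"
      using t5 nn unfolding M_def by linarith+
    have \<epsilon>t: "\<epsilon> * t > 0" using \<epsilon>0 t by simp
    have t': "d x (\<gamma> t0) \<le> \<delta> * t" "norm x \<le> \<delta> * t" "norm x \<le> k / 4 * t" "\<eta> \<le> \<delta> * t" "2 * B' \<le> \<epsilon> * t"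
      using t \<delta> \<epsilon>0 k by (simp_all add: pos_divide_le_eq mult.commute)
    have t6: "k * B'\<^sup>2 / (2 * (\<epsilon> * t)) \<le> \<eta> / 16"
    proof -
      have "8 * k * B'\<^sup>2 \<le> t * (\<epsilon> * \<eta>)" using t(7) \<epsilon>0 eta by (simp add: pos_divide_le_eq)
      moreover have "\<eta> / 16 * (2 * (\<epsilon> * t)) = t * (\<epsilon> * \<eta>) / 8" by (simp add: mult_ac)
      ultimately have "k * B'\<^sup>2 \<le> \<eta> / 16 * (2 * (\<epsilon> * t))" by linarith
      moreover have "0 < 2 * (\<epsilon> * t)" using \<epsilon>t by simp
      ultimately show ?thesis by (simp only: pos_divide_le_eq)
    qed
    define z where "z = y t - \<gamma> t"
    have z: "norm z \<le> B'" using t1 B' by (simp add: z_def)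
    have kt: "norm (t *\<^sub>R a) = k * t" using na t by simp
    have "norm (t *\<^sub>R a) \<le> norm (x - \<gamma> t) + norm (\<gamma> t - t *\<^sub>R a) + norm x"
      using norm_triangle_ineq4[of "x - (x - \<gamma> t)" "\<gamma> t - t *\<^sub>R a"] norm_triangle_ineq4[of x "x - \<gamma> t"] by simp
    then have xg: "\<epsilon> * t < norm (x - \<gamma> t)"
      using t'(3) t3' mult_right_mono[OF \<epsilon>1(2), of t] t(1) mult_pos_pos[OF k t(1)] unfolding kt by linarith
    have "continuous_on UNIV (\<lambda>p. norm (p - \<gamma> t))" by (intro continuous_intros)
    \<comment> \<open>\<open>p\<close> lies on an almost minimizing path from \<open>x\<close>, at
      distance \<open>\<epsilon> * t\<close> from its end. The competitor for \<open>y t\<close>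
      follows that path up to \<open>p\<close> and then a straight segment in the cone.\<close>
    from d_intermediate[OF this, of "\<eta> / 4" "\<gamma> t" "\<epsilon> * t" x] xg eta \<epsilon>t
    obtain p where p: "norm (p - \<gamma> t) = \<epsilon> * t" "d (\<gamma> t) p + d p x \<le> d (\<gamma> t) x + \<eta> / 4" by auto
    define q where "q = \<gamma> t - p"
    have q: "norm q = \<epsilon> * t" using p(1) unfolding q_def by (simp add: norm_minus_commute)
    have q0: "q \<noteq> 0" using q \<epsilon>t by auto
    have dx: "d x p + d p (\<gamma> t) \<le> d x (\<gamma> t) + \<eta> / 4"
      using p(2) d_sym[of "\<gamma> t" p] d_sym[of p x] d_sym[of "\<gamma> t" x] by linarith
    have dxg: "d x (\<gamma> t) \<le> (k\<^sup>2 + 2 * \<delta>) * t" using d_triangle[of x "\<gamma> t" "\<gamma> t0"] t'(1) t4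
      by (simp add: algebra_simps)
    have pg: "k * norm q \<le> d p (\<gamma> t)" using d_ge[of p "\<gamma> t"] by (simp add: q_def norm_minus_commute)
    have "norm (t *\<^sub>R a - q) \<le> norm (x - p) + norm x + norm (\<gamma> t - t *\<^sub>R a)"
    proof -
      have "t *\<^sub>R a - q = - ((x - p) - x) - (\<gamma> t - t *\<^sub>R a)" by (simp add: q_def)
      then have "norm (t *\<^sub>R a - q) \<le> norm (- ((x - p) - x)) + norm (\<gamma> t - t *\<^sub>R a)" by (metis norm_triangle_ineq4)
      then show ?thesis using norm_triangle_ineq4[of "x - p" x] unfolding norm_minus_cancel by linarith
    qed
    then have "k * norm (t *\<^sub>R a - q) \<le> k * (norm (x - p) + \<delta> * t + \<delta> * t)" using k t3 t'(2)
      by (intro mult_left_mono) auto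
    also have "\<dots> = k * norm (x - p) + 2 * k * \<delta> * t" by (simp add: algebra_simps)
    also have "\<dots> \<le> (k\<^sup>2 + 2 * \<delta>) * t + \<delta> * t - k * (\<epsilon> * t) + 2 * k * \<delta> * t"
      using dx dxg pg t'(4) d_ge[of x p] eta unfolding q by linarith
    also have "\<dots> = (k\<^sup>2 + (3 * \<delta> + 2 * k * \<delta>) - k * \<epsilon>) * t" by (simp add: algebra_simps)
    also have "\<dots> = k * ((k - \<epsilon> + \<delta>') * t)" unfolding \<delta>2 by (simp add: algebra_simps power2_eq_square)
    finally have "norm (t *\<^sub>R a - q) \<le> (k - \<epsilon> + \<delta>') * t" using k by simp
    from direction_close[OF na k \<epsilon>0 t(1) less_imp_le[OF \<delta>'] q this]
    have "(norm ((k / norm q) *\<^sub>R q - a))\<^sup>2 \<le> (\<eta> / (8 * B'))\<^sup>2" using \<delta>'2 by (rule order_trans)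
    then have dir: "norm ((k / norm q) *\<^sub>R q - a) \<le> \<eta> / (8 * B')" by (rule power2_le_imp_le) (use eta B' in auto)
    have "((k / norm q) *\<^sub>R q - a) \<bullet> z \<le> norm ((k / norm q) *\<^sub>R q - a) * norm z" by (rule norm_cauchy_schwarz)
    also have "\<dots> \<le> \<eta> / (8 * B') * B'" by (rule mult_mono[OF dir z]) (use eta B' in auto)
    also have "\<dots> = \<eta> / 8" using B' by simp
    finally have "k / norm q * (q \<bullet> z) - a \<bullet> z \<le> \<eta> / 8" unfolding inner_diff_left inner_scaleR_left .
    then have dirz: "k * (q \<bullet> z) / norm q \<le> a \<bullet> z + \<eta> / 8" unfolding times_divide_eq_left by linarith
    have "norm (q + z) \<le> norm q + (q \<bullet> z) / norm q + (norm z)\<^sup>2 / (2 * norm q)" by (rule norm_add_le_linear[OF q0])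
    then have "k * norm (q + z) \<le> k * (norm q + (q \<bullet> z) / norm q + (norm z)\<^sup>2 / (2 * norm q))" using k
      by (intro mult_left_mono) auto
    also have "\<dots> = k * norm q + k * (q \<bullet> z) / norm q + k * (norm z)\<^sup>2 / (2 * norm q)" by (simp add: distrib_left)
    also have "k * (norm z)\<^sup>2 / (2 * norm q) \<le> k * B'\<^sup>2 / (2 * (\<epsilon> * t))"
      unfolding q using z k \<epsilon>t by (intro divide_right_mono mult_left_mono power_mono) auto
    finally have kqz: "k * norm (q + z) \<le> k * norm q + a \<bullet> z + \<eta> / 4" using dirz t6 eta by linarith
    have py: "p - y t = - (q + z)" by (simp add: q_def z_def)
    have zq: "norm z < norm q" using z t'(5) B' unfolding q by linarith
    have pny: "p \<noteq> y t"
    proof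
      assume "p = y t"
      then have "q + z = 0" using py by (metis neg_equal_0_iff_equal right_minus_eq)
      then have "norm z = norm q" by (metis add.commute add_eq_0_iff norm_minus_cancel)
      then show False using zq by simp
    qed
    have B't: "B' \<le> \<epsilon> * t" using t'(5) B' by linarith
    have "p - t *\<^sub>R a = (\<gamma> t - t *\<^sub>R a) - q" by (simp add: q_def)
    then have "norm (p - t *\<^sub>R a) \<le> norm (\<gamma> t - t *\<^sub>R a) + norm q" by (metis norm_triangle_ineq4)
    then have pc: "norm (p - t *\<^sub>R a) \<le> \<kappa> * t" using t2 q mult_right_mono[OF \<epsilon>1(1), of t] t(1) by linarith
    have "y t - t *\<^sub>R a = z + (\<gamma> t - t *\<^sub>R a)" by (simp add: z_def)
    then have "norm (y t - t *\<^sub>R a) \<le> norm z + norm (\<gamma> t - t *\<^sub>R a)" by (metis norm_triangle_ineq)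
    then have yc: "norm (y t - t *\<^sub>R a) \<le> \<kappa> * t" using t2 z B't mult_right_mono[OF \<epsilon>1(1), of t] t(1) by linarith
    have "d p (y t) \<le> k * norm (p - y t) + C * norm (p - y t) / t"
      using cone t(1) pny pc yc unfolding cone_bounds_def by blast
    moreover have "C * norm (p - y t) / t \<le> \<eta> / 4"
    proof -
      have "norm (p - y t) \<le> 2 * (\<epsilon> * t)" using norm_triangle_ineq[of q z] z B't q unfolding py norm_minus_cancel
        by linarith
      then have "C * norm (p - y t) \<le> C * (2 * (\<epsilon> * t))" using C by (rule mult_left_mono)
      also have "\<dots> = (2 * C * \<epsilon>) * t" by simp
      also have "\<dots> \<le> \<eta> / 4 * t" using t(1) by (intro mult_right_mono \<epsilon>2) auto
      finally show ?thesis using t(1) by (simp only: pos_divide_le_eq)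
    qed
    moreover have "k * norm (p - y t) = k * norm (q + z)" unfolding py norm_minus_cancel ..
    ultimately have "d p (y t) \<le> k * norm q + a \<bullet> z + \<eta> / 2" using kqz by linarith
    then show "d x (y t) - d x (\<gamma> t) \<le> a \<bullet> (y t - \<gamma> t) + \<eta>"
      using d_triangle[of x "y t" p] dx pg eta unfolding z_def[symmetric] by linarith
  qed
qed

text \<open>The first variation is applied twice, with the rays exchanged, which bounds
  \<open>D x\<close> from both sides. In the difference of the values at \<open>x\<close> and at the
  reference point 0 the linear form and the base points cancel, leaving
  \<open>D x t - D 0 t\<close>.\<close>

lemma bus_differ_by_constant:
  assumes r1: "ray \<gamma>1 t1 a" and r2: "ray \<gamma>2 t2 a" and B: "\<forall>\<^sub>F t in at_top. norm (\<gamma>1 t - \<gamma>2 t) \<le> B"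
  shows "\<exists>c. \<forall>x. bus \<gamma>1 t1 x = bus \<gamma>2 t2 x + c"
proof -
  have B': "\<forall>\<^sub>F t in at_top. norm (\<gamma>2 t - \<gamma>1 t) \<le> B" using B by (simp only: norm_minus_commute)
  define D where "D x t = d x (\<gamma>1 t) - d x (\<gamma>2 t) - a \<bullet> (\<gamma>1 t - \<gamma>2 t)" for x t
  have D0: "(D x \<longlongrightarrow> 0) at_top" for x
  proof (rule tendstoI)
    fix e :: real assume e: "e > 0"
    then have e2: "e / 2 > 0" by simp
    show "\<forall>\<^sub>F t in at_top. dist (D x t) 0 < e"
      using d_first_variation[OF r2 B e2, of x] d_first_variation[OF r1 B' e2, of x]
    proof eventually_elim
      case (elim t)
      have "a \<bullet> (\<gamma>2 t - \<gamma>1 t) = - (a \<bullet> (\<gamma>1 t - \<gamma>2 t))" by (simp add: inner_diff_right)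
      with elim e have "D x t < e" "- D x t < e" unfolding D_def by linarith+
      then show ?case by (simp add: dist_real_def abs_less_iff)
    qed
  qed
  have "bus \<gamma>1 t1 x - bus \<gamma>2 t2 x - (bus \<gamma>1 t1 0 - bus \<gamma>2 t2 0) = 0" for x
  proof (rule tendsto_unique[OF trivial_limit_at_top_linorder])
    show "((\<lambda>t. (d x (\<gamma>1 t) - d (\<gamma>1 t) (\<gamma>1 t1)) - (d x (\<gamma>2 t) - d (\<gamma>2 t) (\<gamma>2 t2)) -
        ((d 0 (\<gamma>1 t) - d (\<gamma>1 t) (\<gamma>1 t1)) - (d 0 (\<gamma>2 t) - d (\<gamma>2 t) (\<gamma>2 t2))))
       \<longlongrightarrow> bus \<gamma>1 t1 x - bus \<gamma>2 t2 x - (bus \<gamma>1 t1 0 - bus \<gamma>2 t2 0)) at_top"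
      by (intro tendsto_diff bus_tendsto[OF r1] bus_tendsto[OF r2])
    have "((\<lambda>t. D x t - D 0 t) \<longlongrightarrow> 0 - 0) at_top" by (intro tendsto_diff D0)
    moreover have "(\<lambda>t. (d x (\<gamma>1 t) - d (\<gamma>1 t) (\<gamma>1 t1)) - (d x (\<gamma>2 t) - d (\<gamma>2 t) (\<gamma>2 t2)) -
        ((d 0 (\<gamma>1 t) - d (\<gamma>1 t) (\<gamma>1 t1)) - (d 0 (\<gamma>2 t) - d (\<gamma>2 t) (\<gamma>2 t2)))) = (\<lambda>t. D x t - D 0 t)"
      by (rule ext) (simp add: D_def)
    ultimately show "((\<lambda>t. (d x (\<gamma>1 t) - d (\<gamma>1 t) (\<gamma>1 t1)) - (d x (\<gamma>2 t) - d (\<gamma>2 t) (\<gamma>2 t2)) -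
        ((d 0 (\<gamma>1 t) - d (\<gamma>1 t) (\<gamma>1 t1)) - (d 0 (\<gamma>2 t) - d (\<gamma>2 t) (\<gamma>2 t2)))) \<longlongrightarrow> 0) at_top" by simp
  qed
  then show ?thesis by (intro exI[of _ "bus \<gamma>1 t1 0 - bus \<gamma>2 t2 0"] allI) (simp add: algebra_simps)
qed

end

section \<open>Different limit shapes: descent through dyadic scales\<close>

context asymptotic_geometry begin

lemma cone_bounds_mono:
  assumes "cone_bounds a \<kappa> C" "0 < \<kappa>'" "\<kappa>' \<le> \<kappa>" shows "cone_bounds a \<kappa>' C"
proof -
  have le: "n \<le> \<kappa> * t" if "n \<le> \<kappa>' * t" "t > 0" for n t
    using that mult_right_mono[OF assms(3), of t] by linarith
  show ?thesis unfolding cone_bounds_def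
  proof (intro conjI allI impI)
    show "C \<ge> 0" using assms(1) by (simp add: cone_bounds_def)
    show "\<kappa>' > 0" by (rule assms(2))
  next
    fix t x y assume *: "t > 0" "x \<noteq> y" "norm (x - t *\<^sub>R a) \<le> \<kappa>' * t" "norm (y - t *\<^sub>R a) \<le> \<kappa>' * t"
    have "norm (x - t *\<^sub>R a) \<le> \<kappa> * t" "norm (y - t *\<^sub>R a) \<le> \<kappa> * t" using * le by blast+
    with * assms(1) show "d x y \<le> k * norm (x - y) + C * norm (x - y) / t" unfolding cone_bounds_def by blast
  next
    fix \<alpha> \<beta> x y assume *: "0 < \<alpha>" "\<alpha> < \<beta>" "x \<noteq> y" "norm (x - \<alpha> *\<^sub>R a) \<le> \<kappa>' * \<alpha>" "norm (y - \<beta> *\<^sub>R a) \<le> \<kappa>' * \<beta>"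
    have "norm (x - \<alpha> *\<^sub>R a) \<le> \<kappa> * \<alpha>" using *(1,4) le by blast
    moreover have "norm (y - \<beta> *\<^sub>R a) \<le> \<kappa> * \<beta>" using *(1,2,5) le by (meson less_trans)
    ultimately show "d x y \<le> k * norm (x - y) + C * (norm (x - y) / (\<beta> - \<alpha>)) * ln (\<beta> / \<alpha>)"
      using * assms(1) unfolding cone_bounds_def by blast
  qed
qed

text \<open>The logarithm in the cone bound is weakened to a square root, the form in which errors
  enter the halving step. The separation \<open>2 * s \<le> \<xi>\<close> of the scales makes
  \<open>norm (y - p)\<close> at most \<open>4 * k\<close> times \<open>\<xi> - s\<close>.\<close>

lemma cone_upper_bound:
  assumes cone: "cone_bounds a \<kappa> C" and na: "norm a = k" and \<kappa>: "\<kappa> \<le> k / 4"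
    and s: "s > 0" "2 * s \<le> \<xi>" and y: "norm (y - s *\<^sub>R a) \<le> \<kappa> * s" and p: "norm (p - \<xi> *\<^sub>R a) \<le> \<kappa> * \<xi>"
  shows "d y p \<le> k * norm (p - y) + 16 * C * k * sqrt (\<xi> / s)"
proof -
  have C: "C \<ge> 0" using cone by (simp add: cone_bounds_def)
  have \<xi>: "\<xi> > 0" "s < \<xi>" using s by auto
  have ns: "norm (s *\<^sub>R a) = k * s" "norm (\<xi> *\<^sub>R a) = k * \<xi>" using na s \<xi> by auto
  have ks: "\<kappa> * s \<le> k / 4 * s" "\<kappa> * \<xi> \<le> k / 4 * \<xi>" using \<kappa> s \<xi> by (auto intro: mult_right_mono)
  have ny: "norm y \<le> 5 / 4 * (k * s)" using norm_triangle_ineq[of "y - s *\<^sub>R a" "s *\<^sub>R a"] y ks ns by simp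
  have np: "norm p \<le> 5 / 4 * (k * \<xi>)" using norm_triangle_ineq[of "p - \<xi> *\<^sub>R a" "\<xi> *\<^sub>R a"] p ks ns by simp
  have np': "norm p \<ge> 3 / 4 * (k * \<xi>)" using norm_triangle_ineq3[of "p" "\<xi> *\<^sub>R a"] p ks ns by simp
  have "k * \<xi> \<ge> 2 * (k * s)" using mult_left_mono[OF s(2), of k] k by simp
  moreover have "k * s > 0" using k s by simp
  ultimately have ne: "y \<noteq> p" using ny np' by auto
  have n: "norm (y - p) \<le> 2 * k * \<xi>"
  proof -
    have "norm (y - p) \<le> 2 * (k * \<xi>)"
      using norm_triangle_ineq4[of y p] ny np \<open>k * \<xi> \<ge> 2 * (k * s)\<close> mult_pos_pos[OF k \<xi>(1)] by linarith
    then show ?thesis by simp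
  qed
  have "norm (y - p) / (\<xi> - s) \<le> 2 * k * \<xi> / (\<xi> / 2)"
    using n s \<xi> k by (intro frac_le) auto
  also have "\<dots> = 4 * k" using \<xi> by simp
  finally have r: "norm (y - p) / (\<xi> - s) \<le> 4 * k" .
  have q: "\<xi> / s \<ge> 1" using s \<xi> by simp
  have "ln (\<xi> / s) = 2 * ln (sqrt (\<xi> / s))" using q by (simp add: ln_sqrt)
  also have "\<dots> \<le> 4 * sqrt (\<xi> / s)"
  proof -
    have "ln (sqrt (\<xi> / s)) \<le> sqrt (\<xi> / s) - 1" using q by (intro ln_le_minus_one) simp
    moreover have "0 \<le> sqrt (\<xi> / s)" using q by simp
    ultimately show ?thesis by linarith
  qed
  finally have ln: "ln (\<xi> / s) \<le> 4 * sqrt (\<xi> / s)" .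
  have "d y p \<le> k * norm (y - p) + C * (norm (y - p) / (\<xi> - s)) * ln (\<xi> / s)"
    using cone s(1) \<xi>(2) ne y p unfolding cone_bounds_def by blast
  also have "C * (norm (y - p) / (\<xi> - s)) * ln (\<xi> / s) \<le> C * (4 * k) * (4 * sqrt (\<xi> / s))"
    using r ln C k q \<xi> by (intro mult_mono mult_left_mono) auto
  finally show ?thesis by (simp add: norm_minus_commute mult_ac)
qed

text \<open>An almost minimizing path from \<open>x\<close> to \<open>p\<close> meets the hyperplane
  at half the height \<open>\<xi>\<close> of \<open>p\<close> along \<open>a\<close>. Its excess
  length is at most \<open>A3 * sqrt (s * \<xi>)\<close>: \<open>A\<close> comes from the upper
  bound \<open>dxp\<close>, 1 from the defect of the path, \<open>2 * k\<^sup>2\<close> from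
  replacing \<open>x\<close> by the origin, all divided by the unit cost \<open>k\<close>. Then
  \<open>midpoint_deviation\<close> limits the sideways displacement, with \<open>A4\<close> as the
  resulting constant.\<close>

lemma cone_halving:
  assumes na: "norm a = k" and \<xi>: "\<xi> = (a \<bullet> p) / k\<^sup>2" and p: "norm (p - \<xi> *\<^sub>R a) \<le> k / 2 * \<xi>"
    and s: "s \<ge> 1" "4 * s < \<xi>" and x: "norm x \<le> 2 * k * s" and A: "A \<ge> 0"
    and dxp: "d x p \<le> k * norm p + A * sqrt (s * \<xi>)" and \<epsilon>: "\<epsilon> > 0"
    and A3: "A3 = (A + 1 + 2 * k\<^sup>2) / k" and A4: "A4 = sqrt (4 * k * A3 + A3\<^sup>2)"
  shows "\<exists>p'. (a \<bullet> p') / k\<^sup>2 = \<xi> / 2 \<and> d x p' + d p' p \<le> d x p + \<epsilon> \<and>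
    norm (p' - (\<xi> / 2) *\<^sub>R a) \<le> norm (p - \<xi> *\<^sub>R a) / 2 + A4 * \<xi> * sqrt (sqrt (s / \<xi>))"
proof -
  have \<xi>0: "\<xi> > 0" "s > 0" "s \<le> \<xi>" using s by auto
  have k2: "k\<^sup>2 > 0" using k by simp
  have ax: "a \<bullet> x \<le> 2 * s * k\<^sup>2"
  proof -
    have "a \<bullet> x \<le> norm a * norm x" by (rule norm_cauchy_schwarz)
    also have "\<dots> \<le> k * (2 * k * s)" unfolding na using x k by (intro mult_left_mono) auto
    finally show ?thesis by (simp add: power2_eq_square mult_ac)
  qed
  have "(a \<bullet> x) / k\<^sup>2 \<le> 2 * s" using ax k2 by (simp add: pos_divide_le_eq)
  then have lt: "(a \<bullet> x) / k\<^sup>2 < \<xi> / 2" "\<xi> / 2 < (a \<bullet> p) / k\<^sup>2" using s \<xi>0 unfolding \<xi>[symmetric] by linarith+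
  have "continuous_on UNIV (\<lambda>p. (a \<bullet> p) / k\<^sup>2)" unfolding divide_inverse by (intro continuous_intros)
  \<comment> \<open>The defect is at most \<open>\<epsilon>\<close> for the summation over scales,
    and at most 1 so that \<open>sqrt (s * \<xi>) \<ge> 1\<close> dominates it.\<close>
  from d_intermediate[OF this, of "min \<epsilon> 1" x "\<xi> / 2" p] lt \<epsilon>
  obtain p' where p': "(a \<bullet> p') / k\<^sup>2 = \<xi> / 2" "d x p' + d p' p \<le> d x p + min \<epsilon> 1" by auto
  define \<sigma> where "\<sigma> = sqrt (s * \<xi>)"
  have "s * s \<le> s * \<xi>" "s * \<xi> \<le> \<xi> * \<xi>" using \<xi>0 by auto
  from this[THEN real_sqrt_le_mono] have "sqrt (s * s) \<le> \<sigma>" "\<sigma> \<le> sqrt (\<xi> * \<xi>)" unfolding \<sigma>_def .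
  then have \<sigma>: "s \<le> \<sigma>" "\<sigma> \<le> \<xi>" "1 \<le> \<sigma>" "0 \<le> \<sigma>" using \<xi>0 s by (auto simp: real_sqrt_mult_self)
  have A30: "A3 \<ge> 0" unfolding A3 using A k by simp
  have "k * (norm p' + norm (p - p')) \<le> k * norm p + (A + 1 + 2 * k\<^sup>2) * \<sigma>"
  proof -
    have "norm p' \<le> norm (x - p') + norm x" using norm_triangle_ineq4[of x "x - p'"] by (simp add: add.commute)
    then have "k * norm p' \<le> k * (norm (x - p') + 2 * k * s)" using x k by (intro mult_left_mono) auto
    also have "\<dots> = k * norm (x - p') + 2 * k\<^sup>2 * s" by (simp add: algebra_simps power2_eq_square)
    also have "2 * k\<^sup>2 * s \<le> 2 * k\<^sup>2 * \<sigma>" using \<sigma>(1) by (intro mult_left_mono) auto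
    finally have "k * norm p' \<le> d x p' + 2 * k\<^sup>2 * \<sigma>" using d_ge[of x p'] by linarith
    moreover have "k * norm (p - p') \<le> d p' p" using d_ge[of p' p] by (simp add: norm_minus_commute)
    moreover have "d x p + min \<epsilon> 1 \<le> k * norm p + A * \<sigma> + \<sigma>" using dxp \<sigma>(3) unfolding \<sigma>_def[symmetric] by linarith
    ultimately show ?thesis using p'(2) by (simp add: algebra_simps)
  qed
  also have "(A + 1 + 2 * k\<^sup>2) * \<sigma> = k * (A3 * \<sigma>)" unfolding A3 using k by simp
  finally have "k * (norm p' + norm (p - p')) \<le> k * (norm p + A3 * \<sigma>)" by (simp only: distrib_left)
  then have sum: "norm p' + norm (p - p') \<le> norm p + A3 * \<sigma>" using k by simp
  define w where "w = p' - (1/2) *\<^sub>R p"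
  have w: "(1/2) *\<^sub>R p + w = p'" "(1/2) *\<^sub>R p - w = p - p'"
  proof -
    have hp: "(1/2) *\<^sub>R p + (1/2) *\<^sub>R p = p" by (simp flip: scaleR_left_distrib)
    show "(1/2) *\<^sub>R p + w = p'" by (simp add: w_def)
    have "(1/2) *\<^sub>R p - w = ((1/2) *\<^sub>R p + (1/2) *\<^sub>R p) - p'" by (simp add: w_def)
    then show "(1/2) *\<^sub>R p - w = p - p'" unfolding hp .
  qed
  \<comment> \<open>\<open>p'\<close> has the same height as half of \<open>p\<close>. Hence
    \<open>p \<bullet> w\<close> sees only \<open>p - \<xi> *\<^sub>R a\<close>, which the aperture
    keeps small, and \<open>midpoint_deviation\<close> becomes applicable.\<close>
  have aw: "a \<bullet> w = 0"
  proof -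
    have "a \<bullet> p' = \<xi> / 2 * k\<^sup>2" using p'(1) k2 by (simp add: divide_eq_eq)
    moreover have "a \<bullet> p = \<xi> * k\<^sup>2" unfolding \<xi> using k2 by simp
    ultimately show ?thesis by (simp add: w_def inner_diff_right)
  qed
  have kxp: "k * \<xi> \<le> norm p"
  proof -
    have "\<xi> * k\<^sup>2 = a \<bullet> p" unfolding \<xi> using k2 by simp
    also have "\<dots> \<le> k * norm p" using norm_cauchy_schwarz[of a p] na by simp
    finally have "k * (k * \<xi>) \<le> k * norm p" by (simp add: power2_eq_square mult_ac)
    then show ?thesis using k by simp
  qed
  have pos: "norm p > 0" using kxp mult_pos_pos[OF k \<xi>0(1)] by linarith
  have pw: "\<bar>p \<bullet> w\<bar> \<le> norm p * norm w / 2"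
  proof -
    have "p \<bullet> w = (p - \<xi> *\<^sub>R a) \<bullet> w" using aw by (simp add: inner_diff_left)
    then have "\<bar>p \<bullet> w\<bar> \<le> norm (p - \<xi> *\<^sub>R a) * norm w" using Cauchy_Schwarz_ineq2 by metis
    also have "\<dots> \<le> (norm p / 2) * norm w" using p kxp by (intro mult_right_mono) auto
    finally show ?thesis by simp
  qed
  have "(norm w)\<^sup>2 \<le> 2 * norm p * (A3 * \<sigma>) + (A3 * \<sigma>)\<^sup>2"
    by (rule midpoint_deviation) (use pos sum pw w A30 \<sigma> in auto)
  also have "2 * norm p * (A3 * \<sigma>) \<le> 2 * (2 * k * \<xi>) * (A3 * \<sigma>)"
  proof -
    have "norm p \<le> norm (p - \<xi> *\<^sub>R a) + norm (\<xi> *\<^sub>R a)" using norm_triangle_ineq[of "p - \<xi> *\<^sub>R a" "\<xi> *\<^sub>R a"] by simp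
    moreover have "norm (\<xi> *\<^sub>R a) = k * \<xi>" using na \<xi>0 by simp
    moreover have "k / 2 * \<xi> = (k * \<xi>) / 2" by simp
    ultimately have "norm p \<le> 2 * (k * \<xi>)" using p mult_pos_pos[OF k \<xi>0(1)] by linarith
    then have "norm p \<le> 2 * k * \<xi>" by simp
    then show ?thesis using A30 \<sigma> by (intro mult_right_mono mult_left_mono) auto
  qed
  also have "(A3 * \<sigma>)\<^sup>2 \<le> A3\<^sup>2 * (\<xi> * \<sigma>)"
    unfolding power_mult_distrib using \<sigma>
      by (intro mult_left_mono) (auto simp: power2_eq_square intro: mult_right_mono)
  finally have "(norm w)\<^sup>2 \<le> (4 * k * A3 + A3\<^sup>2) * (\<xi> * \<sigma>)" by (simp add: algebra_simps)
  also have "4 * k * A3 + A3\<^sup>2 = A4\<^sup>2" unfolding A4 using A30 k by simp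
  also have "\<sigma> = \<xi> * sqrt (s / \<xi>)"
  proof -
    have "s * \<xi> = \<xi>\<^sup>2 * (s / \<xi>)" using \<xi>0 by (simp add: power2_eq_square)
    from arg_cong[OF this, of sqrt] have "\<sigma> = sqrt (\<xi>\<^sup>2) * sqrt (s / \<xi>)" unfolding \<sigma>_def real_sqrt_mult .
    then show ?thesis using \<xi>0 by simp
  qed
  also have "A4\<^sup>2 * (\<xi> * (\<xi> * sqrt (s / \<xi>))) = (A4 * \<xi> * sqrt (sqrt (s / \<xi>)))\<^sup>2"
    using \<xi>0 by (simp add: power_mult_distrib power2_eq_square[of \<xi>])
  finally have nw: "norm w \<le> A4 * \<xi> * sqrt (sqrt (s / \<xi>))"
    by (rule power2_le_imp_le) (use A30 k \<xi>0 in \<open>auto simp: A4\<close>)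
  have "p' - (\<xi> / 2) *\<^sub>R a = (1/2) *\<^sub>R (p - \<xi> *\<^sub>R a) + w" by (simp add: w_def scaleR_diff_right)
  then have "norm (p' - (\<xi> / 2) *\<^sub>R a) \<le> norm ((1/2) *\<^sub>R (p - \<xi> *\<^sub>R a)) + norm w" by (metis norm_triangle_ineq)
  then show ?thesis using nw p' by (intro exI[of _ p']) auto
qed

text \<open>Seen from a far point \<open>p\<close> in direction \<open>\<omega>\<close>, the
  difference of the distances to \<open>x\<close> and \<open>y\<close> is about
  \<open>\<omega> \<bullet> (y - x)\<close>, which is about \<open>s * g / k\<close> as
  \<open>\<omega>\<close> is close to \<open>(1 / k) *\<^sub>R a\<close>. The errors stem from the
  aperture (\<open>16 * k * \<kappa>\<close>), the positions of \<open>x\<close> and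
  \<open>y\<close> (\<open>2 * k * \<epsilon>\<close>) and the finite distance of \<open>p\<close>
  (\<open>4 * k\<^sup>2 / M\<close>).\<close>

lemma cone_far_point_estimate:
  fixes a a1 :: 'w
  assumes na: "norm a = k" "norm a1 = k" and g: "g = k\<^sup>2 - a \<bullet> a1"
    and p: "norm (p - \<xi> *\<^sub>R a) \<le> 2 * \<kappa> * \<xi>" and \<kappa>: "\<kappa> > 0" "4 * \<kappa> \<le> k" and M: "M > 0" "M * s \<le> \<xi>" and s: "s > 0"
    and x: "norm (x - s *\<^sub>R a1) \<le> \<epsilon> * s" and y: "norm (y - s *\<^sub>R a) \<le> \<epsilon> * s" and \<epsilon>: "\<epsilon> \<le> k"
  shows "k * norm (x - p) - k * norm (p - y) \<ge> s * (g - 16 * k * \<kappa> - 2 * k * \<epsilon> - 4 * k\<^sup>2 / M)"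
proof -
  have \<xi>: "\<xi> > 0" using M s by (meson less_le_trans mult_pos_pos)
  define P where "P = norm p"
  have n\<xi>: "norm (\<xi> *\<^sub>R a) = k * \<xi>" using na \<xi> by simp
  have k\<xi>: "2 * \<kappa> * \<xi> \<le> k * \<xi> / 2" using mult_right_mono[OF \<kappa>(2), of \<xi>] \<xi> by simp
  have dP: "\<bar>P - k * \<xi>\<bar> \<le> norm (p - \<xi> *\<^sub>R a)" using norm_triangle_ineq3[of p "\<xi> *\<^sub>R a"] unfolding P_def n\<xi> .
  have Pl: "k * \<xi> / 2 \<le> P" using dP p k\<xi> by linarith
  have k\<xi>0: "k * \<xi> > 0" using k \<xi> by simp
  have P0: "P > 0" using Pl k\<xi>0 by linarith
  define \<omega> where "\<omega> = (1 / P) *\<^sub>R p"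
  have n\<omega>: "norm \<omega> = 1" using P0 by (simp add: \<omega>_def P_def)
  have \<omega>p: "\<omega> \<bullet> p = P" using P0 by (simp add: \<omega>_def P_def power2_norm_eq_inner[symmetric] power2_eq_square)
  have xp: "P - \<omega> \<bullet> x \<le> norm (x - p)"
    using norm_cauchy_schwarz[of \<omega> "p - x"] n\<omega> \<omega>p by (simp add: inner_diff_right norm_minus_commute)
  have ny: "norm y \<le> 2 * k * s"
  proof -
    have "norm y \<le> norm (y - s *\<^sub>R a) + norm (s *\<^sub>R a)" using norm_triangle_ineq[of "y - s *\<^sub>R a" "s *\<^sub>R a"] by simp
    also have "norm (s *\<^sub>R a) = k * s" using na s by simp
    also have "norm (y - s *\<^sub>R a) \<le> k * s" using y mult_right_mono[OF \<epsilon>, of s] s by linarith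
    finally show ?thesis by simp
  qed
  have py: "norm (p - y) \<le> P - \<omega> \<bullet> y + 4 * k * s / M"
  proof -
    have p0: "p \<noteq> 0" using P0 by (auto simp: P_def)
    have "norm (p + (- y)) \<le> norm p + (p \<bullet> (- y)) / norm p + (norm (- y))\<^sup>2 / (2 * norm p)"
      by (rule norm_add_le_linear[OF p0])
    also have "(p \<bullet> (- y)) / norm p = - (\<omega> \<bullet> y)" by (simp add: \<omega>_def P_def)
    also have "(norm (- y))\<^sup>2 / (2 * norm p) \<le> (2 * k * s)\<^sup>2 / (k * (M * s))"
    proof (rule frac_le)
      show "(norm (- y))\<^sup>2 \<le> (2 * k * s)\<^sup>2" using ny by (intro power_mono) auto
      show "0 < k * (M * s)" using k M s by simp
      show "k * (M * s) \<le> 2 * norm p" using Pl mult_left_mono[OF M(2), of k] k unfolding P_def by linarith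
    qed auto
    also have "(2 * k * s)\<^sup>2 / (k * (M * s)) = 4 * k * s / M" using k M s by (simp add: power2_eq_square)
    finally show ?thesis by (simp add: P_def)
  qed
  have dir: "norm (\<omega> - (1 / k) *\<^sub>R a) \<le> 8 * \<kappa> / k"
  proof -
    have "\<omega> - (1 / k) *\<^sub>R a = (1 / P) *\<^sub>R (p - \<xi> *\<^sub>R a) + ((k * \<xi> - P) / (k * P)) *\<^sub>R a"
    proof -
      have e: "(k * \<xi> - P) / (k * P) = \<xi> / P - 1 / k" using P0 k by (simp add: field_simps)
      show ?thesis unfolding \<omega>_def e scaleR_diff_right scaleR_left_diff_distrib by simp
    qed
    then have "norm (\<omega> - (1 / k) *\<^sub>R a) \<le> norm ((1 / P) *\<^sub>R (p - \<xi> *\<^sub>R a)) + norm (((k * \<xi> - P) / (k * P)) *\<^sub>R a)"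
      by (metis norm_triangle_ineq)
    also have "norm (((k * \<xi> - P) / (k * P)) *\<^sub>R a) = \<bar>P - k * \<xi>\<bar> / P"
      using na k P0 by (simp add: abs_mult abs_minus_commute)
    also have "norm ((1 / P) *\<^sub>R (p - \<xi> *\<^sub>R a)) = norm (p - \<xi> *\<^sub>R a) / P" using P0 by simp
    also have "norm (p - \<xi> *\<^sub>R a) / P + \<bar>P - k * \<xi>\<bar> / P \<le> 2 * \<kappa> * \<xi> / (k * \<xi> / 2) + 2 * \<kappa> * \<xi> / (k * \<xi> / 2)"
      using p dP Pl k\<xi>0 by (intro add_mono frac_le) auto
    also have "\<dots> = 8 * \<kappa> / k" using \<xi> by simp
    finally show ?thesis .
  qed
  have \<omega>a: "\<omega> \<bullet> (a - a1) \<ge> g / k - 16 * \<kappa>"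
  proof -
    have "\<omega> \<bullet> (a - a1) = (1 / k) * (a \<bullet> (a - a1)) + (\<omega> - (1 / k) *\<^sub>R a) \<bullet> (a - a1)" by (simp add: inner_diff_left)
    also have "a \<bullet> (a - a1) = g" unfolding g inner_diff_right using na power2_norm_eq_inner[of a] by simp
    finally have eq: "\<omega> \<bullet> (a - a1) = g / k + (\<omega> - (1 / k) *\<^sub>R a) \<bullet> (a - a1)" by simp
    have "\<bar>(\<omega> - (1 / k) *\<^sub>R a) \<bullet> (a - a1)\<bar> \<le> norm (\<omega> - (1 / k) *\<^sub>R a) * norm (a - a1)" by (rule Cauchy_Schwarz_ineq2)
    also have "\<dots> \<le> 8 * \<kappa> / k * (2 * k)"
      using dir norm_triangle_ineq4[of a a1] na k \<kappa> by (intro mult_mono) auto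
    also have "\<dots> = 16 * \<kappa>" using k by simp
    finally show ?thesis using eq by linarith
  qed
  have yx: "\<omega> \<bullet> (y - x) \<ge> s * (g / k - 16 * \<kappa>) - 2 * \<epsilon> * s"
  proof -
    have "\<omega> \<bullet> (y - x) = s * (\<omega> \<bullet> (a - a1)) + \<omega> \<bullet> (y - s *\<^sub>R a) - \<omega> \<bullet> (x - s *\<^sub>R a1)"
      by (simp add: inner_diff_right algebra_simps)
    moreover have "\<bar>\<omega> \<bullet> (y - s *\<^sub>R a)\<bar> \<le> \<epsilon> * s" "\<bar>\<omega> \<bullet> (x - s *\<^sub>R a1)\<bar> \<le> \<epsilon> * s"
      using Cauchy_Schwarz_ineq2[of \<omega> "y - s *\<^sub>R a"] Cauchy_Schwarz_ineq2[of \<omega> "x - s *\<^sub>R a1"] n\<omega> x y by auto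
    moreover have "s * (\<omega> \<bullet> (a - a1)) \<ge> s * (g / k - 16 * \<kappa>)" using \<omega>a s by (intro mult_left_mono) auto
    ultimately show ?thesis by linarith
  qed
  have "norm (x - p) - norm (p - y) \<ge> s * (g / k - 16 * \<kappa>) - 2 * \<epsilon> * s - 4 * k * s / M"
    using xp py yx by (simp add: inner_diff_right)
  then have "k * (norm (x - p) - norm (p - y)) \<ge> k * (s * (g / k - 16 * \<kappa>) - 2 * \<epsilon> * s - 4 * k * s / M)"
    using k by (intro mult_left_mono) auto
  also have "k * (s * (g / k - 16 * \<kappa>) - 2 * \<epsilon> * s - 4 * k * s / M) = s * (g - 16 * k * \<kappa> - 2 * k * \<epsilon> - 4 * k\<^sup>2 / M)"
    using k by (simp add: right_diff_distrib power2_eq_square mult_ac)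
  finally show ?thesis by (simp only: right_diff_distrib)
qed

end

text \<open>The fourth root of 2 is at least 11/10. This surplus of a tenth per halving pays for the
  deviation that the halving creates.\<close>

lemma quartic_root_halving:
  fixes s \<xi> :: real
  assumes "s > 0" "\<xi> > 0"
  shows "11 / 10 * sqrt (sqrt (s / \<xi>)) \<le> sqrt (sqrt (s / (\<xi> / 2)))"
proof -
  have "11 / 10 \<le> sqrt (sqrt (2::real))"
    by (intro real_le_rsqrt) (simp add: power2_eq_square)
  then have "11 / 10 * sqrt (sqrt (s / \<xi>)) \<le> sqrt (sqrt 2) * sqrt (sqrt (s / \<xi>))" using assms
    by (intro mult_right_mono) auto
  also have "\<dots> = sqrt (sqrt (2 * (s / \<xi>)))" by (simp only: real_sqrt_mult)
  also have "2 * (s / \<xi>) = s / (\<xi> / 2)" by simp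
  finally show ?thesis .
qed

context asymptotic_geometry begin

text \<open>A nearly minimizing curve from \<open>x\<close> to a far point in the direction of \<open>a\<close> is nearly straight at all dyadic
  scales down to the one of \<open>x\<close>: the deviations at successive scales form a geometric series. This transports
  the lower bound \<open>base\<close> from the scale of \<open>x\<close> to arbitrarily far points \<open>p\<close>.\<close>

lemma cone_lower_bound_far:
  fixes B :: "'w \<Rightarrow> real"
  assumes na: "norm a = k" and s: "s \<ge> 1" and x: "norm x \<le> 2 * k * s" and A: "A \<ge> 0"
    and \<kappa>: "\<kappa> > 0" "4 * \<kappa> \<le> k" and N: "N \<ge> 2" "20 * A4 \<le> \<kappa> * N"
    and A3: "A3 = (A + 1 + 2 * k\<^sup>2) / k" and A4: "A4 = sqrt (4 * k * A3 + A3\<^sup>2)"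
    and B: "\<And>p q. B q \<le> d q p + B p"
    and up: "\<And>p. N ^ 4 * s \<le> (a \<bullet> p) / k\<^sup>2 \<Longrightarrow> norm (p - ((a \<bullet> p) / k\<^sup>2) *\<^sub>R a) \<le> 2 * \<kappa> * ((a \<bullet> p) / k\<^sup>2) \<Longrightarrow>
        d x p \<le> k * norm p + A * sqrt (s * ((a \<bullet> p) / k\<^sup>2))"
    and base: "\<And>p. N ^ 4 * s \<le> (a \<bullet> p) / k\<^sup>2 \<Longrightarrow> (a \<bullet> p) / k\<^sup>2 \<le> 2 * N ^ 4 * s \<Longrightarrow>
        norm (p - ((a \<bullet> p) / k\<^sup>2) *\<^sub>R a) \<le> 2 * \<kappa> * ((a \<bullet> p) / k\<^sup>2) \<Longrightarrow> - Q \<le> d x p + B p"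
    and p: "N ^ 4 * s \<le> (a \<bullet> p) / k\<^sup>2" "norm (p - ((a \<bullet> p) / k\<^sup>2) *\<^sub>R a) \<le> \<kappa> * ((a \<bullet> p) / k\<^sup>2)"
  shows "- Q \<le> d x p + B p"
proof -
  define \<xi> where "\<xi> p = (a \<bullet> p) / k\<^sup>2" for p
  \<comment> \<open>The aperture allowed at height \<open>t\<close> is
    \<open>\<kappa> * (1 + \<psi> t)\<close>. It widens on the way down: each halving enlarges
    \<open>\<psi>\<close> by at least a tenth, which absorbs the deviation because
    \<open>20 * A4 \<le> \<kappa> * N\<close>. Above \<open>N ^ 4 * s\<close> one has
    \<open>\<psi> \<le> 1\<close>, so the aperture never exceeds
    \<open>2 * \<kappa>\<close>.\<close>
  define \<psi> where "\<psi> t = N * sqrt (sqrt (s / t))" for t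
  have N0: "N > 0" using N by simp
  have s0: "s > 0" using s by simp
  have N4: "N ^ 4 \<ge> 16" using power_mono[of 2 N 4] N by simp
  have Ns: "N ^ 4 * s > 0" using N4 s0 by (intro mult_pos_pos) linarith+
  have \<psi>1: "0 \<le> \<psi> t \<and> \<psi> t \<le> 1" if t: "N ^ 4 * s \<le> t" for t
  proof -
    have t0: "t > 0" using t Ns by linarith
    have "s / t \<le> s / (N ^ 4 * s)" using t t0 Ns s0 by (intro divide_left_mono) auto
    also have "\<dots> = ((1 / N)\<^sup>2)\<^sup>2" using s0 by (simp add: power_divide flip: power_mult)
    finally have "sqrt (s / t) \<le> (1 / N)\<^sup>2" by (rule real_le_lsqrt[rotated]) simp
    then have "sqrt (sqrt (s / t)) \<le> 1 / N" by (rule real_le_lsqrt[rotated]) (use N0 in simp)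
    then have "N * sqrt (sqrt (s / t)) \<le> N * (1 / N)" using N0 by (intro mult_left_mono) auto
    then have "\<psi> t \<le> 1" using N0 by (simp add: \<psi>_def)
    then show ?thesis using N0 s0 t0 by (simp add: \<psi>_def)
  qed
  \<comment> \<open>Induction on a bound \<open>n\<close> for the number of halvings that lead into
    the range of \<open>base\<close>. The defects \<open>\<epsilon> / 2\<close>,
    \<open>\<epsilon> / 4\<close>, ... sum up to at most \<open>\<epsilon>\<close> for every
    \<open>n\<close>.\<close>
  have claim: "- Q - \<epsilon> \<le> d x p + B p"
    if "N ^ 4 * s \<le> \<xi> p" "\<xi> p \<le> 2 ^ n * (2 * N ^ 4 * s)" "norm (p - \<xi> p *\<^sub>R a) \<le> \<kappa> * \<xi> p * (1 + \<psi> (\<xi> p))" "\<epsilon> > 0"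
      for n p \<epsilon>
    using that
  proof (induction n arbitrary: p \<epsilon>)
    case 0
    have \<xi>0: "\<xi> p > 0" using 0(1) Ns by linarith
    have "\<kappa> * \<xi> p * (1 + \<psi> (\<xi> p)) \<le> \<kappa> * \<xi> p * 2" using \<psi>1[OF 0(1)] \<kappa> \<xi>0 by (intro mult_left_mono) auto
    then have "- Q \<le> d x p + B p" using base[of p, folded \<xi>_def] 0 by simp
    then show ?case using 0(4) by linarith
  next
    case (Suc n)
    have \<xi>0: "\<xi> p > 0" using Suc.prems(1) Ns by linarith
    have "\<kappa> * \<xi> p * (1 + \<psi> (\<xi> p)) \<le> \<kappa> * \<xi> p * 2" using \<psi>1[OF Suc.prems(1)] \<kappa> \<xi>0 by (intro mult_left_mono) auto
    then have e2: "norm (p - \<xi> p *\<^sub>R a) \<le> 2 * \<kappa> * \<xi> p" using Suc.prems(3) by simp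
    show ?case
    proof (cases "\<xi> p \<le> 2 * N ^ 4 * s")
      case True
      then have "- Q \<le> d x p + B p" using base[of p, folded \<xi>_def] Suc.prems(1) e2 by simp
      then show ?thesis using Suc.prems(4) by linarith
    next
      case False
      have e3: "norm (p - \<xi> p *\<^sub>R a) \<le> k / 2 * \<xi> p"
        using e2 mult_right_mono[OF \<kappa>(2), of "\<xi> p"] \<xi>0 by linarith
      have "16 * s \<le> N ^ 4 * s" using N4 s0 by (intro mult_right_mono) auto
      then have s4: "4 * s < \<xi> p" using Suc.prems(1) s0 by linarith
      have \<epsilon>2: "\<epsilon> / 2 > 0" using Suc.prems(4) by simp
      obtain p' where p': "\<xi> p' = \<xi> p / 2" "d x p' + d p' p \<le> d x p + \<epsilon> / 2"
        "norm (p' - (\<xi> p / 2) *\<^sub>R a) \<le> norm (p - \<xi> p *\<^sub>R a) / 2 + A4 * \<xi> p * sqrt (sqrt (s / \<xi> p))"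
        using cone_halving[OF na \<xi>_def[of p] e3 s s4 x A up[of p, folded \<xi>_def, OF Suc.prems(1) e2] \<epsilon>2 A3 A4]
        unfolding \<xi>_def[symmetric] by blast
      have h1: "N ^ 4 * s \<le> \<xi> p'" using False p'(1) by simp
      have h2: "\<xi> p' \<le> 2 ^ n * (2 * N ^ 4 * s)" using Suc.prems(2) p'(1) by simp
      have h3: "norm (p' - \<xi> p' *\<^sub>R a) \<le> \<kappa> * \<xi> p' * (1 + \<psi> (\<xi> p'))"
      proof -
        define r where "r = sqrt (sqrt (s / \<xi> p))"
        have r: "r \<ge> 0" using s0 \<xi>0 by (simp add: r_def)
        have "11 / 10 * r \<le> sqrt (sqrt (s / (\<xi> p / 2)))" unfolding r_def by (rule quartic_root_halving[OF s0 \<xi>0])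
        then have "N * (11 / 10 * r) \<le> N * sqrt (sqrt (s / (\<xi> p / 2)))" using N0 by (intro mult_left_mono) auto
        then have \<psi>h: "11 / 10 * (N * r) \<le> \<psi> (\<xi> p / 2)" by (simp add: \<psi>_def)
        have "norm (p' - (\<xi> p / 2) *\<^sub>R a) \<le> \<kappa> * \<xi> p * (1 + N * r) / 2 + A4 * \<xi> p * r"
          using p'(3) Suc.prems(3) unfolding r_def \<psi>_def by linarith
        also have "A4 * \<xi> p * r \<le> \<kappa> * N / 20 * (\<xi> p * r)"
        proof -
          have "A4 \<le> \<kappa> * N / 20" using N(2) by simp
          then have "A4 * (\<xi> p * r) \<le> \<kappa> * N / 20 * (\<xi> p * r)" using \<xi>0 r by (intro mult_right_mono) auto
          then show ?thesis by (simp add: mult.assoc)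
        qed
        also have "\<kappa> * \<xi> p * (1 + N * r) / 2 + \<kappa> * N / 20 * (\<xi> p * r) = \<kappa> * (\<xi> p / 2) * (1 + 11 / 10 * (N * r))"
          by (simp add: field_simps)
        also have "\<dots> \<le> \<kappa> * (\<xi> p / 2) * (1 + \<psi> (\<xi> p / 2))"
          using \<psi>h \<kappa> \<xi>0 by (intro mult_left_mono) auto
        finally show ?thesis unfolding p'(1) by simp
      qed
      from Suc.IH[OF h1 h2 h3 \<epsilon>2] have "- Q - \<epsilon> / 2 \<le> d x p' + B p'" .
      moreover have "B p' \<le> d p' p + B p" by (rule B)
      ultimately show ?thesis using p'(2) by linarith
    qed
  qed
  obtain n where n: "\<xi> p / (2 * N ^ 4 * s) < 2 ^ n" using real_arch_pow[of 2] by auto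
  moreover have "2 * N ^ 4 * s > 0" using Ns by linarith
  ultimately have n': "\<xi> p \<le> 2 ^ n * (2 * N ^ 4 * s)" using pos_divide_less_eq less_imp_le by blast
  have \<xi>0: "\<xi> p > 0" using p(1) Ns by (simp add: \<xi>_def)
  have "\<kappa> * \<xi> p * 1 \<le> \<kappa> * \<xi> p * (1 + \<psi> (\<xi> p))" using \<psi>1[OF p(1)[folded \<xi>_def]] \<kappa> \<xi>0 by (intro mult_left_mono) auto
  then have p2: "norm (p - \<xi> p *\<^sub>R a) \<le> \<kappa> * \<xi> p * (1 + \<psi> (\<xi> p))" using p(2) by (simp add: \<xi>_def)
  show ?thesis
  proof (rule field_le_epsilon)
    fix e :: real assume "0 < e"
    from claim[OF p(1)[folded \<xi>_def] n' p2 this] show "- Q \<le> d x p + B p + e" by simp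
  qed
qed

text \<open>The contradiction arises at a single large \<open>s\<close>, where the two Busemann
  functions differ by about \<open>g / 2 * s\<close> at least, more than \<open>c\<close> allows.
  The aperture \<open>\<kappa>\<close>, the constant \<open>A\<close> and the depth \<open>N\<close>
  are fixed before \<open>s\<close>, and no constant depends on how far out
  \<open>\<gamma>2 T\<close> lies.\<close>

lemma shapes_eq_if_bus_differ_by_constant:
  assumes r1: "ray \<gamma>1 t1 a1" and r2: "ray \<gamma>2 t2 a" and c: "\<And>x. bus \<gamma>1 t1 x = bus \<gamma>2 t2 x + c"
  shows "a1 = a"
proof (rule ccontr)
  assume neq: "a1 \<noteq> a"
  have na: "norm a = k" "norm a1 = k" using rayD(1)[OF r1] rayD(1)[OF r2] by auto
  \<comment> \<open>Half the squared distance of the two shapes, since both have norm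
    \<open>k\<close>.\<close>
  define g where "g = k\<^sup>2 - a \<bullet> a1"
  have g: "g > 0"
  proof -
    have "0 < (norm (a - a1))\<^sup>2" using neq by simp
    also have "\<dots> = a \<bullet> a - 2 * (a \<bullet> a1) + a1 \<bullet> a1"
      by (simp add: power2_norm_eq_inner inner_diff_left inner_diff_right inner_commute)
    also have "\<dots> = 2 * g" using na by (simp add: g_def flip: power2_norm_eq_inner)
    finally show ?thesis by simp
  qed
  obtain \<kappa>' C where cone': "cone_bounds a \<kappa>' C" using rayD(2)[OF r2] by blast
  define \<kappa>1 where "\<kappa>1 = min \<kappa>' (k / 4)"
  have \<kappa>1: "\<kappa>1 > 0" "\<kappa>1 \<le> \<kappa>'" "\<kappa>1 \<le> k / 4" using cone' k by (auto simp: \<kappa>1_def cone_bounds_def)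
  have cone: "cone_bounds a \<kappa>1 C" by (rule cone_bounds_mono[OF cone' \<kappa>1(1,2)])
  have C: "C \<ge> 0" using cone by (simp add: cone_bounds_def)
  \<comment> \<open>Half of \<open>\<kappa>1\<close> because the descent may double the aperture;
    the other bound makes the aperture error \<open>16 * k * \<kappa>\<close> at most
    \<open>g / 8\<close>.\<close>
  define \<kappa> where "\<kappa> = min (\<kappa>1 / 2) (g / (128 * k))"
  have \<kappa>: "\<kappa> > 0" "\<kappa> \<le> \<kappa>1 / 2" "\<kappa> \<le> g / (128 * k)"
    unfolding \<kappa>_def using \<kappa>1 g k by (auto intro: min.cobounded1 min.cobounded2 simp del: divide_le_eq)
  have \<kappa>4: "4 * \<kappa> \<le> k" using \<kappa> \<kappa>1 by linarith
  have \<kappa>g: "16 * k * \<kappa> \<le> g / 8" using mult_left_mono[OF \<kappa>(3), of "16 * k"] k by simp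
  define C1 where "C1 = 16 * C * k"
  have C1: "C1 \<ge> 0" using C k by (simp add: C1_def)
  \<comment> \<open>\<open>4 * k\<^sup>2 * s\<close> for going from \<open>x\<close> to
    \<open>y\<close>, \<open>2 * k\<^sup>2 * s\<close> for replacing \<open>y\<close> by the origin,
    and \<open>C1\<close> for the logarithmic excess, all measured against
    \<open>sqrt (s * \<xi>)\<close>.\<close>
  define A where "A = 6 * k\<^sup>2 + C1"
  have A: "A \<ge> 0" using C1 by (simp add: A_def)
  define A3 where "A3 = (A + 1 + 2 * k\<^sup>2) / k"
  define A4 where "A4 = sqrt (4 * k * A3 + A3\<^sup>2)"
  \<comment> \<open>\<open>20 * A4 / \<kappa>\<close> serves the descent;
    \<open>64 * k\<^sup>2 / g\<close> makes the error \<open>4 * k\<^sup>2 / M\<close> at most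
    \<open>g / 16\<close>.\<close>
  define N where "N = max 2 (max (20 * A4 / \<kappa>) (64 * k\<^sup>2 / g))"
  have N: "N \<ge> 2" "20 * A4 / \<kappa> \<le> N" "64 * k\<^sup>2 / g \<le> N" by (auto simp: N_def)
  have N': "20 * A4 \<le> \<kappa> * N" using N(2) \<kappa>(1) by (simp add: pos_divide_le_eq mult.commute)
  define M where "M = N ^ 4"
  have MN: "N \<le> M" unfolding M_def using N(1) self_le_power[of N 4] by simp
  have M16: "M \<ge> 16" unfolding M_def using power_mono[of 2 N 4] N by simp
  have Mg: "4 * k\<^sup>2 / M \<le> g / 16"
  proof -
    have "64 * k\<^sup>2 / g \<le> M" using N(3) MN by linarith
    then have "64 * k\<^sup>2 \<le> M * g" using g by (simp add: pos_divide_le_eq)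
    then show ?thesis using M16 by (simp add: pos_divide_le_eq mult.commute)
  qed
  define \<epsilon> where "\<epsilon> = min (min \<kappa>1 (k\<^sup>2 / 2)) (g / (8 * (2 * k + 1)))"
  have \<epsilon>: "\<epsilon> > 0" "\<epsilon> \<le> \<kappa>1" "\<epsilon> \<le> k\<^sup>2 / 2" "\<epsilon> \<le> g / (8 * (2 * k + 1))"
  proof -
    show "\<epsilon> > 0" unfolding \<epsilon>_def using \<kappa>1 k g by simp
    show "\<epsilon> \<le> \<kappa>1" "\<epsilon> \<le> k\<^sup>2 / 2" "\<epsilon> \<le> g / (8 * (2 * k + 1))" unfolding \<epsilon>_def
      by (meson min.cobounded1 min.cobounded2 order_trans)+
  qed
  have \<epsilon>k: "\<epsilon> \<le> k" using \<epsilon>(2) \<kappa>1(3) k by linarith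
  have \<epsilon>g: "2 * k * \<epsilon> + \<epsilon> \<le> g / 8"
  proof -
    have "(2 * k + 1) * \<epsilon> \<le> (2 * k + 1) * (g / (8 * (2 * k + 1)))" using \<epsilon>(4) k by (intro mult_left_mono) auto
    also have "\<dots> = g / 8"
    proof -
      have "u * (g / (8 * u)) = g / 8" if "u > 0" for u using that by simp
      from this show ?thesis by this (use k in simp)
    qed
    finally show ?thesis by (simp add: distrib_right)
  qed
  \<comment> \<open>Beyond \<open>K\<close> the fixed quantities are small against multiples of
    \<open>s\<close>: the logarithmic excess at the lowest scales, the distance of the starting
    points, and the terms with \<open>\<gamma>1 t1\<close> and \<open>c\<close> in the final
    comparison.\<close>
  define K where "K = max 1 (max (C1 * sqrt (2 * M) * 16 / g) (max (d (\<gamma>1 t1) (\<gamma>2 t2) / k\<^sup>2) (4 * (k * norm (\<gamma>1 t1) + \<bar>c\<bar>) / g)))"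
  have "\<forall>\<^sub>F s in at_top. norm (\<gamma>1 s - s *\<^sub>R a1) \<le> \<epsilon> * s \<and> norm (\<gamma>2 s - s *\<^sub>R a) \<le> \<epsilon> * s \<and>
     d (\<gamma>1 t1) (\<gamma>1 s) \<le> (k\<^sup>2 + \<epsilon>) * s \<and> d (\<gamma>2 t2) (\<gamma>2 s) \<le> (k\<^sup>2 + \<epsilon>) * s \<and> s > t1 \<and> s > t2 \<and> s > K"
    by (intro eventually_conj rayD(4)[OF r1 \<epsilon>(1)] rayD(4)[OF r2 \<epsilon>(1)] rayD(5)[OF r1 \<epsilon>(1)] rayD(5)[OF r2 \<epsilon>(1)] eventually_gt_at_top)
  from eventually_happens'[OF trivial_limit_at_top_linorder this]
  obtain s where s: "norm (\<gamma>1 s - s *\<^sub>R a1) \<le> \<epsilon> * s" "norm (\<gamma>2 s - s *\<^sub>R a) \<le> \<epsilon> * s"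
     "d (\<gamma>1 t1) (\<gamma>1 s) \<le> (k\<^sup>2 + \<epsilon>) * s" "d (\<gamma>2 t2) (\<gamma>2 s) \<le> (k\<^sup>2 + \<epsilon>) * s" "s > t1" "s > t2" "s > K" by blast
  have sK: "s \<ge> 1" "C1 * sqrt (2 * M) * 16 / g \<le> s" "d (\<gamma>1 t1) (\<gamma>2 t2) / k\<^sup>2 \<le> s" "4 * (k * norm (\<gamma>1 t1) + \<bar>c\<bar>) / g < s"
    using s(7) unfolding K_def by auto
  have s0: "s > 0" using sK by simp
  define x where "x = \<gamma>1 s"
  define y where "y = \<gamma>2 s"
  define Q where "Q = (k\<^sup>2 - g / 2) * s"
  have nsa: "norm (s *\<^sub>R a1) = k * s" "norm (s *\<^sub>R a) = k * s" using na s0 by auto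
  have \<epsilon>s: "\<epsilon> * s \<le> k * s" using \<epsilon>k s0 by (intro mult_right_mono) auto
  have nx: "norm x \<le> 2 * k * s" using norm_triangle_ineq[of "x - s *\<^sub>R a1" "s *\<^sub>R a1"] s(1) nsa \<epsilon>s unfolding x_def
    by simp
  have ny: "norm y \<le> 2 * k * s" using norm_triangle_ineq[of "y - s *\<^sub>R a" "s *\<^sub>R a"] s(2) nsa \<epsilon>s unfolding y_def
    by simp
  have yc: "norm (y - s *\<^sub>R a) \<le> \<kappa>1 * s" using s(2) mult_right_mono[OF \<epsilon>(2), of s] s0 unfolding y_def by linarith
  have dxy: "d x y \<le> 4 * k\<^sup>2 * s"
  proof -
    have "d (\<gamma>1 t1) (\<gamma>2 t2) \<le> s * k\<^sup>2" using sK(3) k by (simp add: pos_divide_le_eq)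
    moreover have "d x y \<le> d x (\<gamma>1 t1) + (d (\<gamma>1 t1) (\<gamma>2 t2) + d (\<gamma>2 t2) y)"
      using d_triangle[of x y "\<gamma>1 t1"] d_triangle[of "\<gamma>1 t1" y "\<gamma>2 t2"] by linarith
    moreover have "d x (\<gamma>1 t1) \<le> (k\<^sup>2 + \<epsilon>) * s" using s(3) d_sym[of x "\<gamma>1 t1"] unfolding x_def by simp
    moreover have "d (\<gamma>2 t2) y \<le> (k\<^sup>2 + \<epsilon>) * s" using s(4) unfolding y_def by simp
    moreover have "(k\<^sup>2 + \<epsilon>) * s \<le> (k\<^sup>2 + k\<^sup>2 / 2) * s" using \<epsilon>(3) s0 by (intro mult_right_mono) auto
    ultimately have "d x y \<le> s * k\<^sup>2 + 2 * ((k\<^sup>2 + k\<^sup>2 / 2) * s)" by linarith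
    then show ?thesis by (simp add: algebra_simps)
  qed
  have M2: "2 * s \<le> \<xi>" if "M * s \<le> \<xi>" for \<xi> using that mult_right_mono[OF M16, of s] s0 by linarith
  have cone\<kappa>: "norm (p - \<xi> *\<^sub>R a) \<le> \<kappa>1 * \<xi>" if "norm (p - \<xi> *\<^sub>R a) \<le> 2 * \<kappa> * \<xi>" "\<xi> > 0" for p \<xi>
    using that mult_right_mono[OF \<kappa>(2), of \<xi>] by linarith
  have dyp: "d y p \<le> k * norm (p - y) + C1 * sqrt (\<xi> / s)" if "M * s \<le> \<xi>" "norm (p - \<xi> *\<^sub>R a) \<le> 2 * \<kappa> * \<xi>" for p \<xi>
  proof -
    have "\<xi> > 0" using M2[OF that(1)] s0 by linarith
    then show ?thesis unfolding C1_def
      by (intro cone_upper_bound[OF cone na(1) \<kappa>1(3) s0 M2[OF that(1)] yc cone\<kappa>[OF that(2)]])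
  qed
  have lower: "- Q \<le> d x p + bus \<gamma>2 t2 p"
    if p: "M * s \<le> (a \<bullet> p) / k\<^sup>2" "norm (p - ((a \<bullet> p) / k\<^sup>2) *\<^sub>R a) \<le> \<kappa> * ((a \<bullet> p) / k\<^sup>2)" for p
  proof (rule cone_lower_bound_far[OF na(1) sK(1) nx A \<kappa>(1) \<kappa>4 N(1) N' A3_def A4_def bus_le[OF r2], folded M_def, OF _ _ p])
    fix p define \<xi> where "\<xi> = (a \<bullet> p) / k\<^sup>2"
    assume p1: "M * s \<le> (a \<bullet> p) / k\<^sup>2" and p2: "norm (p - ((a \<bullet> p) / k\<^sup>2) *\<^sub>R a) \<le> 2 * \<kappa> * ((a \<bullet> p) / k\<^sup>2)"
    note p1 = p1[folded \<xi>_def] and p2 = p2[folded \<xi>_def]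
    have \<xi>s: "s \<le> \<xi>" "\<xi> > 0" using M2[OF p1] s0 by linarith+
    have s\<sigma>: "s \<le> sqrt (s * \<xi>)" using \<xi>s s0 by (intro real_le_rsqrt) (simp add: power2_eq_square)
    have "\<xi> / s \<le> \<xi>" using \<xi>s sK(1) by (simp add: pos_divide_le_eq)
    also have "\<dots> \<le> s * \<xi>" using \<xi>s sK(1) by simp
    finally have r\<sigma>: "sqrt (\<xi> / s) \<le> sqrt (s * \<xi>)" by (rule real_sqrt_le_mono)
    have "k * norm (p - y) \<le> k * norm p + k * (2 * k * s)"
      using mult_left_mono[OF order_trans[OF norm_triangle_ineq4[of p y] add_left_mono[OF ny]], of k] k
        by (simp add: distrib_left)
    then have "d x p \<le> 4 * k\<^sup>2 * s + (k * norm p + k * (2 * k * s) + C1 * sqrt (\<xi> / s))"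
      using d_triangle[of x p y] dxy dyp[OF p1 p2] by linarith
    also have "\<dots> = k * norm p + 6 * k\<^sup>2 * s + C1 * sqrt (\<xi> / s)" by (simp add: power2_eq_square algebra_simps)
    also have "\<dots> \<le> k * norm p + 6 * k\<^sup>2 * sqrt (s * \<xi>) + C1 * sqrt (s * \<xi>)"
      using s\<sigma> r\<sigma> C1 k by (intro add_mono mult_left_mono) auto
    finally show "d x p \<le> k * norm p + A * sqrt (s * ((a \<bullet> p) / k\<^sup>2))"
      unfolding \<xi>_def[symmetric] by (simp add: A_def distrib_right)
  next
    fix p define \<xi> where "\<xi> = (a \<bullet> p) / k\<^sup>2"
    assume p1: "M * s \<le> (a \<bullet> p) / k\<^sup>2" and p3: "(a \<bullet> p) / k\<^sup>2 \<le> 2 * M * s"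
      and p2: "norm (p - ((a \<bullet> p) / k\<^sup>2) *\<^sub>R a) \<le> 2 * \<kappa> * ((a \<bullet> p) / k\<^sup>2)"
    note p1 = p1[folded \<xi>_def] and p2 = p2[folded \<xi>_def] and p3 = p3[folded \<xi>_def]
    have M0: "M > 0" using M16 by simp
    have "s * (g - 16 * k * \<kappa> - 2 * k * \<epsilon> - 4 * k\<^sup>2 / M) \<le> k * norm (x - p) - k * norm (p - y)"
      by (rule cone_far_point_estimate[OF na g_def p2 \<kappa>(1) \<kappa>4 M0 p1 s0 s(1,2)[folded x_def y_def] \<epsilon>k])
    moreover have "s * (g - g / 8 - (g / 8 - \<epsilon>) - g / 16) \<le> s * (g - 16 * k * \<kappa> - 2 * k * \<epsilon> - 4 * k\<^sup>2 / M)"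
      using \<kappa>g \<epsilon>g Mg s0 by (intro mult_left_mono) auto
    moreover have "bus \<gamma>2 t2 p \<ge> - ((k\<^sup>2 + \<epsilon>) * s) - d y p"
      using bus_le[OF r2, of y p] bus_ray[OF r2 s(6)] s(4) unfolding y_def by linarith
    moreover have "C1 * sqrt (\<xi> / s) \<le> g / 16 * s"
    proof -
      have "\<xi> / s \<le> 2 * M" using p3 s0 by (simp add: pos_divide_le_eq)
      then have "C1 * sqrt (\<xi> / s) \<le> C1 * sqrt (2 * M)" using C1 by (intro mult_left_mono real_sqrt_le_mono)
      also have "\<dots> \<le> g / 16 * s" using sK(2) g by (simp add: pos_divide_le_eq mult.commute)
      finally show ?thesis .
    qed
    moreover have "d y p \<le> k * norm (p - y) + C1 * sqrt (\<xi> / s)" by (rule dyp[OF p1 p2])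
    moreover have "k * norm (x - p) \<le> d x p" by (rule d_ge)
    \<comment> \<open>The errors use up three eighths of \<open>g\<close>; one half is kept in
      \<open>Q\<close>, and one eighth is to spare.\<close>
    moreover have "s * (g - g / 8 - (g / 8 - \<epsilon>) - g / 16) - (k\<^sup>2 + \<epsilon>) * s - g / 16 * s = - Q + s * g / 8"
      by (simp add: Q_def algebra_simps)
    moreover have "s * g / 8 \<ge> 0" using s0 g by simp
    ultimately show "- Q \<le> d x p + bus \<gamma>2 t2 p" by linarith
  qed
  \<comment> \<open>\<open>\<gamma>2 T\<close> is close to \<open>T *\<^sub>R a\<close>, but the
    descent measures height by \<open>(a \<bullet> p) / k\<^sup>2\<close>. This \<open>e\<close> is
    small enough for the height to be at least \<open>T / 2\<close> and for the point to lie in the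
    cone of aperture \<open>\<kappa>\<close> at its own height.\<close>
  define e where "e = min (k / 2) (\<kappa> / 4)"
  have e: "e > 0" "e \<le> k / 2" "e \<le> \<kappa> / 4" using k \<kappa> by (auto simp: e_def)
  have "- Q \<le> bus \<gamma>2 t2 x"
  proof (rule tendsto_lowerbound[OF bus_tendsto[OF r2]])
    have "\<forall>\<^sub>F T in at_top. norm (\<gamma>2 T - T *\<^sub>R a) \<le> e * T \<and> T > t2 \<and> T > max 1 (2 * (M * s))"
      by (intro eventually_conj rayD(4)[OF r2 e(1)] eventually_gt_at_top)
    then show "\<forall>\<^sub>F T in at_top. - Q \<le> d x (\<gamma>2 T) - d (\<gamma>2 T) (\<gamma>2 t2)"
    proof (rule eventually_mono, elim conjE)
      fix T assume T: "norm (\<gamma>2 T - T *\<^sub>R a) \<le> e * T" "T > t2" "T > max 1 (2 * (M * s))"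
      define p where "p = \<gamma>2 T"
      define \<xi> where "\<xi> = (a \<bullet> p) / k\<^sup>2"
      have T0: "T > 0" "2 * (M * s) \<le> T" using T(3) by auto
      have "\<xi> - T = (a \<bullet> (p - T *\<^sub>R a)) / k\<^sup>2"
        using k na(1) by (simp add: \<xi>_def inner_diff_right power2_norm_eq_inner[symmetric] diff_divide_distrib)
      also have "\<bar>\<dots>\<bar> \<le> k * (e * T) / k\<^sup>2"
      proof -
        have "\<bar>a \<bullet> (p - T *\<^sub>R a)\<bar> \<le> norm a * norm (p - T *\<^sub>R a)" by (rule Cauchy_Schwarz_ineq2)
        also have "\<dots> \<le> k * (e * T)" unfolding na using T(1) k by (intro mult_left_mono) (auto simp: p_def)
        finally show ?thesis unfolding abs_divide abs_power2 by (intro divide_right_mono) auto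
      qed
      also have "k * (e * T) / k\<^sup>2 = e * T / k" using k by (simp add: power2_eq_square)
      finally have \<xi>T: "\<bar>\<xi> - T\<bar> \<le> e * T / k" .
      have "e * T / k \<le> (k / 2) * T / k" using e T0 k by (intro divide_right_mono mult_right_mono) auto
      also have "\<dots> = T / 2" using k by simp
      finally have \<xi>2: "T / 2 \<le> \<xi>" using \<xi>T by linarith
      have "p - \<xi> *\<^sub>R a = (p - T *\<^sub>R a) + (T - \<xi>) *\<^sub>R a" by (simp add: scaleR_left_diff_distrib)
      then have "norm (p - \<xi> *\<^sub>R a) \<le> norm (p - T *\<^sub>R a) + norm ((T - \<xi>) *\<^sub>R a)" by (metis norm_triangle_ineq)
      also have "norm ((T - \<xi>) *\<^sub>R a) = \<bar>\<xi> - T\<bar> * k" using na by (simp add: abs_minus_commute)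
      also have "\<bar>\<xi> - T\<bar> * k \<le> e * T" using mult_right_mono[OF \<xi>T, of k] k by simp
      also have "norm (p - T *\<^sub>R a) \<le> e * T" using T(1) by (simp add: p_def)
      also have "e * T + e * T \<le> \<kappa> * \<xi>"
      proof -
        have "e * T \<le> \<kappa> / 4 * T" using e T0 by (intro mult_right_mono) auto
        moreover have "\<kappa> * (T / 2) \<le> \<kappa> * \<xi>" using \<xi>2 \<kappa> by (intro mult_left_mono) auto
        ultimately show ?thesis by linarith
      qed
      finally have "norm (p - \<xi> *\<^sub>R a) \<le> \<kappa> * \<xi>" by simp
      moreover have "M * s \<le> \<xi>" using \<xi>2 T0 by linarith
      ultimately have "- Q \<le> d x p + bus \<gamma>2 t2 p" using lower[of p, folded \<xi>_def] by blast
      then show "- Q \<le> d x (\<gamma>2 T) - d (\<gamma>2 T) (\<gamma>2 t2)"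
        using bus_ray[OF r2 T(2)] d_sym[of "\<gamma>2 T" "\<gamma>2 t2"] unfolding p_def by linarith
    qed
  qed simp
  moreover have "bus \<gamma>2 t2 x = - d (\<gamma>1 t1) x - c" using c[of x] bus_ray[OF r1 s(5)] unfolding x_def by linarith
  moreover have "k * (k * s - \<epsilon> * s - norm (\<gamma>1 t1)) \<le> d (\<gamma>1 t1) x"
  proof -
    have "norm (s *\<^sub>R a1) \<le> norm (x - s *\<^sub>R a1) + norm (\<gamma>1 t1 - x) + norm (\<gamma>1 t1)"
    proof -
      have "s *\<^sub>R a1 = (\<gamma>1 t1 - (\<gamma>1 t1 - x)) - (x - s *\<^sub>R a1)" by simp
      then have "norm (s *\<^sub>R a1) \<le> norm (\<gamma>1 t1 - (\<gamma>1 t1 - x)) + norm (x - s *\<^sub>R a1)" by (metis norm_triangle_ineq4)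
      then show ?thesis using norm_triangle_ineq4[of "\<gamma>1 t1" "\<gamma>1 t1 - x"] by linarith
    qed
    then have "k * s - \<epsilon> * s - norm (\<gamma>1 t1) \<le> norm (\<gamma>1 t1 - x)" using nsa s(1) unfolding x_def by linarith
    then have "k * (k * s - \<epsilon> * s - norm (\<gamma>1 t1)) \<le> k * norm (\<gamma>1 t1 - x)" using k by (intro mult_left_mono) auto
    then show ?thesis using d_ge[of "\<gamma>1 t1" x] by linarith
  qed
  moreover have "k * (k * s - \<epsilon> * s - norm (\<gamma>1 t1)) = k\<^sup>2 * s - (k * \<epsilon>) * s - k * norm (\<gamma>1 t1)"
    by (simp add: algebra_simps power2_eq_square)
  ultimately have "(g / 2) * s \<le> (k * \<epsilon>) * s + k * norm (\<gamma>1 t1) + \<bar>c\<bar>" unfolding Q_def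
    by (simp add: left_diff_distrib)
  moreover have "(k * \<epsilon>) * s \<le> g / 16 * s" using \<epsilon>g \<epsilon>(1) s0 by (intro mult_right_mono) auto
  moreover have "4 * (k * norm (\<gamma>1 t1) + \<bar>c\<bar>) < s * g" using sK(4) g by (simp add: pos_divide_less_eq)
  moreover have "s * g > 0" using s0 g by simp
  moreover have "(g / 2) * s = s * g / 2" "g / 16 * s = s * g / 16" by simp_all
  ultimately show False by argo
qed

end

subsection \<open>Geodesic rays of the N-body problem\<close>

text \<open>The Jacobi-Maupertuis distance in the coordinates \<open>sqrt (m i) *\<^sub>R x $ i\<close>, in which the mass norm is the norm
  of the library.\<close>

definition scaled_jm_dist ::
    "('n::{finite,linorder} \<Rightarrow> real) \<Rightarrow> real \<Rightarrow> ('a::euclidean_space, 'n) vec \<Rightarrow> ('a, 'n) vec \<Rightarrow> real" where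
  "scaled_jm_dist m h X Y = enn2real (jm_dist m h (mass_scale (\<lambda>i. inverse (m i)) X) (mass_scale (\<lambda>i. inverse (m i)) Y))"

text \<open>The type argument \<open>E\<close> ties the dimension hypothesis to the space of the
  bodies, which occurs in the type of neither \<open>m\<close> nor \<open>h\<close>.\<close>

locale n_body_space =
  fixes m :: "'n::{finite,linorder} \<Rightarrow> real" and h :: real and E :: "'a::euclidean_space itself"
  assumes m: "\<And>i. m i > 0" and h: "h > 0" and dim: "DIM('a) \<ge> 2"
begin

lemma scaled_jm_dist_scale: "scaled_jm_dist m h (mass_scale m x) (mass_scale m y) = enn2real (jm_dist m h x y)"
  by (simp add: scaled_jm_dist_def mass_scale_inverse(2)[OF m])

lemma jm_dist_eq_scaled:
  "jm_dist m h x y = ennreal (scaled_jm_dist m h (mass_scale m x) (mass_scale m (y :: ('a, 'n) vec)))"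
  unfolding scaled_jm_dist_scale using jm_dist_finite[of m h x y, OF m h dim] by (simp add: less_top)

lemma scaled_jm_dist_nonneg: "scaled_jm_dist m h X Y \<ge> 0"
  by (simp add: scaled_jm_dist_def)

lemma mass_scaleE: obtains x where "X = mass_scale m x"
  using mass_scale_inverse(1)[of m X, OF m] by metis

text \<open>Finiteness of the distance makes the passage to real values lossless, so that the
  inequalities between extended reals carry over.\<close>

sublocale asymptotic_geometry "scaled_jm_dist m h :: ('a, 'n) vec \<Rightarrow> ('a, 'n) vec \<Rightarrow> real" "sqrt (2 * h)"
proof
  fix X Y Z :: "('a, 'n) vec"
  obtain x where x: "X = mass_scale m x" by (rule mass_scaleE)
  obtain y where y: "Y = mass_scale m y" by (rule mass_scaleE)
  obtain z where z: "Z = mass_scale m z" by (rule mass_scaleE)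
  show "scaled_jm_dist m h X Y = scaled_jm_dist m h Y X"
    unfolding scaled_jm_dist_def by (subst jm_dist_sym[OF m]) (rule refl)
  have "ennreal (scaled_jm_dist m h X Z) \<le> ennreal (scaled_jm_dist m h X Y) + ennreal (scaled_jm_dist m h Y Z)"
    using jm_dist_triangle[of m h x z y, OF m] unfolding x y z jm_dist_eq_scaled .
  then show "scaled_jm_dist m h X Z \<le> scaled_jm_dist m h X Y + scaled_jm_dist m h Y Z"
    by (simp add: scaled_jm_dist_nonneg flip: ennreal_plus)
  have "ennreal (sqrt (2 * h) * norm (X - Y)) \<le> ennreal (scaled_jm_dist m h X Y)"
    using jm_dist_ge_norm[of m h x y, OF m less_imp_le[OF h]]
    unfolding x y jm_dist_eq_scaled mass_norm_scale[OF m] mass_scale_diff .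
  then show "sqrt (2 * h) * norm (X - Y) \<le> scaled_jm_dist m h X Y"
    by (simp add: scaled_jm_dist_nonneg)
next
  fix F :: "('a, 'n) vec \<Rightarrow> real" and \<epsilon> l :: real and X Y :: "('a, 'n) vec"
  assume F: "continuous_on UNIV F" and e: "\<epsilon> > 0" and l: "F X < l \<and> l < F Y \<or> F Y < l \<and> l < F X"
  obtain x where x: "X = mass_scale m x" by (rule mass_scaleE)
  obtain y where y: "Y = mass_scale m y" by (rule mass_scaleE)
  have "continuous_on UNIV (\<lambda>p. F (mass_scale m p))"
    by (rule continuous_on_compose2[OF F linear_continuous_on[OF bounded_linear_mass_scale]]) simp
  from jm_dist_intermediate_point[OF jm_dist_finite[of m h x y, OF m h dim] e this l[unfolded x y]]
  obtain p where p: "F (mass_scale m p) = l" "jm_dist m h x p + jm_dist m h p y \<le> jm_dist m h x y + ennreal \<epsilon>"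
    by blast
  from p(2) have "scaled_jm_dist m h X (mass_scale m p) + scaled_jm_dist m h (mass_scale m p) Y \<le> scaled_jm_dist m h X Y + \<epsilon>"
    unfolding x y jm_dist_eq_scaled using e by (simp add: scaled_jm_dist_nonneg flip: ennreal_plus)
  with p(1) show "\<exists>p. F p = l \<and> scaled_jm_dist m h X p + scaled_jm_dist m h p Y \<le> scaled_jm_dist m h X Y + \<epsilon>" by blast
qed (simp add: h)

text \<open>By convexity a segment between points of the cone at scales \<open>\<alpha>\<close> and
  \<open>\<beta>\<close> stays in it at the interpolated scale, where the potential is at most
  \<open>P / \<rho>\<close> divided by that scale. Integration gives a multiple of
  \<open>1 / t\<close> for equal scales and the logarithm otherwise; the remaining factor is the
  travelling time.\<close>

lemma cone_bounds_Omega: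
  fixes a :: "('a, 'n) vec"
  assumes a: "a \<in> Omega"
  shows "\<exists>\<kappa> C. cone_bounds (mass_scale m a) \<kappa> C"
proof -
  obtain \<kappa> where \<kappa>: "\<kappa> > 0" and "\<exists>\<rho>>0. \<forall>x \<xi> i j. \<xi> > 0 \<longrightarrow> mass_norm m (x - \<xi> *\<^sub>R a) \<le> \<kappa> * \<xi> \<longrightarrow> i \<noteq> j \<longrightarrow>
      \<rho> * \<xi> \<le> norm (x $ i - x $ j)"
    using shape_cone_separated[of m a, OF m a] by (elim exE, elim conjE) (rule that)
  then obtain \<rho> where \<rho>: "\<rho> > 0" and sep: "\<And>x \<xi> i j. \<xi> > 0 \<Longrightarrow> mass_norm m (x - \<xi> *\<^sub>R a) \<le> \<kappa> * \<xi> \<Longrightarrow> i \<noteq> j \<Longrightarrow>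
      \<rho> * \<xi> \<le> norm (x $ i - x $ j)" by blast
  define P where "P = pair_mass m"
  have P: "P \<ge> 0" unfolding P_def by (rule pair_mass_nonneg[OF m])
  define k where "k = sqrt (2 * h)"
  have k0: "k > 0" using h by (simp add: k_def)
  have pot: "potential m (x + \<tau> *\<^sub>R (y - x)) \<le> ennreal (P / (\<rho> * (\<alpha> + \<tau> * (\<beta> - \<alpha>))))"
    if \<alpha>: "0 < \<alpha>" "\<alpha> \<le> \<beta>" and x: "mass_norm m (x - \<alpha> *\<^sub>R a) \<le> \<kappa> * \<alpha>" and y: "mass_norm m (y - \<beta> *\<^sub>R a) \<le> \<kappa> * \<beta>"
      and \<tau>: "\<tau> \<in> {0..1}" for x y \<alpha> \<beta> \<tau>
  proof -
    define \<xi> where "\<xi> = \<alpha> + \<tau> * (\<beta> - \<alpha>)"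
    have \<xi>: "\<xi> > 0" unfolding \<xi>_def using \<alpha> \<tau> by (intro add_pos_nonneg mult_nonneg_nonneg) auto
    have "x + \<tau> *\<^sub>R (y - x) - \<xi> *\<^sub>R a = (1 - \<tau>) *\<^sub>R (x - \<alpha> *\<^sub>R a) + \<tau> *\<^sub>R (y - \<beta> *\<^sub>R a)"
      by (simp add: \<xi>_def algebra_simps)
    then have "mass_norm m (x + \<tau> *\<^sub>R (y - x) - \<xi> *\<^sub>R a) =
        norm ((1 - \<tau>) *\<^sub>R mass_scale m (x - \<alpha> *\<^sub>R a) + \<tau> *\<^sub>R mass_scale m (y - \<beta> *\<^sub>R a))"
      by (simp add: mass_norm_scale[OF m] linear_add[OF linear_mass_scale] linear_scale[OF linear_mass_scale])
    also have "\<dots> \<le> (1 - \<tau>) * mass_norm m (x - \<alpha> *\<^sub>R a) + \<tau> * mass_norm m (y - \<beta> *\<^sub>R a)"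
      unfolding mass_norm_scale[OF m] by (rule norm_triangle_le) (use \<tau> in simp)
    also have "\<dots> \<le> (1 - \<tau>) * (\<kappa> * \<alpha>) + \<tau> * (\<kappa> * \<beta>)" using x y \<tau> by (intro add_mono mult_left_mono) auto
    also have "\<dots> = \<kappa> * \<xi>" by (simp add: \<xi>_def algebra_simps)
    finally show ?thesis unfolding P_def \<xi>_def[symmetric] by (intro potential_le[OF m] mult_pos_pos[OF \<rho> \<xi>] sep[OF \<xi>])
  qed
  have G0: "0 \<le> P / (\<rho> * (\<alpha> + \<tau> * (\<beta> - \<alpha>)))" if "0 < \<alpha>" "\<alpha> \<le> \<beta>" "\<tau> \<in> {0..1}" for \<alpha> \<beta> \<tau>
    using that P \<rho> by (intro divide_nonneg_nonneg mult_nonneg_nonneg add_nonneg_nonneg) auto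
  have seg: "scaled_jm_dist m h X Y \<le> k * norm (X - Y) + norm (X - Y) / k * I"
    if \<alpha>: "0 < \<alpha>" "\<alpha> \<le> \<beta>" and XY: "X \<noteq> Y"
      and X: "norm (X - \<alpha> *\<^sub>R mass_scale m a) \<le> \<kappa> * \<alpha>" and Y: "norm (Y - \<beta> *\<^sub>R mass_scale m a) \<le> \<kappa> * \<beta>"
      and I: "((\<lambda>\<tau>. P / (\<rho> * (\<alpha> + \<tau> * (\<beta> - \<alpha>)))) has_integral I) {0..1}" for X Y :: "('a, 'n) vec" and \<alpha> \<beta> I
  proof -
    obtain x where x: "X = mass_scale m x" by (rule mass_scaleE)
    obtain y where y: "Y = mass_scale m y" by (rule mass_scaleE)
    have "mass_norm m (x - \<alpha> *\<^sub>R a) \<le> \<kappa> * \<alpha>" "mass_norm m (y - \<beta> *\<^sub>R a) \<le> \<kappa> * \<beta>"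
      using X Y unfolding x y
        by (simp_all add: mass_norm_scale[OF m] mass_scale_diff linear_scale[OF linear_mass_scale])
    note pot = pot[OF \<alpha> this]
    have "jm_dist m h x y \<le> ennreal (k * mass_norm m (y - x) + mass_norm m (y - x) / k * I)"
      unfolding k_def by (rule jm_dist_segment_le[OF m h _ I G0[OF \<alpha>] pot]) (use XY x y in auto)
    then have "ennreal (scaled_jm_dist m h X Y) \<le> ennreal (k * norm (X - Y) + norm (X - Y) / k * I)"
      unfolding jm_dist_eq_scaled x y mass_norm_scale[OF m] mass_scale_diff by (simp add: norm_minus_commute)
    moreover have "I \<ge> 0" by (rule has_integral_nonneg[OF I G0[OF \<alpha>]])
    ultimately show ?thesis using k0
      by (subst (asm) ennreal_le_iff) (auto intro!: add_nonneg_nonneg mult_nonneg_nonneg divide_nonneg_nonneg)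
  qed
  have "cone_bounds (mass_scale m a) \<kappa> (P / (\<rho> * k))"
    unfolding cone_bounds_def unfolding k_def[symmetric]
  proof (intro conjI allI impI)
    show "\<kappa> > 0" "P / (\<rho> * k) \<ge> 0" using \<kappa> P \<rho> k0 by auto
  next
    fix t and X Y :: "('a, 'n) vec"
    assume t: "t > 0" "X \<noteq> Y" "norm (X - t *\<^sub>R mass_scale m a) \<le> \<kappa> * t" "norm (Y - t *\<^sub>R mass_scale m a) \<le> \<kappa> * t"
    have "((\<lambda>\<tau>. P / (\<rho> * (t + \<tau> * (t - t)))) has_integral P / (\<rho> * t)) {0..1}"
      using has_integral_const_real[of "P / (\<rho> * t)" 0 1] by simp
    from seg[OF t(1) order_refl t(2-4) this]
    show "scaled_jm_dist m h X Y \<le> k * norm (X - Y) + P / (\<rho> * k) * norm (X - Y) / t" by (simp add: mult_ac)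
  next
    fix \<alpha> \<beta> and X Y :: "('a, 'n) vec"
    assume t: "0 < \<alpha>" "\<alpha> < \<beta>" "X \<noteq> Y" "norm (X - \<alpha> *\<^sub>R mass_scale m a) \<le> \<kappa> * \<alpha>" "norm (Y - \<beta> *\<^sub>R mass_scale m a) \<le> \<kappa> * \<beta>"
    define F where "F \<tau> = P / (\<rho> * (\<beta> - \<alpha>)) * ln (\<alpha> + \<tau> * (\<beta> - \<alpha>))" for \<tau>
    have "((\<lambda>\<tau>. P / (\<rho> * (\<alpha> + \<tau> * (\<beta> - \<alpha>)))) has_integral F 1 - F 0) {0..1}"
    proof (rule fundamental_theorem_of_calculus)
      fix \<tau> :: real assume \<tau>: "\<tau> \<in> {0..1}"
      have "\<alpha> + \<tau> * (\<beta> - \<alpha>) > 0" using t \<tau> by (intro add_pos_nonneg mult_nonneg_nonneg) auto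
      then have "(F has_real_derivative P / (\<rho> * (\<beta> - \<alpha>)) * (inverse (\<alpha> + \<tau> * (\<beta> - \<alpha>)) * (\<beta> - \<alpha>))) (at \<tau> within {0..1})"
        unfolding F_def by (auto intro!: derivative_eq_intros simp: divide_inverse)
      moreover have "P / (\<rho> * (\<beta> - \<alpha>)) * (inverse (\<alpha> + \<tau> * (\<beta> - \<alpha>)) * (\<beta> - \<alpha>)) = P / (\<rho> * (\<alpha> + \<tau> * (\<beta> - \<alpha>)))"
      proof -
        have "P / (\<rho> * w) * (inverse z * w) = P / (\<rho> * z)" if "w \<noteq> 0" for w z using that
          by (cases "z = 0") (simp_all add: field_simps)
        then show ?thesis by this (use t in simp)
      qed
      ultimately show "(F has_vector_derivative P / (\<rho> * (\<alpha> + \<tau> * (\<beta> - \<alpha>)))) (at \<tau> within {0..1})"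
        by (simp only: has_real_derivative_iff_has_vector_derivative)
    qed simp
    from seg[OF t(1) less_imp_le[OF t(2)] t(3-5) this]
    have "scaled_jm_dist m h X Y \<le> k * norm (X - Y) + norm (X - Y) / k * (F 1 - F 0)" .
    also have "F 1 - F 0 = P / (\<rho> * (\<beta> - \<alpha>)) * ln (\<beta> / \<alpha>)"
      unfolding F_def using t by (simp add: ln_div right_diff_distrib)
    also have "norm (X - Y) / k * (P / (\<rho> * (\<beta> - \<alpha>)) * ln (\<beta> / \<alpha>)) = P / (\<rho> * k) * (norm (X - Y) / (\<beta> - \<alpha>)) * ln (\<beta> / \<alpha>)"
      by (simp only: divide_inverse inverse_mult_distrib mult_ac)
    finally show "scaled_jm_dist m h X Y \<le> k * norm (X - Y) + P / (\<rho> * k) * (norm (X - Y) / (\<beta> - \<alpha>)) * ln (\<beta> / \<alpha>)" .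
  qed
  then show ?thesis by blast
qed

lemma scaled_ray:
  fixes \<gamma> :: "real \<Rightarrow> ('a, 'n) vec"
  assumes g: "hyperbolic_geodesic_ray m h t0 \<gamma>" and a: "has_limit_shape m \<gamma> a"
  shows "ray (\<lambda>t. mass_scale m (\<gamma> t)) t0 (mass_scale m a)"
  unfolding ray_def
proof (intro conjI allI impI)
  have "(norm (mass_scale m a))\<^sup>2 = 2 * h" using ray_energy_and_action(1)[OF m h g a]
    by (simp add: mass_norm_scale[OF m])
  then show "norm (mass_scale m a) = sqrt (2 * h)" by (metis norm_ge_zero real_sqrt_unique)
  show "\<exists>\<kappa> C. cone_bounds (mass_scale m a) \<kappa> C" using a by (intro cone_bounds_Omega) (simp add: has_limit_shape_def)
next
  fix s t assume "t0 < s" "s < t"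
  from ray_jm_dist_additive[OF g m this]
  show "scaled_jm_dist m h (mass_scale m (\<gamma> t0)) (mass_scale m (\<gamma> t)) =
      scaled_jm_dist m h (mass_scale m (\<gamma> t0)) (mass_scale m (\<gamma> s)) + scaled_jm_dist m h (mass_scale m (\<gamma> s)) (mass_scale m (\<gamma> t))"
    unfolding jm_dist_eq_scaled by (simp add: scaled_jm_dist_nonneg flip: ennreal_plus)
next
  fix \<epsilon> :: real assume e: "\<epsilon> > 0"
  have "\<forall>\<^sub>F t in at_top. norm (mass_norm m (\<gamma> t - t *\<^sub>R a)) \<le> \<epsilon> * norm t"
    using a e unfolding has_limit_shape_def by (auto dest: landau_o.smallD)
  then show "\<forall>\<^sub>F t in at_top. norm (mass_scale m (\<gamma> t) - t *\<^sub>R mass_scale m a) \<le> \<epsilon> * t"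
    using eventually_gt_at_top[of 0]
    by eventually_elim (simp add: mass_norm_scale[OF m] mass_scale_diff linear_scale[OF linear_mass_scale])
next
  fix \<epsilon> :: real assume e: "\<epsilon> > 0"
  then have "\<epsilon> / 2 > 0" by simp
  from ray_energy_and_action(2)[OF m h g a this]
  obtain T where T: "T > t0" "\<And>t. t \<ge> T \<Longrightarrow> action m h T t \<gamma> \<le> ennreal ((2 * h + \<epsilon> / 2) * (t - T))" by blast
  \<comment> \<open>What the part of the ray before \<open>T\<close> costs beyond the linear rate;
    half of \<open>\<epsilon>\<close> absorbs it for large \<open>t\<close>.\<close>
  define D where "D = scaled_jm_dist m h (mass_scale m (\<gamma> t0)) (mass_scale m (\<gamma> T)) - (2 * h + \<epsilon> / 2) * T"
  show "\<forall>\<^sub>F t in at_top. scaled_jm_dist m h (mass_scale m (\<gamma> t0)) (mass_scale m (\<gamma> t)) \<le> ((sqrt (2 * h))\<^sup>2 + \<epsilon>) * t"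
    using eventually_gt_at_top[of T] eventually_ge_at_top[of "2 * D / \<epsilon>"]
  proof eventually_elim
    fix t assume t: "T < t" "2 * D / \<epsilon> \<le> t"
    have "abs_continuous_on {t0..t} \<gamma>" using g t T by (auto simp: hyperbolic_geodesic_ray_def)
    then have "abs_continuous_on {T..t} \<gamma>" by (rule abs_continuous_on_subset) (use T in auto)
    from order_trans[OF jm_dist_le_action[OF t(1) this] T(2)[OF less_imp_le[OF t(1)]]]
    have "scaled_jm_dist m h (mass_scale m (\<gamma> T)) (mass_scale m (\<gamma> t)) \<le> (2 * h + \<epsilon> / 2) * (t - T)"
      unfolding jm_dist_eq_scaled using h e t by (subst (asm) ennreal_le_iff) auto
    moreover have "D \<le> \<epsilon> / 2 * t" using t(2) e by (simp add: pos_divide_le_eq mult.commute)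
    ultimately have "scaled_jm_dist m h (mass_scale m (\<gamma> t0)) (mass_scale m (\<gamma> t)) \<le> (2 * h + \<epsilon>) * t"
      using d_triangle[of "mass_scale m (\<gamma> t0)" "mass_scale m (\<gamma> t)" "mass_scale m (\<gamma> T)"]
      unfolding D_def ring_distribs by linarith
    then show "scaled_jm_dist m h (mass_scale m (\<gamma> t0)) (mass_scale m (\<gamma> t)) \<le> ((sqrt (2 * h))\<^sup>2 + \<epsilon>) * t"
      using h by simp
  qed
qed

lemma busemann_eq_bus: "busemann m h t0 \<gamma> x = bus (\<lambda>t. mass_scale m (\<gamma> t)) t0 (mass_scale m (x :: ('a, 'n) vec))"
  by (simp add: busemann_def bus_def scaled_jm_dist_scale)

lemma same_shape_eventually_bounded:
  fixes \<gamma>1 \<gamma>2 :: "real \<Rightarrow> ('a, 'n) vec"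
  assumes g: "hyperbolic_geodesic_ray m h t1 \<gamma>1" "hyperbolic_geodesic_ray m h t2 \<gamma>2"
    and a: "has_limit_shape m \<gamma>1 a" "has_limit_shape m \<gamma>2 a"
  shows "\<exists>B. \<forall>\<^sub>F t in at_top. norm (mass_scale m (\<gamma>1 t) - mass_scale m (\<gamma>2 t)) \<le> B"
proof -
  obtain v1 f1 where 1: "\<And>t. t > t1 \<Longrightarrow> (\<gamma>1 has_vector_derivative v1 t) (at t)"
    "\<And>t. t > t1 \<Longrightarrow> (v1 has_vector_derivative f1 t) (at t)"
    "\<And>t. t > t1 \<Longrightarrow> has_mass_gradient m (\<lambda>y. enn2real (potential m y)) (\<gamma>1 t) (f1 t)"
    "\<And>t. t > t1 \<Longrightarrow> \<gamma>1 t \<in> Omega"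
    by (rule hyperbolic_geodesic_rayE[OF g(1)]) (rule that)
  obtain v2 f2 where 2: "\<And>t. t > t2 \<Longrightarrow> (\<gamma>2 has_vector_derivative v2 t) (at t)"
    "\<And>t. t > t2 \<Longrightarrow> (v2 has_vector_derivative f2 t) (at t)"
    "\<And>t. t > t2 \<Longrightarrow> has_mass_gradient m (\<lambda>y. enn2real (potential m y)) (\<gamma>2 t) (f2 t)"
    "\<And>t. t > t2 \<Longrightarrow> \<gamma>2 t \<in> Omega"
    by (rule hyperbolic_geodesic_rayE[OF g(2)]) (rule that)
  have "\<exists>C T. \<forall>t\<ge>T. mass_norm m (\<gamma>1 t - \<gamma>2 t) \<le> C"
    by (rule hyperbolic_motions_same_shape_bounded[of m "max t1 t2" \<gamma>1 v1 f1 \<gamma>2 v2 f2 a]) (use m 1 2 a in auto)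
  then show ?thesis unfolding mass_norm_scale[OF m] mass_scale_diff eventually_at_top_linorder by blast
qed

lemma shape_if_bounded_distance:
  fixes \<gamma>1 \<gamma>2 :: "real \<Rightarrow> ('a, 'n) vec"
  assumes a: "has_limit_shape m \<gamma>1 a" and C: "\<And>t. t \<ge> T \<Longrightarrow> mass_norm m (\<gamma>1 t - \<gamma>2 t) \<le> C"
  shows "has_limit_shape m \<gamma>2 a"
proof -
  have "(\<lambda>t. C) \<in> o[at_top](\<lambda>t::real. t)"
  proof (rule smalloI_tendsto)
    show "((\<lambda>t::real. C / t) \<longlongrightarrow> 0) at_top" by real_asymp
    show "\<forall>\<^sub>F t in at_top. t \<noteq> (0::real)" using eventually_gt_at_top[of "0::real"] by eventually_elim simp
  qed
  moreover have "(\<lambda>t. mass_norm m (\<gamma>1 t - t *\<^sub>R a)) \<in> o[at_top](\<lambda>t. t)" using a by (simp add: has_limit_shape_def)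
  ultimately have o: "(\<lambda>t. C + mass_norm m (\<gamma>1 t - t *\<^sub>R a)) \<in> o[at_top](\<lambda>t. t)" by (rule sum_in_smallo)
  have "mass_norm m (\<gamma>2 t - t *\<^sub>R a) \<le> C + mass_norm m (\<gamma>1 t - t *\<^sub>R a)" if "t \<ge> T" for t
    using C[OF that] norm_triangle_ineq4[of "mass_scale m (\<gamma>1 t - t *\<^sub>R a)" "mass_scale m (\<gamma>1 t - \<gamma>2 t)"]
    unfolding mass_norm_scale[OF m] by (simp add: mass_scale_diff)
  from order_trans[OF this abs_ge_self] have "norm (mass_norm m (\<gamma>2 t - t *\<^sub>R a)) \<le> 1 * norm (C + mass_norm m (\<gamma>1 t - t *\<^sub>R a))"
    if "t \<ge> T" for t
    using that by (simp add: mass_norm_scale[OF m])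
  then have "(\<lambda>t. mass_norm m (\<gamma>2 t - t *\<^sub>R a)) \<in> O[at_top](\<lambda>t. C + mass_norm m (\<gamma>1 t - t *\<^sub>R a))"
    by (intro bigoI[where c = 1]) (auto simp: eventually_at_top_linorder)
  from landau_o.big_small_trans[OF this o] have "(\<lambda>t. mass_norm m (\<gamma>2 t - t *\<^sub>R a)) \<in> o[at_top](\<lambda>t. t)" .
  then show ?thesis using a by (simp add: has_limit_shape_def)
qed

text \<open>Late on, both points lie in the cone at bounded distance and the cone bound applies.
  Before \<open>T\<close> the distances from each start are bounded by additivity, and the triangle
  inequality goes through both starts.\<close>

lemma jm_bounded_if_same_shape:
  fixes \<gamma>1 \<gamma>2 :: "real \<Rightarrow> ('a, 'n) vec"
  assumes g: "hyperbolic_geodesic_ray m h t1 \<gamma>1" "hyperbolic_geodesic_ray m h t2 \<gamma>2"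
    and a: "has_limit_shape m \<gamma>1 a" "has_limit_shape m \<gamma>2 a"
  shows "\<exists>C. \<forall>t\<ge>max t1 t2. jm_dist m h (\<gamma>1 t) (\<gamma>2 t) \<le> ennreal C"
proof -
  define \<Gamma>1 \<Gamma>2 A where "\<Gamma>1 t = mass_scale m (\<gamma>1 t)" and "\<Gamma>2 t = mass_scale m (\<gamma>2 t)" and "A = mass_scale m a" for t
  define k where "k = sqrt (2 * h)"
  have k0: "k \<ge> 0" using h by (simp add: k_def)
  let ?d = "scaled_jm_dist m h :: ('a, 'n) vec \<Rightarrow> ('a, 'n) vec \<Rightarrow> real"
  have r: "ray \<Gamma>1 t1 A" "ray \<Gamma>2 t2 A"
    using scaled_ray[OF g(1) a(1)] scaled_ray[OF g(2) a(2)] unfolding \<Gamma>1_def[abs_def] \<Gamma>2_def[abs_def] A_def by blast+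
  obtain \<kappa> C where cone: "cone_bounds A \<kappa> C" using rayD(2)[OF r(1)] by blast
  then have \<kappa>: "\<kappa> / 2 > 0" and C: "C \<ge> 0"
    and near: "\<And>t x y. t > 0 \<Longrightarrow> x \<noteq> y \<Longrightarrow> norm (x - t *\<^sub>R A) \<le> \<kappa> * t \<Longrightarrow> norm (y - t *\<^sub>R A) \<le> \<kappa> * t \<Longrightarrow>
      ?d x y \<le> k * norm (x - y) + C * norm (x - y) / t" unfolding cone_bounds_def k_def by auto
  obtain B where B: "\<forall>\<^sub>F t in at_top. norm (\<Gamma>1 t - \<Gamma>2 t) \<le> B"
    using same_shape_eventually_bounded[OF g a] unfolding \<Gamma>1_def \<Gamma>2_def by blast
  have "\<forall>\<^sub>F t in at_top. norm (\<Gamma>1 t - t *\<^sub>R A) \<le> \<kappa> / 2 * t \<and> norm (\<Gamma>2 t - t *\<^sub>R A) \<le> \<kappa> / 2 * t \<and> norm (\<Gamma>1 t - \<Gamma>2 t) \<le> B \<and> t > max 1 (max t1 t2)"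
    by (intro eventually_conj rayD(4)[OF r(1) \<kappa>] rayD(4)[OF r(2) \<kappa>] B eventually_gt_at_top)
  then obtain T where T: "\<And>t. t \<ge> T \<Longrightarrow> norm (\<Gamma>1 t - t *\<^sub>R A) \<le> \<kappa> / 2 * t \<and> norm (\<Gamma>2 t - t *\<^sub>R A) \<le> \<kappa> / 2 * t \<and> norm (\<Gamma>1 t - \<Gamma>2 t) \<le> B \<and> t > max 1 (max t1 t2)"
    unfolding eventually_at_top_linorder by blast
  have near': "?d x y \<le> k * R + C * R"
    if t: "t \<ge> T" and "x \<noteq> y" "norm (x - t *\<^sub>R A) \<le> \<kappa> * t" "norm (y - t *\<^sub>R A) \<le> \<kappa> * t" and R: "norm (x - y) \<le> R"
      for t x y R
  proof -
    have t1: "t > 1" using T[OF t] by simp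
    have "norm (x - y) / t \<le> R / 1" using t1 R by (intro frac_le) (auto intro: order_trans[OF norm_ge_zero])
    then have "C * (norm (x - y) / t) \<le> C * R" using C by (intro mult_left_mono) auto
    moreover have "k * norm (x - y) \<le> k * R" using R k0 by (rule mult_left_mono)
    ultimately show ?thesis using near[of t x y] that t1 by simp
  qed
  define R where "R = k * (\<kappa> / 2) + C * (\<kappa> / 2)"
  define M where "M = max (k * B + C * B) (2 * R)"
  have late: "?d (\<Gamma>1 t) (\<Gamma>2 t) \<le> M" if t: "t \<ge> T" for t
  proof -
    have t1: "t > 1" using T[OF t] by simp
    have cone2: "norm (\<Gamma>1 t - t *\<^sub>R A) \<le> \<kappa> * t" "norm (\<Gamma>2 t - t *\<^sub>R A) \<le> \<kappa> * t"
      using T[OF t] mult_pos_pos[OF \<kappa>, of t] t1 by (auto simp: field_simps)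
    show ?thesis
    proof (cases "\<Gamma>1 t = \<Gamma>2 t")
      case False
      then have "?d (\<Gamma>1 t) (\<Gamma>2 t) \<le> k * B + C * B" using near'[OF t False cone2] T[OF t] by blast
      then show ?thesis unfolding M_def by (rule max.coboundedI1)
    next
      \<comment> \<open>The cone bound is for distinct points. The distance of a point to itself is
        an infimum over curves of positive duration; it is bounded here by an excursion to
        \<open>z\<close> and back.\<close>
      case True
      obtain b :: "('a, 'n) vec" where b: "b \<in> Basis" using nonempty_Basis by blast
      define z where "z = \<Gamma>1 t + (\<kappa> / 2) *\<^sub>R b"
      have z: "norm (\<Gamma>1 t - z) = \<kappa> / 2" using b \<kappa> by (simp add: z_def)
      have "z - t *\<^sub>R A = (\<Gamma>1 t - t *\<^sub>R A) - (\<Gamma>1 t - z)" by simp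
      then have "norm (z - t *\<^sub>R A) \<le> norm (\<Gamma>1 t - t *\<^sub>R A) + norm (\<Gamma>1 t - z)" by (metis norm_triangle_ineq4)
      also have "\<dots> \<le> \<kappa> / 2 * t + \<kappa> / 2 * t" using T[OF t] z mult_left_mono[OF less_imp_le[OF t1] less_imp_le[OF \<kappa>]]
        by linarith
      finally have zc: "norm (z - t *\<^sub>R A) \<le> \<kappa> * t" by simp
      have "\<Gamma>1 t \<noteq> z" using z \<kappa> by auto
      from near'[OF t this cone2(1) zc eq_refl[OF z]]
      have "?d (\<Gamma>1 t) (\<Gamma>1 t) \<le> 2 * R"
        using d_triangle[of "\<Gamma>1 t" "\<Gamma>1 t" z] d_sym[of z "\<Gamma>1 t"] unfolding R_def[symmetric] by linarith
      then show ?thesis unfolding M_def True[symmetric] by (rule max.coboundedI2)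
    qed
  qed
  have start: "?d (\<gamma> t0) (\<gamma> t) \<le> ?d (\<gamma> t0) (\<gamma> t0) + ?d (\<gamma> t0) (\<gamma> T)" if r: "ray \<gamma> t0 A" and t: "t0 \<le> t" "t \<le> T"
    for \<gamma> t0 t
  proof -
    consider "t = t0" | "t = T" | "t0 < t" "t < T" using t by linarith
    then show ?thesis
    proof cases
      case 3
      then show ?thesis using rayD(3)[OF r 3] d_nonneg[of "\<gamma> t" "\<gamma> T"] d_nonneg[of "\<gamma> t0" "\<gamma> t0"] by linarith
    qed (use d_nonneg[of "\<gamma> t0" "\<gamma> t0"] d_nonneg[of "\<gamma> t0" "\<gamma> T"] in auto)
  qed
  define M' where "M' = ?d (\<Gamma>1 t1) (\<Gamma>1 t1) + ?d (\<Gamma>1 t1) (\<Gamma>1 T) + ?d (\<Gamma>1 t1) (\<Gamma>2 t2) + ?d (\<Gamma>2 t2) (\<Gamma>2 t2) + ?d (\<Gamma>2 t2) (\<Gamma>2 T)"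
  have "?d (\<Gamma>1 t) (\<Gamma>2 t) \<le> max M M'" if "t \<ge> max t1 t2" for t
  proof (cases "t \<ge> T")
    case False
    then have "?d (\<Gamma>1 t) (\<Gamma>2 t) \<le> M'"
      using start[OF r(1), of t] start[OF r(2), of t] that d_sym[of "\<Gamma>1 t" "\<Gamma>1 t1"]
        d_triangle[of "\<Gamma>1 t" "\<Gamma>2 t" "\<Gamma>1 t1"] d_triangle[of "\<Gamma>1 t1" "\<Gamma>2 t" "\<Gamma>2 t2"] unfolding M'_def by simp
    then show ?thesis by simp
  qed (use late in \<open>auto simp: le_max_iff_disj\<close>)
  then have "\<forall>t\<ge>max t1 t2. jm_dist m h (\<gamma>1 t) (\<gamma>2 t) \<le> ennreal (max M M')"
    unfolding jm_dist_eq_scaled \<Gamma>1_def \<Gamma>2_def by (intro allI impI ennreal_leI) blast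
  then show ?thesis by blast
qed

lemma norm_bounded_if_jm_bounded:
  fixes x y :: "('a, 'n) vec"
  assumes "jm_dist m h x y \<le> ennreal C"
  shows "mass_norm m (x - y) \<le> max 0 C / sqrt (2 * h)"
proof -
  \<comment> \<open>\<open>ennreal C\<close> is 0 for negative \<open>C\<close>, hence the
    maximum.\<close>
  have "ennreal (sqrt (2 * h) * mass_norm m (x - y)) \<le> ennreal (max 0 C)"
    using order_trans[OF jm_dist_ge_norm[of m h x y, OF m less_imp_le[OF h]] assms] by (simp add: ennreal_max_0)
  then show ?thesis using h by (simp add: pos_le_divide_eq mult.commute)
qed

end

theorem theorem1p1:
  fixes m :: "'n::{finite,linorder} \<Rightarrow> real"
    and \<gamma>1 \<gamma>2 :: "real \<Rightarrow> ('a::euclidean_space, 'n) vec"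
    and h t1 t2 :: real
  assumes "DIM('a) \<ge> 2" and "CARD('n) \<ge> 2"
    and "\<And>i. m i > 0"
    and "h > 0"
    and "hyperbolic_geodesic_ray m h t1 \<gamma>1"
    and "hyperbolic_geodesic_ray m h t2 \<gamma>2"
  shows "let
      bounded_euclidean = (\<exists>C. \<forall>t\<ge>max t1 t2. mass_norm m (\<gamma>1 t - \<gamma>2 t) \<le> C);
      bounded_jm = (\<exists>C. \<forall>t\<ge>max t1 t2. jm_dist m h (\<gamma>1 t) (\<gamma>2 t) \<le> ennreal C);
      same_limit_shape = (\<exists>a. has_limit_shape m \<gamma>1 a \<and> has_limit_shape m \<gamma>2 a);
      busemann_differ_by_const = (\<exists>c. \<forall>x. busemann m h t1 \<gamma>1 x = busemann m h t2 \<gamma>2 x + c)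
    in (bounded_euclidean \<longleftrightarrow> bounded_jm) \<and>
       (bounded_jm \<longleftrightarrow> same_limit_shape) \<and>
       (same_limit_shape \<longleftrightarrow> busemann_differ_by_const)"
proof -
  interpret n_body_space m h "TYPE('a)" by (rule n_body_space.intro) (rule assms)+
  note g = assms(5,6)
  obtain a1 where a1: "has_limit_shape m \<gamma>1 a1" using g(1)
    by (auto simp: hyperbolic_geodesic_ray_def hyperbolic_motion_def)
  obtain a2 where a2: "has_limit_shape m \<gamma>2 a2" using g(2)
    by (auto simp: hyperbolic_geodesic_ray_def hyperbolic_motion_def)
  define E J S B where
    "E \<longleftrightarrow> (\<exists>C. \<forall>t\<ge>max t1 t2. mass_norm m (\<gamma>1 t - \<gamma>2 t) \<le> C)" and
    "J \<longleftrightarrow> (\<exists>C. \<forall>t\<ge>max t1 t2. jm_dist m h (\<gamma>1 t) (\<gamma>2 t) \<le> ennreal C)" and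
    "S \<longleftrightarrow> (\<exists>a. has_limit_shape m \<gamma>1 a \<and> has_limit_shape m \<gamma>2 a)" and
    "B \<longleftrightarrow> (\<exists>c. \<forall>x. busemann m h t1 \<gamma>1 x = busemann m h t2 \<gamma>2 x + c)"
  \<comment> \<open>A bounded difference is \<open>o(t)\<close>. The implications from
    \<open>E\<close> to \<open>S\<close>, from \<open>S\<close> to \<open>J\<close> and from
    \<open>J\<close> to \<open>E\<close> form a cycle, and \<open>B\<close> is linked to
    \<open>S\<close> in both directions.\<close>
  have "S" if E
    using that shape_if_bounded_distance[OF a1] a1 unfolding E_def S_def by blast
  moreover have "J" if S
    using that jm_bounded_if_same_shape[OF g] unfolding S_def J_def by blast
  moreover have "E" if J
    using that norm_bounded_if_jm_bounded unfolding J_def E_def by blast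
  moreover have "B" if S
  proof -
    from that obtain a where a: "has_limit_shape m \<gamma>1 a" "has_limit_shape m \<gamma>2 a" unfolding S_def by blast
    obtain R where "\<forall>\<^sub>F t in at_top. norm (mass_scale m (\<gamma>1 t) - mass_scale m (\<gamma>2 t)) \<le> R"
      using same_shape_eventually_bounded[OF g a] by blast
    from bus_differ_by_constant[OF scaled_ray[OF g(1) a(1)] scaled_ray[OF g(2) a(2)] this]
    show ?thesis unfolding B_def busemann_eq_bus by blast
  qed
  moreover have "S" if B
  proof -
    from that obtain c where c: "\<And>x. busemann m h t1 \<gamma>1 x = busemann m h t2 \<gamma>2 x + c" unfolding B_def by blast
    have "bus (\<lambda>t. mass_scale m (\<gamma>1 t)) t1 X = bus (\<lambda>t. mass_scale m (\<gamma>2 t)) t2 X + c" for X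
      using c[unfolded busemann_eq_bus] by (metis mass_scaleE)
    from shapes_eq_if_bus_differ_by_constant[OF scaled_ray[OF g(1) a1] scaled_ray[OF g(2) a2] this]
    have "a1 = a2" using mass_scale_inverse(2)[of m, OF m] by metis
    then show ?thesis using a1 a2 unfolding S_def by blast
  qed
  ultimately show ?thesis unfolding Let_def E_def[symmetric] J_def[symmetric] S_def[symmetric] B_def[symmetric]
    by blast
qed

end
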